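(* Let $A$ be a regular weak multiplier bialgebra over a field $k$ with a right full comultiplication. For a finite dimensional full right $A$-comodule $(V,\lambda,\varrho)$, the left $A$-comodule $(V^*,\lambda^*,\varrho^* )$ on $V^*=\mathsf{Lin}(V,k)$ given by $$\lambda^*(b\otimes\varphi)=\sum_ia_i\otimes(\varphi\otimes\alpha_i)\lambda(-\otimes b),\qquad \varrho^*(b\otimes\varphi)=\sum_ia_i\otimes(\varphi\otimes\alpha_i)\varrho(-\otimes b),$$ where $\{a_i\}$ is a basis of $A$ with coordinate functionals $\alpha_i\in\mathsf{Lin}(A,k)$, is also full.
   Context: Conventions. All vector spaces are over a field $k$; $\otimes$ is $\otimes_k$; the identity map of a space $V$ is also denoted by $V$; composition is juxtaposition; $\mathsf{Lin}(V,W)$ is the space of linear maps; $\mathsf{tw}$ is the flip; $\langle\ldots\rangle$ denotes linear span. For a linear map $f:V\otimes W\to V'\otimes W'$ put $f^{13}=(V'\otimes\mathsf{tw})(f\otimes Z)(V\otimes\mathsf{tw}):V\otimes Z\otimes W\to V'\otimes Z\otimes W'$ for any space $Z$. An associative, possibly non-unital algebra $A$ with multiplication $\mu$ is idempotent if $\mu:A\otimes A\to A$ is surjective, and non-degenerate if each of ($ab=0\ \forall b\in A$) and ($ba=0\ \forall b\in A$) implies $a=0$. A regular weak multiplier bialgebra is an idempotent non-degenerate $k$-algebra $A$ with linear maps $E_1,E_2,T_1,T_2,T_3,T_4:A\otimes A\to A\otimes A$ and $\epsilon:A\to k$ such that for all $a,b,c,d\in A$: (i) $(a\otimes b)E_1(c\otimes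 d)=E_2(a\otimes b)(c\otimes d)$; (ii) $E_1^2=E_1$; (iii) $(T_2\otimes A)(A\otimes T_1)=(A\otimes T_1)(T_2\otimes A)$; (iv) $(\epsilon\otimes A)T_1=\mu=(A\otimes\epsilon)T_2$; (v) $(\mu\otimes A)T_1^{13}(A\otimes T_1)=T_1(\mu\otimes A)$; (vi) $\langle T_1(a\otimes c)(b\otimes 1)\mid a,b,c\in A\rangle=\langle E_1(b\otimes c)\mid b,c\in A\rangle$ and $\langle(1\otimes c)T_2(b\otimes a)\mid a,b,c\in A\rangle=\langle E_2(b\otimes c)\mid b,c\in A\rangle$; (vii) $(E_1\otimes A)(A\otimes T_1)=(A\otimes T_1)(E_1\otimes A)$ and $(E_2\otimes A)(A\otimes T_2)=(A\otimes T_2)E_2^{13}$; (viii) $(\epsilon\otimes A)((1\otimes a)E_1(b\otimes c))=(\epsilon\otimes A)(T_1(a\otimes c)(b\otimes1))$ and $(\epsilon\otimes A)(E_2(a\otimes b)(1\otimes c))=(\epsilon\otimes A)((1\otimes b)T_2(a\otimes c))$; (ix) $(1\otimes a)T_1(c\otimes b)=T_3(c\otimes a)(1\otimes b)$ and $T_2(a\otimes c)(b\otimes1)=(a\otimes1)T_4(b\otimes c)$. (Here $(x\otimes 1)(y\otimes z)=xy\otimes z$, etc.) The comultiplication is right full if $A=\langle(A\otimes\omega)T_1(a\otimes b)\mid a,b\in A,\ \omega\in\mathsf{Lin}(A,k)\rangle$. A right $A$-comodule is a vector space $V$ with linear maps $\lambda,\varrho:V\otimes A\to V\otimes A$ such that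 $(1\otimes a)\lambda(v\otimes b)=\varrho(v\otimes a)(1\otimes b)$ for all $v\in V$, $a,b\in A$, $(\lambda\otimes A)\lambda^{13}(V\otimes E_1)=(\lambda\otimes A)\lambda^{13}$ and $(\lambda\otimes A)\lambda^{13}(V\otimes T_1)=(V\otimes T_1)(\lambda\otimes A)$. It is full if $V=\langle(V\otimes\omega)\lambda(v\otimes a)\mid v\in V,a\in A,\omega\in\mathsf{Lin}(A,k)\rangle$ (equivalently, the same with $\varrho$). A left $A$-comodule is a vector space $V$ with linear maps $\lambda,\varrho:A\otimes V\to A\otimes V$ such that $(a\otimes1)\lambda(b\otimes v)=\varrho(a\otimes v)(b\otimes1)$ for all $v\in V$, $a,b\in A$, $(A\otimes\lambda)\lambda^{13}(E_1\otimes V)=(A\otimes\lambda)\lambda^{13}$ and $(A\otimes\lambda)\lambda^{13}(T_1\otimes V)=(T_1\otimes V)\lambda^{13}$. It is full if $V=\langle(\omega\otimes V)\lambda(a\otimes v)\mid v\in V,a\in A,\omega\in\mathsf{Lin}(A,k)\rangle$ (equivalently, the same with $\varrho$). The expression $(\varphi\otimes\alpha_i)\lambda(-\otimes b)$ denotes the functional $v\mapsto(\varphi\otimes\alpha_i)(\lambda(v\otimes b))$ on $V$; for finite dimensional $V$ the sums defining $\lambda^*,\varrho^*$ have only finitely many non-zero terms and $(V^*,\lambda^*,\varrho^* )$ is a left $A$-comodule. *)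

theory Defs
  imports Complex_Main "HOL-Library.Function_Algebras"
begin

section \<open>Vector spaces with a carrier\<close>

text \<open>
  The dual of a space and the tensor product of two spaces depend on the scalar multiplications
  of these spaces and hence are no types. A space is therefore a subspace of a type.
  Maps between spaces are only considered on the carriers; their values elsewhere are irrelevant.
\<close>

record ('k, 'v) vspace =
  carrier :: "'v set"
  smul :: "'k \<Rightarrow> 'v \<Rightarrow> 'v"

definition is_vspace :: "('k::field, 'v::ab_group_add) vspace \<Rightarrow> bool" where
  "is_vspace V \<longleftrightarrow> vector_space (smul V) \<and> module.subspace (smul V) (carrier V)"

definition lspan :: "('k::field, 'v::ab_group_add) vspace \<Rightarrow> 'v set \<Rightarrow> 'v set" where
  "lspan V S = module.span (smul V) S"

definition is_basis :: "('k::field, 'v::ab_group_add) vspace \<Rightarrow> 'v set \<Rightarrow> bool" where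
  "is_basis V B \<longleftrightarrow> \<not> module.dependent (smul V) B \<and> lspan V B = carrier V"

text \<open>\<open>coord V B i\<close> is the functional on \<open>V\<close> sending \<open>v\<close> to its coordinate at \<open>i \<in> B\<close>.\<close>

definition coord :: "('k::field, 'v::ab_group_add) vspace \<Rightarrow> 'v set \<Rightarrow> 'v \<Rightarrow> 'v \<Rightarrow> 'k" where
  "coord V B i v = module.representation (smul V) B v i"

definition fin_dim :: "('k::field, 'v::ab_group_add) vspace \<Rightarrow> bool" where
  "fin_dim V \<longleftrightarrow> (\<exists>S. finite S \<and> lspan V S = carrier V)"

definition lin :: "('k::field, 'v::ab_group_add) vspace \<Rightarrow> ('k, 'w::ab_group_add) vspace
    \<Rightarrow> ('v \<Rightarrow> 'w) \<Rightarrow> bool" where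
  "lin V W f \<longleftrightarrow>
     (\<forall>x\<in>carrier V. f x \<in> carrier W) \<and>
     (\<forall>x\<in>carrier V. \<forall>y\<in>carrier V. f (x + y) = f x + f y) \<and>
     (\<forall>c. \<forall>x\<in>carrier V. f (smul V c x) = smul W c (f x))"

definition bilin :: "('k::field, 'v::ab_group_add) vspace \<Rightarrow> ('k, 'w::ab_group_add) vspace
    \<Rightarrow> ('k, 'x::ab_group_add) vspace \<Rightarrow> ('v \<Rightarrow> 'w \<Rightarrow> 'x) \<Rightarrow> bool" where
  "bilin V W X \<beta> \<longleftrightarrow>
     (\<forall>v\<in>carrier V. lin W X (\<lambda>w. \<beta> v w)) \<and> (\<forall>w\<in>carrier W. lin V X (\<lambda>v. \<beta> v w))"

definition ground :: "('k::field, 'k) vspace" where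
  "ground = \<lparr>carrier = UNIV, smul = (*)\<rparr>"

definition pointwise :: "'k::field \<Rightarrow> ('x \<Rightarrow> 'k) \<Rightarrow> ('x \<Rightarrow> 'k)" where
  "pointwise c f = (\<lambda>x. c * f x)"

text \<open>Functionals are extended by \<open>0\<close> outside the carrier, so that equality in the dual space is
  equality of functions on the carrier.\<close>

definition dual :: "('k::field, 'v::ab_group_add) vspace \<Rightarrow> ('k, 'v \<Rightarrow> 'k) vspace" where
  "dual V = \<lparr>carrier = {f. lin V ground f \<and> (\<forall>x. x \<notin> carrier V \<longrightarrow> f x = 0)}, smul = pointwise\<rparr>"


section \<open>Tensor products\<close>

text \<open>
  \<open>v \<otimes> w\<close> is the functional \<open>\<beta> \<mapsto> \<beta>(v, w)\<close> on the space of bilinear forms on \<open>V \<times> W\<close>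
  (extended by \<open>0\<close> to all functions of that type), and \<open>V \<otimes> W\<close> is the span of these functionals. The lemmas
  \<open>tlift\<close> and \<open>lin_tens_eqI\<close> below are the universal property.
\<close>

type_synonym ('k, 'v, 'w) tensor = "('v \<Rightarrow> 'w \<Rightarrow> 'k) \<Rightarrow> 'k"

definition pure :: "('k::field, 'v::ab_group_add) vspace \<Rightarrow> ('k, 'w::ab_group_add) vspace
    \<Rightarrow> 'v \<Rightarrow> 'w \<Rightarrow> ('k, 'v, 'w) tensor" where
  "pure V W v w = (\<lambda>\<beta>. if bilin V W ground \<beta> then \<beta> v w else 0)"

definition tens :: "('k::field, 'v::ab_group_add) vspace \<Rightarrow> ('k, 'w::ab_group_add) vspace
    \<Rightarrow> ('k, ('k, 'v, 'w) tensor) vspace" (infixl \<open>\<otimes>\<close> 70) where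
  "V \<otimes> W = \<lparr>carrier = module.span pointwise {pure V W v w | v w. v \<in> carrier V \<and> w \<in> carrier W},
            smul = pointwise\<rparr>"

text \<open>The linear map \<open>V \<otimes> W \<rightarrow> X\<close> induced by a bilinear map \<open>\<beta>\<close>.\<close>

definition tlift :: "('k::field, 'v::ab_group_add) vspace \<Rightarrow> ('k, 'w::ab_group_add) vspace
    \<Rightarrow> ('k, 'x::ab_group_add) vspace \<Rightarrow> ('v \<Rightarrow> 'w \<Rightarrow> 'x) \<Rightarrow> ('k, 'v, 'w) tensor \<Rightarrow> 'x" where
  "tlift V W X \<beta> = (SOME h. lin (V \<otimes> W) X h \<and>
     (\<forall>v\<in>carrier V. \<forall>w\<in>carrier W. h (pure V W v w) = \<beta> v w))"

lemma vector_space_pointwise: "vector_space pointwise"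
  by unfold_locales (auto simp: pointwise_def fun_eq_iff algebra_simps)

lemma is_vspace_ground: "is_vspace ground"
proof -
  interpret vector_space "(*) :: 'k::field \<Rightarrow> 'k \<Rightarrow> 'k"
    by unfold_locales (auto simp: algebra_simps)
  show "is_vspace (ground :: ('k, 'k) vspace)"
    using vector_space_axioms by (auto simp: is_vspace_def ground_def)
qed

lemma is_vspace_tens: "is_vspace (V \<otimes> W)"
proof -
  interpret vector_space pointwise by (rule vector_space_pointwise)
  show ?thesis
    unfolding is_vspace_def tens_def using vector_space_axioms by simp
qed

lemma is_vspace_dual:
  assumes "is_vspace V"
  shows "is_vspace (dual V)"
proof -
  interpret P: vector_space pointwise by (rule vector_space_pointwise)
  interpret V: vector_space "smul V" using assms by (simp add: is_vspace_def)
  have "V.subspace (carrier V)" using assms by (simp add: is_vspace_def)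
  then have "P.subspace (carrier (dual V))"
    by (intro P.subspaceI)
      (auto simp: dual_def lin_def ground_def pointwise_def algebra_simps)
  then show ?thesis
    using P.vector_space_axioms by (simp add: is_vspace_def dual_def)
qed

lemma pure_in_tens: "v \<in> carrier V \<Longrightarrow> w \<in> carrier W \<Longrightarrow> pure V W v w \<in> carrier (V \<otimes> W)"
proof -
  interpret vector_space pointwise by (rule vector_space_pointwise)
  show "v \<in> carrier V \<Longrightarrow> w \<in> carrier W \<Longrightarrow> ?thesis"
    unfolding tens_def by (auto intro: span_base)
qed

lemma bilin_pure:
  assumes "is_vspace V" "is_vspace W"
  shows "bilin V W (V \<otimes> W) (pure V W)"
  unfolding bilin_def lin_def
  using pure_in_tens[of _ V _ W]
  by (auto simp: pure_def fun_eq_iff tens_def pointwise_def)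
    (auto simp: bilin_def lin_def ground_def)

lemma tens_induct [consumes 1, case_names zero add]:
  assumes t: "t \<in> carrier (V \<otimes> W)"
    and z: "P 0"
    and a: "\<And>c v w t. v \<in> carrier V \<Longrightarrow> w \<in> carrier W \<Longrightarrow> t \<in> carrier (V \<otimes> W) \<Longrightarrow> P t \<Longrightarrow>
      P (smul (V \<otimes> W) c (pure V W v w) + t)"
  shows "P t"
proof -
  interpret vector_space pointwise by (rule vector_space_pointwise)
  have "t \<in> span {pure V W v w | v w. v \<in> carrier V \<and> w \<in> carrier W}"
    using t by (simp add: tens_def)
  then have "t \<in> carrier (V \<otimes> W) \<and> P t"
  proof (induction rule: span_induct_alt)
    case base
    have "0 \<in> carrier (V \<otimes> W)" unfolding tens_def vspace.simps by (rule span_zero)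
    then show ?case using z by blast
  next
    case (step c x y)
    then obtain v w where x: "x = pure V W v w" and v: "v \<in> carrier V" and w: "w \<in> carrier W"
      by blast
    have y: "y \<in> carrier (V \<otimes> W)" and P: "P y" using step by blast+
    have "P (pointwise c x + y)"
      using a[OF v w y P, of c] unfolding x tens_def vspace.simps .
    moreover have "pointwise c x + y \<in> carrier (V \<otimes> W)"
      using pure_in_tens[OF v w] y unfolding x tens_def vspace.simps
      by (intro span_add span_scale)
    ultimately show ?case by blast
  qed
  then show ?thesis ..
qed

lemma functionals_separate:
  assumes X: "is_vspace X" and x: "\<And>g. lin X ground g \<Longrightarrow> g x = g y"
  shows "x = y"
proof (rule ccontr)
  assume ne: "x \<noteq> y"
  interpret X: vector_space "smul X" using X by (simp add: is_vspace_def)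
  interpret K: vector_space "(*) :: 'a \<Rightarrow> 'a \<Rightarrow> 'a"
    by unfold_locales (auto simp: algebra_simps)
  interpret P: vector_space_pair "smul X" "(*) :: 'a \<Rightarrow> 'a \<Rightarrow> 'a" ..
  from ne have "X.independent {x - y}" by simp
  from P.linear_independent_extend[OF this, of "\<lambda>_. 1"] obtain g
    where g: "Vector_Spaces.linear (smul X) (*) g" "g (x - y) = 1" by auto
  interpret g: Vector_Spaces.linear "smul X" "(*)" g by (rule g)
  have "lin X ground g" by (simp add: lin_def ground_def g.add g.scale)
  from x[OF this] have "g (x - y) = 0" by (simp add: g.diff)
  with g show False by simp
qed

lemma lin_zero:
  assumes "is_vspace V" "is_vspace W" "lin V W h"
  shows "h 0 = 0"
proof -
  interpret V: vector_space "smul V" using assms by (simp add: is_vspace_def)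
  have "0 \<in> carrier V" using assms by (simp add: is_vspace_def V.subspace_0)
  then have "h (0 + 0) = h 0 + h 0" using assms(3) by (simp only: lin_def)
  then show ?thesis by simp
qed

lemma lin_tens_eqI:
  assumes X: "is_vspace X" and h: "lin (V \<otimes> W) X h" "lin (V \<otimes> W) X h'"
    and eq: "\<And>v w. v \<in> carrier V \<Longrightarrow> w \<in> carrier W \<Longrightarrow> h (pure V W v w) = h' (pure V W v w)"
    and t: "t \<in> carrier (V \<otimes> W)"
  shows "h t = h' t"
  using t
proof (induction rule: tens_induct)
  case zero
  show ?case using lin_zero[OF is_vspace_tens X] h by metis
next
  case (add c v w t)
  interpret T: vector_space "smul (V \<otimes> W)"
    using is_vspace_tens[of V W] by (simp add: is_vspace_def)
  have "smul (V \<otimes> W) c (pure V W v w) \<in> carrier (V \<otimes> W)"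
    using is_vspace_tens[of V W] add by (simp add: is_vspace_def T.subspace_scale pure_in_tens)
  then have "g (smul (V \<otimes> W) c (pure V W v w) + t) = smul X c (g (pure V W v w)) + g t"
    if "lin (V \<otimes> W) X g" for g
    using that add(1-3) unfolding lin_def by (metis pure_in_tens)
  then show ?case
    using h add eq by metis
qed

lemma tlift:
  fixes V :: "('k::field, 'v::ab_group_add) vspace" and W :: "('k, 'w::ab_group_add) vspace"
    and X :: "('k, 'x::ab_group_add) vspace"
  assumes X: "is_vspace X" and b: "bilin V W X \<beta>"
  shows lin_tlift: "lin (V \<otimes> W) X (tlift V W X \<beta>)"
    and tlift_pure: "v \<in> carrier V \<Longrightarrow> w \<in> carrier W \<Longrightarrow> tlift V W X \<beta> (pure V W v w) = \<beta> v w"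
proof -
  interpret X: vector_space "smul X" using X by (simp add: is_vspace_def)
  have sX: "X.subspace (carrier X)" using X by (simp add: is_vspace_def)
  define R where "R t x \<longleftrightarrow> x \<in> carrier X \<and>
    (\<forall>g. lin X ground g \<longrightarrow> g x = t (\<lambda>v w. g (\<beta> v w)))" for t x
  have uniq: "x = y" if "R t x" "R t y" for t x y
    using that by (intro functionals_separate[OF X]) (auto simp: R_def)
  have gb: "bilin V W ground (\<lambda>v w. g (\<beta> v w))" if "lin X ground g" for g
    using that b by (simp add: bilin_def lin_def)
  have Rp: "R (pure V W v w) (\<beta> v w)" if "v \<in> carrier V" "w \<in> carrier W" for v w
    using that b gb by (auto simp: R_def pure_def bilin_def lin_def)
  have Radd: "R (t + t') (x + x')" if "R t x" "R t' x'" for t t' x x'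
    using that X.subspace_add[OF sX, of x x'] by (auto simp: R_def lin_def)
  have Rscale: "R (smul (V \<otimes> W) c t) (smul X c x)" if "R t x" for c t x
    using that X.subspace_scale[OF sX, of x c]
    by (auto simp: R_def lin_def tens_def pointwise_def ground_def)
  have ex: "\<exists>x. R t x" if "t \<in> carrier (V \<otimes> W)" for t
    using that
  proof (induction rule: tens_induct)
    case zero
    have "R 0 0" using lin_zero[OF X is_vspace_ground] X.subspace_0[OF sX] by (auto simp: R_def)
    then show ?case ..
  next
    case (add c v w t)
    then show ?case using Radd Rscale Rp by blast
  qed
  define h where "h t = (SOME x. R t x)" for t
  have hI: "h t = x" if "R t x" for t x
    unfolding h_def using that uniq by (metis someI)
  have Rh: "R t (h t)" if "t \<in> carrier (V \<otimes> W)" for t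
    using ex[OF that] hI by blast
  have "lin (V \<otimes> W) X h"
    unfolding lin_def using Rh by (auto simp: R_def[of _ "h _"] intro!: hI Radd Rscale)
  moreover have "\<forall>v\<in>carrier V. \<forall>w\<in>carrier W. h (pure V W v w) = \<beta> v w"
    using Rp hI by blast
  ultimately have "\<exists>h. lin (V \<otimes> W) X h \<and>
     (\<forall>v\<in>carrier V. \<forall>w\<in>carrier W. h (pure V W v w) = \<beta> v w)" by blast
  from someI_ex[OF this] show "lin (V \<otimes> W) X (tlift V W X \<beta>)"
    and "v \<in> carrier V \<Longrightarrow> w \<in> carrier W \<Longrightarrow> tlift V W X \<beta> (pure V W v w) = \<beta> v w"
    unfolding tlift_def by blast+
qed


subsection \<open>Maps between tensor products\<close>

text \<open>In \<open>tens_map V W V' W' f g\<close>, the map \<open>f \<otimes> g\<close> goes from \<open>V \<otimes> W\<close> to \<open>V' \<otimes> W'\<close>.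
  The maps \<open>V \<otimes> \<omega>\<close>, \<open>\<omega> \<otimes> W\<close> and \<open>\<phi> \<otimes> \<omega>\<close> for functionals \<open>\<phi>\<close>, \<open>\<omega>\<close> are composed with
  \<open>V \<otimes> k \<cong> V\<close>, \<open>k \<otimes> W \<cong> W\<close> and \<open>k \<otimes> k \<cong> k\<close>.\<close>

definition tens_map :: "('k::field, 'v::ab_group_add) vspace \<Rightarrow> ('k, 'w::ab_group_add) vspace
    \<Rightarrow> ('k, 'p::ab_group_add) vspace \<Rightarrow> ('k, 'q::ab_group_add) vspace
    \<Rightarrow> ('v \<Rightarrow> 'p) \<Rightarrow> ('w \<Rightarrow> 'q) \<Rightarrow> ('k, 'v, 'w) tensor \<Rightarrow> ('k, 'p, 'q) tensor" where
  "tens_map V W V' W' f g = tlift V W (V' \<otimes> W') (\<lambda>v w. pure V' W' (f v) (g w))"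

definition slice_right :: "('k::field, 'v::ab_group_add) vspace \<Rightarrow> ('k, 'w::ab_group_add) vspace
    \<Rightarrow> ('w \<Rightarrow> 'k) \<Rightarrow> ('k, 'v, 'w) tensor \<Rightarrow> 'v" where
  "slice_right V W \<omega> = tlift V W V (\<lambda>v w. smul V (\<omega> w) v)"

definition slice_left :: "('k::field, 'v::ab_group_add) vspace \<Rightarrow> ('k, 'w::ab_group_add) vspace
    \<Rightarrow> ('v \<Rightarrow> 'k) \<Rightarrow> ('k, 'v, 'w) tensor \<Rightarrow> 'w" where
  "slice_left V W \<omega> = tlift V W W (\<lambda>v w. smul W (\<omega> v) w)"

definition slice_both :: "('k::field, 'v::ab_group_add) vspace \<Rightarrow> ('k, 'w::ab_group_add) vspace
    \<Rightarrow> ('v \<Rightarrow> 'k) \<Rightarrow> ('w \<Rightarrow> 'k) \<Rightarrow> ('k, 'v, 'w) tensor \<Rightarrow> 'k" where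
  "slice_both V W \<phi> \<omega> = tlift V W ground (\<lambda>v w. \<phi> v * \<omega> w)"

definition flip :: "('k::field, 'v::ab_group_add) vspace \<Rightarrow> ('k, 'w::ab_group_add) vspace
    \<Rightarrow> ('k, 'v, 'w) tensor \<Rightarrow> ('k, 'w, 'v) tensor" where
  "flip V W = tlift V W (W \<otimes> V) (\<lambda>v w. pure W V w v)"

definition assoc :: "('k::field, 'v::ab_group_add) vspace \<Rightarrow> ('k, 'w::ab_group_add) vspace
    \<Rightarrow> ('k, 'z::ab_group_add) vspace
    \<Rightarrow> ('k, ('k, 'v, 'w) tensor, 'z) tensor \<Rightarrow> ('k, 'v, ('k, 'w, 'z) tensor) tensor" where
  "assoc V W Z = tlift (V \<otimes> W) Z (V \<otimes> (W \<otimes> Z))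
     (\<lambda>t z. tlift V W (V \<otimes> (W \<otimes> Z)) (\<lambda>v w. pure V (W \<otimes> Z) v (pure W Z w z)) t)"

definition unassoc :: "('k::field, 'v::ab_group_add) vspace \<Rightarrow> ('k, 'w::ab_group_add) vspace
    \<Rightarrow> ('k, 'z::ab_group_add) vspace
    \<Rightarrow> ('k, 'v, ('k, 'w, 'z) tensor) tensor \<Rightarrow> ('k, ('k, 'v, 'w) tensor, 'z) tensor" where
  "unassoc V W Z = tlift V (W \<otimes> Z) (V \<otimes> W \<otimes> Z)
     (\<lambda>v t. tlift W Z (V \<otimes> W \<otimes> Z) (\<lambda>w z. pure (V \<otimes> W) Z (pure V W v w) z) t)"

text \<open>Threefold tensor products are bracketed to the left. For endomorphisms \<open>f\<close> of
  \<open>X \<otimes> Y\<close>, of \<open>Y \<otimes> Z\<close> and of \<open>X \<otimes> Z\<close>, respectively, these are the endomorphisms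
  \<open>f \<otimes> Z\<close>, \<open>X \<otimes> f\<close> and \<open>f\<^sup>1\<^sup>3\<close> of \<open>X \<otimes> Y \<otimes> Z\<close>.\<close>

definition leg12 :: "('k::field, 'x::ab_group_add) vspace \<Rightarrow> ('k, 'y::ab_group_add) vspace
    \<Rightarrow> ('k, 'z::ab_group_add) vspace
    \<Rightarrow> (('k, 'x, 'y) tensor \<Rightarrow> ('k, 'x, 'y) tensor)
    \<Rightarrow> ('k, ('k, 'x, 'y) tensor, 'z) tensor \<Rightarrow> ('k, ('k, 'x, 'y) tensor, 'z) tensor" where
  "leg12 X Y Z f = tens_map (X \<otimes> Y) Z (X \<otimes> Y) Z f id"

definition leg23 :: "('k::field, 'x::ab_group_add) vspace \<Rightarrow> ('k, 'y::ab_group_add) vspace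
    \<Rightarrow> ('k, 'z::ab_group_add) vspace
    \<Rightarrow> (('k, 'y, 'z) tensor \<Rightarrow> ('k, 'y, 'z) tensor)
    \<Rightarrow> ('k, ('k, 'x, 'y) tensor, 'z) tensor \<Rightarrow> ('k, ('k, 'x, 'y) tensor, 'z) tensor" where
  "leg23 X Y Z f = unassoc X Y Z \<circ> tens_map X (Y \<otimes> Z) X (Y \<otimes> Z) id f \<circ> assoc X Y Z"

definition flip23 :: "('k::field, 'x::ab_group_add) vspace \<Rightarrow> ('k, 'y::ab_group_add) vspace
    \<Rightarrow> ('k, 'z::ab_group_add) vspace
    \<Rightarrow> ('k, ('k, 'x, 'y) tensor, 'z) tensor \<Rightarrow> ('k, ('k, 'x, 'z) tensor, 'y) tensor" where
  "flip23 X Y Z = unassoc X Z Y \<circ> tens_map X (Y \<otimes> Z) X (Z \<otimes> Y) id (flip Y Z) \<circ> assoc X Y Z"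

definition leg13 :: "('k::field, 'x::ab_group_add) vspace \<Rightarrow> ('k, 'y::ab_group_add) vspace
    \<Rightarrow> ('k, 'z::ab_group_add) vspace
    \<Rightarrow> (('k, 'x, 'z) tensor \<Rightarrow> ('k, 'x, 'z) tensor)
    \<Rightarrow> ('k, ('k, 'x, 'y) tensor, 'z) tensor \<Rightarrow> ('k, ('k, 'x, 'y) tensor, 'z) tensor" where
  "leg13 X Y Z f = flip23 X Z Y \<circ> leg12 X Z Y f \<circ> flip23 X Y Z"

text \<open>The endomorphism \<open>f \<otimes> g\<close> of \<open>V \<otimes> W\<close>. With multiplications by elements of \<open>A\<close> as \<open>f\<close> and
  \<open>g\<close> it renders products such as \<open>(1 \<otimes> a) t\<close> and \<open>t (b \<otimes> 1)\<close>, where \<open>1\<close> acts as \<open>id\<close>.\<close>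

definition tact :: "('k::field, 'v::ab_group_add) vspace \<Rightarrow> ('k, 'w::ab_group_add) vspace
    \<Rightarrow> ('v \<Rightarrow> 'v) \<Rightarrow> ('w \<Rightarrow> 'w) \<Rightarrow> ('k, 'v, 'w) tensor \<Rightarrow> ('k, 'v, 'w) tensor" where
  "tact V W f g = tens_map V W V W f g"


section \<open>Regular weak multiplier bialgebras\<close>

locale idempotent_nondegenerate_algebra =
  fixes A :: "('k::field, 'a::ring) vspace"
  assumes vspace: "vector_space (smul A)"
    and carrier_UNIV: "carrier A = UNIV"
    and smul_mult_left: "smul A c x * y = smul A c (x * y)"
    and smul_mult_right: "x * smul A c y = smul A c (x * y)"
    and idempotent: "tlift A A A (*) ` carrier (A \<otimes> A) = UNIV"
    and nondegenerate_left: "(\<forall>b::'a. a * b = 0) \<Longrightarrow> a = 0"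
    and nondegenerate_right: "(\<forall>b::'a. b * a = 0) \<Longrightarrow> a = 0"
begin

abbreviation A2 where "A2 \<equiv> A \<otimes> A"
abbreviation A3 where "A3 \<equiv> A \<otimes> A \<otimes> A"
abbreviation pureA (infix \<open>\<odot>\<close> 75) where "a \<odot> b \<equiv> pure A A a b"
abbreviation mu where "mu \<equiv> tlift A A A (*)"

end

locale regular_weak_multiplier_bialgebra = idempotent_nondegenerate_algebra A
  for A :: "('k::field, 'a::ring) vspace" +
  fixes E1 E2 T1 T2 T3 T4 :: "('k, 'a, 'a) tensor \<Rightarrow> ('k, 'a, 'a) tensor"
    and counit :: "'a \<Rightarrow> 'k"
  assumes lin_maps: "lin A2 A2 E1" "lin A2 A2 E2" "lin A2 A2 T1" "lin A2 A2 T2"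
      "lin A2 A2 T3" "lin A2 A2 T4"
    and lin_counit: "lin A ground counit"
    and E1_E2: "tact A A ((*) a) ((*) b) (E1 (c \<odot> d)) =
      tact A A (\<lambda>x. x * c) (\<lambda>x. x * d) (E2 (a \<odot> b))"
    and E1_idem: "t \<in> carrier A2 \<Longrightarrow> E1 (E1 t) = E1 t"
    and T2_T1: "s \<in> carrier A3 \<Longrightarrow>
      leg12 A A A T2 (leg23 A A A T1 s) = leg23 A A A T1 (leg12 A A A T2 s)"
    and counit_T1: "t \<in> carrier A2 \<Longrightarrow> slice_left A A counit (T1 t) = mu t"
    and counit_T2: "t \<in> carrier A2 \<Longrightarrow> slice_right A A counit (T2 t) = mu t"
    and T1_mult: "s \<in> carrier A3 \<Longrightarrow>
      tens_map A2 A A A mu id (leg13 A A A T1 (leg23 A A A T1 s)) = T1 (tens_map A2 A A A mu id s)"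
    and range_E1: "lspan A2 {tact A A (\<lambda>x. x * b) id (T1 (a \<odot> c)) | a b c. True} =
      lspan A2 {E1 (b \<odot> c) | b c. True}"
    and range_E2: "lspan A2 {tact A A id ((*) c) (T2 (b \<odot> a)) | a b c. True} =
      lspan A2 {E2 (b \<odot> c) | b c. True}"
    and E1_T1: "s \<in> carrier A3 \<Longrightarrow>
      leg12 A A A E1 (leg23 A A A T1 s) = leg23 A A A T1 (leg12 A A A E1 s)"
    and E2_T2: "s \<in> carrier A3 \<Longrightarrow>
      leg12 A A A E2 (leg23 A A A T2 s) = leg23 A A A T2 (leg13 A A A E2 s)"
    and counit_E1: "slice_left A A counit (tact A A id ((*) a) (E1 (b \<odot> c))) =
      slice_left A A counit (tact A A (\<lambda>x. x * b) id (T1 (a \<odot> c)))"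
    and counit_E2: "slice_left A A counit (tact A A id (\<lambda>x. x * c) (E2 (a \<odot> b))) =
      slice_left A A counit (tact A A id ((*) b) (T2 (a \<odot> c)))"
    and T1_T3: "tact A A id ((*) a) (T1 (c \<odot> b)) = tact A A id (\<lambda>x. x * b) (T3 (c \<odot> a))"
    and T2_T4: "tact A A (\<lambda>x. x * b) id (T2 (a \<odot> c)) = tact A A ((*) a) id (T4 (b \<odot> c))"

definition right_full_comultiplication :: "('k::field, 'a::ring) vspace \<Rightarrow> (('k, 'a, 'a) tensor \<Rightarrow> ('k, 'a, 'a) tensor) \<Rightarrow> bool" where
  "right_full_comultiplication A T1 \<longleftrightarrow>
     carrier A = lspan A {slice_right A A \<omega> (T1 (pure A A a b)) | a b \<omega>.
       a \<in> carrier A \<and> b \<in> carrier A \<and> \<omega> \<in> carrier (dual A)}"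


section \<open>Comodules\<close>

definition right_comodule :: "('k::field, 'a::ring) vspace \<Rightarrow> (('k, 'a, 'a) tensor \<Rightarrow> ('k, 'a, 'a) tensor) \<Rightarrow> (('k, 'a, 'a) tensor \<Rightarrow> ('k, 'a, 'a) tensor)
    \<Rightarrow> ('k, 'v::ab_group_add) vspace \<Rightarrow> (('k, 'v, 'a) tensor \<Rightarrow> ('k, 'v, 'a) tensor)
    \<Rightarrow> (('k, 'v, 'a) tensor \<Rightarrow> ('k, 'v, 'a) tensor) \<Rightarrow> bool" where
  "right_comodule A E1 T1 V lam rho \<longleftrightarrow>
     is_vspace V \<and> lin (V \<otimes> A) (V \<otimes> A) lam \<and> lin (V \<otimes> A) (V \<otimes> A) rho \<and>
     (\<forall>v\<in>carrier V. \<forall>a\<in>carrier A. \<forall>b\<in>carrier A.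
        tact V A id ((*) a) (lam (pure V A v b)) = tact V A id (\<lambda>x. x * b) (rho (pure V A v a))) \<and>
     (\<forall>t\<in>carrier (V \<otimes> A \<otimes> A).
        leg12 V A A lam (leg13 V A A lam (leg23 V A A E1 t)) = leg12 V A A lam (leg13 V A A lam t)) \<and>
     (\<forall>t\<in>carrier (V \<otimes> A \<otimes> A).
        leg12 V A A lam (leg13 V A A lam (leg23 V A A T1 t)) = leg23 V A A T1 (leg12 V A A lam t))"

definition full_right :: "('k::field, 'a::ring) vspace \<Rightarrow> ('k, 'v::ab_group_add) vspace
    \<Rightarrow> (('k, 'v, 'a) tensor \<Rightarrow> ('k, 'v, 'a) tensor) \<Rightarrow> bool" where
  "full_right A V lam \<longleftrightarrow>
     carrier V = lspan V {slice_right V A \<omega> (lam (pure V A v a)) | v a \<omega>.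
       v \<in> carrier V \<and> a \<in> carrier A \<and> \<omega> \<in> carrier (dual A)}"

definition left_comodule :: "('k::field, 'a::ring) vspace \<Rightarrow> (('k, 'a, 'a) tensor \<Rightarrow> ('k, 'a, 'a) tensor) \<Rightarrow> (('k, 'a, 'a) tensor \<Rightarrow> ('k, 'a, 'a) tensor)
    \<Rightarrow> ('k, 'v::ab_group_add) vspace \<Rightarrow> (('k, 'a, 'v) tensor \<Rightarrow> ('k, 'a, 'v) tensor)
    \<Rightarrow> (('k, 'a, 'v) tensor \<Rightarrow> ('k, 'a, 'v) tensor) \<Rightarrow> bool" where
  "left_comodule A E1 T1 V lam rho \<longleftrightarrow>
     is_vspace V \<and> lin (A \<otimes> V) (A \<otimes> V) lam \<and> lin (A \<otimes> V) (A \<otimes> V) rho \<and>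
     (\<forall>v\<in>carrier V. \<forall>a\<in>carrier A. \<forall>b\<in>carrier A.
        tact A V ((*) a) id (lam (pure A V b v)) = tact A V (\<lambda>x. x * b) id (rho (pure A V a v))) \<and>
     (\<forall>t\<in>carrier (A \<otimes> A \<otimes> V).
        leg23 A A V lam (leg13 A A V lam (leg12 A A V E1 t)) = leg23 A A V lam (leg13 A A V lam t)) \<and>
     (\<forall>t\<in>carrier (A \<otimes> A \<otimes> V).
        leg23 A A V lam (leg13 A A V lam (leg12 A A V T1 t)) = leg12 A A V T1 (leg13 A A V lam t))"

definition full_left :: "('k::field, 'a::ring) vspace \<Rightarrow> ('k, 'v::ab_group_add) vspace
    \<Rightarrow> (('k, 'a, 'v) tensor \<Rightarrow> ('k, 'a, 'v) tensor) \<Rightarrow> bool" where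
  "full_left A V lam \<longleftrightarrow>
     carrier V = lspan V {slice_left A V \<omega> (lam (pure A V a v)) | a v \<omega>.
       v \<in> carrier V \<and> a \<in> carrier A \<and> \<omega> \<in> carrier (dual A)}"

text \<open>
  \<open>dual_summand A B V lam b \<phi> i\<close> is \<open>i \<otimes> (\<phi> \<otimes> \<alpha>\<^sub>i) lam(- \<otimes> b)\<close>, where \<open>\<alpha>\<^sub>i\<close> is the coordinate
  functional of the element \<open>i\<close> of the basis \<open>B\<close>. If \<open>V\<close> has finite dimension, then for given \<open>b\<close>
  and \<open>\<phi>\<close> only finitely many summands are non-zero; \<open>sum\<close> needs this restriction, as it is \<open>0\<close> over
  infinite index sets.
\<close>

definition dual_summand :: "('k::field, 'a::ring) vspace \<Rightarrow> 'a set \<Rightarrow> ('k, 'v::ab_group_add) vspace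
    \<Rightarrow> (('k, 'v, 'a) tensor \<Rightarrow> ('k, 'v, 'a) tensor) \<Rightarrow> 'a \<Rightarrow> ('v \<Rightarrow> 'k) \<Rightarrow> 'a
    \<Rightarrow> ('k, 'a, 'v \<Rightarrow> 'k) tensor" where
  "dual_summand A B V lam b \<phi> i = pure A (dual V) i
     (\<lambda>v. if v \<in> carrier V then slice_both V A \<phi> (coord A B i) (lam (pure V A v b)) else 0)"

definition dual_coaction :: "('k::field, 'a::ring) vspace \<Rightarrow> 'a set \<Rightarrow> ('k, 'v::ab_group_add) vspace
    \<Rightarrow> (('k, 'v, 'a) tensor \<Rightarrow> ('k, 'v, 'a) tensor)
    \<Rightarrow> ('k, 'a, 'v \<Rightarrow> 'k) tensor \<Rightarrow> ('k, 'a, 'v \<Rightarrow> 'k) tensor" where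
  "dual_coaction A B V lam = tlift A (dual V) (A \<otimes> dual V)
     (\<lambda>b \<phi>. \<Sum>i | i \<in> B \<and> dual_summand A B V lam b \<phi> i \<noteq> 0. dual_summand A B V lam b \<phi> i)"

end

theory Submission
  imports Defs
begin

text \<open>
  Let \<open>(u\<^sub>i)\<close> be a basis of \<open>V\<close> and write \<open>\<lambda>(u\<^sub>j \<otimes> a) = \<Sum>\<^sub>i u\<^sub>i \<otimes> L\<^sub>i\<^sub>j(a)\<close>. Passing to the dual space
  transposes the matrix \<open>L\<close>: on the dual basis \<open>(u\<^sup>i)\<close> the coaction is
  \<open>\<lambda>\<^sup>*(b \<otimes> u\<^sup>k) = \<Sum>\<^sub>j L\<^sub>k\<^sub>j(b) \<otimes> u\<^sup>j\<close>. The axioms of a right comodule for \<open>V\<close> and those of a left comodule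
  for the dual are the same identities,
  \<open>\<Sum>\<^sub>i (L\<^sub>k\<^sub>i \<otimes> L\<^sub>i\<^sub>j) E\<^sub>1 = \<Sum>\<^sub>i L\<^sub>k\<^sub>i \<otimes> L\<^sub>i\<^sub>j\<close> and \<open>\<Sum>\<^sub>i (L\<^sub>k\<^sub>i \<otimes> L\<^sub>i\<^sub>j) T\<^sub>1 = T\<^sub>1 (L\<^sub>k\<^sub>j \<otimes> A)\<close>,
  together with a compatibility of each \<open>L\<^sub>i\<^sub>j\<close> with its counterpart for \<open>\<varrho>\<close>. So the dual is a left
  comodule for formal reasons (\<open>left_comodule_dual\<close>).

  Fullness of \<open>V\<close> says that no linear relation holds between the rows of \<open>L\<close>
  (\<open>rows_independent\<close>), fullness of the dual that none holds between the columns. The heart of the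
  matter is that independent rows imply independent columns (\<open>columns_independent\<close>):
  if \<open>\<lambda>(n \<otimes> a) = 0\<close> for all \<open>a\<close>, then \<open>n = 0\<close>.

  Write \<open>\<epsilon>\<close> for the counit, \<open>\<pi>(b) a = (\<epsilon> \<otimes> A) E\<^sub>1(b \<otimes> a)\<close>, and use Sweedler notation as if \<open>A\<close> had a unit:
  \<open>\<Delta>(a) = a\<^sub>1 \<otimes> a\<^sub>2\<close>, \<open>\<lambda>(v \<otimes> a) = v\<^sub>0 \<otimes> v\<^sub>1a\<close>, \<open>E = 1\<^sub>1 \<otimes> 1\<^sub>2\<close> and \<open>\<pi>(b) = \<epsilon>(1\<^sub>1b) 1\<^sub>2\<close>.
  As \<open>\<lambda>(v \<otimes> yz) = v\<^sub>0 \<epsilon>(v\<^sub>1y\<^sub>1) \<otimes> v\<^sub>2y\<^sub>2z\<close>, fullness allows us to write each vector \<open>n\<close> of \<open>V\<close> in the form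
  \<open>n = \<Sum>\<^sub>m (V \<otimes> \<epsilon>)\<lambda>(u\<^sub>m \<otimes> a\<^sub>m)\<close>, where moreover \<open>\<epsilon>(\<pi>(b)a\<^sub>m)\<close> is the \<open>m\<close>-th coordinate of
  \<open>(V \<otimes> \<epsilon>)\<lambda>(n \<otimes> b)\<close> (\<open>all_reached\<close>). If \<open>\<lambda>(n \<otimes> -) = 0\<close>, we obtain \<open>\<epsilon>(\<pi>(b)a\<^sub>m) = 0\<close> for all \<open>b\<close>.
  By \<open>counit_left_zero\<close> this improves to \<open>\<epsilon>(za\<^sub>m) = 0\<close> for all \<open>z\<close>, hence \<open>\<pi>(a\<^sub>m) = 0\<close> because of
  \<open>z \<pi>(a) = \<epsilon>(z\<^sub>1a) z\<^sub>2\<close>. Now \<open>v\<^sub>0 \<epsilon>(v\<^sub>1b) \<otimes> v\<^sub>2y = v\<^sub>0 \<otimes> v\<^sub>1\<pi>(b)y\<close> (\<open>counit_entry_pi_L\<close>) vanishes for \<open>b = a\<^sub>m\<close>,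
  and the independence of the rows turns this into \<open>(V \<otimes> \<epsilon>)\<lambda>(u \<otimes> a\<^sub>m) = 0\<close> for all \<open>u\<close>. So \<open>n = 0\<close>.

  The fact \<open>counit_left_zero\<close> about \<open>A\<close> is proved as follows. Let \<open>\<epsilon>(\<pi>(b)a) = 0\<close> for all \<open>b\<close>. Since
  \<open>1\<^sub>1 \<otimes> 1\<^sub>2\<pi>(d)a = 1\<^sub>1 \<otimes> \<pi>(1\<^sub>2d)a\<close> (\<open>E1_pi_L_ev\<close>), we get \<open>1\<^sub>1 \<epsilon>(1\<^sub>2\<pi>(d)a) = 0\<close>. The identity
  \<open>z\<^sub>1 \<epsilon>(z\<^sub>2a) = z 1\<^sub>1 \<epsilon>(1\<^sub>2a)\<close> (\<open>counit_E1_right_ev\<close>), a mirror image of one of the axioms, yields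
  \<open>z\<^sub>1 \<epsilon>(z\<^sub>2\<pi>(d)a) = 0\<close>. Then \<open>z\<^sub>1x \<epsilon>(z\<^sub>2a) = z\<^sub>1x\<^sub>1 \<epsilon>(z\<^sub>2x\<^sub>2) \<epsilon>(z\<^sub>3a) = z\<^sub>1x\<^sub>1 \<epsilon>(z\<^sub>2\<pi>(x\<^sub>2)a) = 0\<close> for all \<open>x\<close>, so that
  \<open>z\<^sub>1 \<epsilon>(z\<^sub>2a) = 0\<close> by non-degeneracy, and applying \<open>\<epsilon>\<close> gives \<open>\<epsilon>(za) = 0\<close>.

  All these computations are carried out with scalars. A tensor is a functional on bilinear forms, so
  its value at \<open>F\<close>, written \<open>ev t F\<close> below, is what Sweedler notation writes as \<open>F(t\<^sub>1, t\<^sub>2)\<close>. An identity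
  between operators on a threefold tensor product becomes an identity between iterated evaluations,
  and an identity that only holds after multiplication by an arbitrary element of \<open>A\<close> is
  freed from this factor by non-degeneracy (\<open>cancel_left\<close>, \<open>cancel_right\<close>).
\<close>

section \<open>Evaluation of tensors at bilinear forms\<close>

lemma lin_ground_iff:
  "lin V ground g \<longleftrightarrow>
    (\<forall>x\<in>carrier V. \<forall>y\<in>carrier V. g (x + y) = g x + g y) \<and>
    (\<forall>c. \<forall>x\<in>carrier V. g (smul V c x) = c * g x)"
  by (auto simp: lin_def ground_def)

lemma lin_compose: "lin V W f \<Longrightarrow> lin W X g \<Longrightarrow> lin V X (\<lambda>x. g (f x))"
  by (simp add: lin_def)

lemma smul_tens [simp]: "smul (V \<otimes> W) = pointwise"
  by (simp add: tens_def)

lemma smul_dual [simp]: "smul (dual V) = pointwise"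
  by (simp add: dual_def)

lemma is_vspaceD: "is_vspace V \<Longrightarrow> module.subspace (smul V) (carrier V)" "is_vspace V \<Longrightarrow> module (smul V)"
  by (simp_all add: is_vspace_def module_iff_vector_space)

lemma zero_in_carrier: "is_vspace V \<Longrightarrow> 0 \<in> carrier V"
  by (rule module.subspace_0[OF is_vspaceD(2) is_vspaceD(1)])

lemma add_in_carrier: "is_vspace V \<Longrightarrow> x \<in> carrier V \<Longrightarrow> y \<in> carrier V \<Longrightarrow> x + y \<in> carrier V"
  by (rule module.subspace_add[OF is_vspaceD(2) is_vspaceD(1)])

lemma smul_in_carrier: "is_vspace V \<Longrightarrow> x \<in> carrier V \<Longrightarrow> smul V c x \<in> carrier V"
  by (rule module.subspace_scale[OF is_vspaceD(2) is_vspaceD(1)])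

lemma sum_in_carrier: "is_vspace V \<Longrightarrow> (\<And>i. i \<in> I \<Longrightarrow> f i \<in> carrier V) \<Longrightarrow> sum f I \<in> carrier V"
  by (induction I rule: infinite_finite_induct) (auto simp: zero_in_carrier add_in_carrier)

lemma lin_sum:
  assumes "is_vspace V" "is_vspace W" "lin V W h" "\<And>i. i \<in> I \<Longrightarrow> f i \<in> carrier V"
  shows "h (sum f I) = (\<Sum>i\<in>I. h (f i))"
  using assms(4)
proof (induction I rule: infinite_finite_induct)
  case (insert i I)
  then show ?case
    using assms(3) sum_in_carrier[OF assms(1), of I f] by (simp add: lin_def)
qed (simp_all add: lin_zero[OF assms(1-3)])

lemma bilin_ground_iff:
  "bilin V W ground \<beta> \<longleftrightarrow>
    (\<forall>v\<in>carrier V. lin W ground (\<beta> v)) \<and> (\<forall>w\<in>carrier W. lin V ground (\<lambda>v. \<beta> v w))"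
  by (simp add: bilin_def)

lemma bilin_lin_comp: "bilin V W X \<beta> \<Longrightarrow> lin X Y h \<Longrightarrow> bilin V W Y (\<lambda>v w. h (\<beta> v w))"
  by (auto simp: bilin_def intro: lin_compose[where g = h])

lemma lin_pure:
  assumes "is_vspace V" "is_vspace W"
  shows "w \<in> carrier W \<Longrightarrow> lin V (V \<otimes> W) (\<lambda>v. pure V W v w)"
    and "v \<in> carrier V \<Longrightarrow> lin W (V \<otimes> W) (\<lambda>w. pure V W v w)"
  using bilin_pure[OF assms] by (simp_all add: bilin_def)

text \<open>
  The universal property in evaluated form: tensors are functionals on bilinear forms, and a linear
  functional on \<open>V \<otimes> W\<close> is evaluation at the bilinear form that it induces.
\<close>

lemma tens_expand:
  assumes G: "lin (V \<otimes> W) ground G" and VW: "is_vspace V" "is_vspace W"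
    and t: "t \<in> carrier (V \<otimes> W)"
  shows "t (\<lambda>v w. G (pure V W v w)) = G t"
proof -
  have b: "bilin V W ground (\<lambda>v w. G (pure V W v w))"
    by (rule bilin_lin_comp[OF bilin_pure[OF VW] G])
  have p: "pure V W v w (\<lambda>v w. G (pure V W v w)) = G (pure V W v w)" for v w
    using b unfolding pure_def[of V W v w] by simp
  show ?thesis
    by (rule lin_tens_eqI[OF is_vspace_ground _ G p t])
      (simp add: lin_ground_iff pointwise_def)
qed

lemma tens_eval_cong:
  assumes t: "t \<in> carrier (V \<otimes> W)" and "bilin V W ground \<beta>" "bilin V W ground \<gamma>"
    and "\<And>v w. v \<in> carrier V \<Longrightarrow> w \<in> carrier W \<Longrightarrow> \<beta> v w = \<gamma> v w"
  shows "t \<beta> = t \<gamma>"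
  using t by (induction rule: tens_induct) (auto simp: pointwise_def pure_def assms)

lemma tens_eval_add:
  assumes t: "t \<in> carrier (V \<otimes> W)" and b: "bilin V W ground \<beta>" "bilin V W ground \<gamma>"
  shows "t (\<lambda>v w. \<beta> v w + \<gamma> v w) = t \<beta> + t \<gamma>"
proof -
  have "bilin V W ground (\<lambda>v w. \<beta> v w + \<gamma> v w)"
    using b by (auto simp: bilin_ground_iff lin_ground_iff algebra_simps)
  with t show ?thesis
    by (induction rule: tens_induct) (auto simp: pointwise_def pure_def b algebra_simps)
qed

lemma tens_eval_scale:
  assumes t: "t \<in> carrier (V \<otimes> W)" and b: "bilin V W ground \<beta>"
  shows "t (\<lambda>v w. c * \<beta> v w) = c * t \<beta>"
proof -
  have "bilin V W ground (\<lambda>v w. c * \<beta> v w)"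
    using b by (auto simp: bilin_ground_iff lin_ground_iff algebra_simps)
  with t show ?thesis
    by (induction rule: tens_induct) (auto simp: pointwise_def pure_def b algebra_simps)
qed

lemma tens_eqI:
  assumes t: "t \<in> carrier (V \<otimes> W)" and u: "u \<in> carrier (V \<otimes> W)"
    and eq: "\<And>\<beta>. bilin V W ground \<beta> \<Longrightarrow> t \<beta> = u \<beta>"
  shows "t = u"
proof
  fix \<beta>
  have z: "s \<beta> = 0" if "s \<in> carrier (V \<otimes> W)" "\<not> bilin V W ground \<beta>" for s
    using that by (induction rule: tens_induct) (auto simp: pointwise_def pure_def)
  show "t \<beta> = u \<beta>"
  proof (cases "bilin V W ground \<beta>")
    case False
    then show ?thesis using z[OF t] z[OF u] by simp
  qed (rule eq)
qed

lemma lin_tens_eval: "lin (V \<otimes> W) ground (\<lambda>t. t \<beta>)"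
  by (simp add: lin_ground_iff pointwise_def)

definition trilin where
  "trilin X Y Z f \<longleftrightarrow>
    (\<forall>x\<in>carrier X. \<forall>y\<in>carrier Y. lin Z ground (\<lambda>z. f x y z)) \<and>
    (\<forall>x\<in>carrier X. \<forall>z\<in>carrier Z. lin Y ground (\<lambda>y. f x y z)) \<and>
    (\<forall>y\<in>carrier Y. \<forall>z\<in>carrier Z. lin X ground (\<lambda>x. f x y z))"

text \<open>
  This is the linear functional on \<open>X \<otimes> Y \<otimes> Z\<close> induced by the trilinear form \<open>f\<close>.
\<close>

definition eval3 ::
  "('k, ('k, 'x, 'y) tensor, 'z) tensor \<Rightarrow> ('x \<Rightarrow> 'y \<Rightarrow> 'z \<Rightarrow> 'k) \<Rightarrow> 'k" where
  "eval3 s f = s (\<lambda>t z. t (\<lambda>x y. f x y z))"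

lemma trilinD:
  assumes "trilin X Y Z f"
  shows "z \<in> carrier Z \<Longrightarrow> bilin X Y ground (\<lambda>x y. f x y z)"
    and "x \<in> carrier X \<Longrightarrow> bilin Y Z ground (\<lambda>y z. f x y z)"
    and "y \<in> carrier Y \<Longrightarrow> bilin X Z ground (\<lambda>x z. f x y z)"
  using assms by (auto simp: trilin_def bilin_def)

lemma bilin_eval3:
  assumes f: "trilin X Y Z f" and Z: "is_vspace Z"
  shows "bilin (X \<otimes> Y) Z ground (\<lambda>t z. t (\<lambda>x y. f x y z))"
  unfolding bilin_ground_iff
proof (intro conjI ballI)
  fix t assume t: "t \<in> carrier (X \<otimes> Y)"
  have "t (\<lambda>x y. f x y (z + z')) = t (\<lambda>x y. f x y z) + t (\<lambda>x y. f x y z')"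
    if z: "z \<in> carrier Z" "z' \<in> carrier Z" for z z'
  proof -
    have "bilin X Y ground (\<lambda>x y. f x y z + f x y z')"
      using trilinD(1)[OF f z(1)] trilinD(1)[OF f z(2)]
      by (auto simp: bilin_ground_iff lin_ground_iff algebra_simps)
    then have "t (\<lambda>x y. f x y (z + z')) = t (\<lambda>x y. f x y z + f x y z')"
      using f z by (intro tens_eval_cong[OF t trilinD(1)[OF f]])
        (auto simp: add_in_carrier[OF Z] trilin_def lin_ground_iff)
    then show ?thesis using tens_eval_add[OF t trilinD(1)[OF f z(1)] trilinD(1)[OF f z(2)]] by simp
  qed
  moreover have "t (\<lambda>x y. f x y (smul Z c z)) = c * t (\<lambda>x y. f x y z)" if z: "z \<in> carrier Z" for c z
  proof -
    have "bilin X Y ground (\<lambda>x y. c * f x y z)"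
      using trilinD(1)[OF f z] by (auto simp: bilin_ground_iff lin_ground_iff algebra_simps)
    then have "t (\<lambda>x y. f x y (smul Z c z)) = t (\<lambda>x y. c * f x y z)"
      using f z by (intro tens_eval_cong[OF t trilinD(1)[OF f]])
        (auto simp: smul_in_carrier[OF Z] trilin_def lin_ground_iff)
    then show ?thesis using tens_eval_scale[OF t trilinD(1)[OF f z]] by simp
  qed
  ultimately show "lin Z ground (\<lambda>z. t (\<lambda>x y. f x y z))"
    by (simp add: lin_ground_iff)
qed (rule lin_tens_eval)

lemma lin_eval3: "lin (X \<otimes> Y \<otimes> Z) ground (\<lambda>s. eval3 s f)"
  unfolding eval3_def by (rule lin_tens_eval)

lemma eval3_pure_left:
  assumes "trilin X Y Z f" "is_vspace Z"
  shows "eval3 (pure (X \<otimes> Y) Z t z) f = t (\<lambda>x y. f x y z)"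
  using bilin_eval3[OF assms] by (simp add: eval3_def pure_def)

lemma eval3_pure:
  assumes "trilin X Y Z f" "is_vspace Z" "z \<in> carrier Z"
  shows "eval3 (pure (X \<otimes> Y) Z (pure X Y x y) z) f = f x y z"
  using trilinD(1)[OF assms(1,3)] by (subst eval3_pure_left[OF assms(1,2)]) (simp add: pure_def)

lemma lin_tens3_eqI:
  assumes X: "is_vspace X" and Y: "is_vspace Y" and Z: "is_vspace Z" and W: "is_vspace W"
    and G: "lin (X \<otimes> Y \<otimes> Z) W G" and H: "lin (X \<otimes> Y \<otimes> Z) W H"
    and eq: "\<And>x y z. x \<in> carrier X \<Longrightarrow> y \<in> carrier Y \<Longrightarrow> z \<in> carrier Z \<Longrightarrow>
      G (pure (X \<otimes> Y) Z (pure X Y x y) z) = H (pure (X \<otimes> Y) Z (pure X Y x y) z)"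
    and s: "s \<in> carrier (X \<otimes> Y \<otimes> Z)"
  shows "G s = H s"
proof (rule lin_tens_eqI[OF W G H _ s])
  fix t z assume t: "t \<in> carrier (X \<otimes> Y)" and z: "z \<in> carrier Z"
  have l: "lin (X \<otimes> Y) (X \<otimes> Y \<otimes> Z) (\<lambda>t. pure (X \<otimes> Y) Z t z)"
    using bilin_pure[OF is_vspace_tens Z] z by (auto simp: bilin_def)
  show "G (pure (X \<otimes> Y) Z t z) = H (pure (X \<otimes> Y) Z t z)"
    by (rule lin_tens_eqI[OF W lin_compose[OF l G] lin_compose[OF l H] eq[OF _ _ z] t])
qed

text \<open>
  Each bilinear form on \<open>(X \<otimes> Y) \<times> Z\<close> comes from a trilinear form, so trilinear forms separate
  threefold tensors.
\<close>

lemma eval3_eqI: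
  assumes X: "is_vspace X" and Y: "is_vspace Y" and Z: "is_vspace Z"
    and s: "s \<in> carrier (X \<otimes> Y \<otimes> Z)" and u: "u \<in> carrier (X \<otimes> Y \<otimes> Z)"
    and eq: "\<And>f. trilin X Y Z f \<Longrightarrow> eval3 s f = eval3 u f"
  shows "s = u"
proof (rule tens_eqI[OF s u])
  fix \<beta> assume \<beta>: "bilin (X \<otimes> Y) Z ground \<beta>"
  define f where "f x y z = \<beta> (pure X Y x y) z" for x y z
  have f: "trilin X Y Z f"
    unfolding trilin_def f_def
  proof (intro conjI ballI)
    fix x y z assume a: "x \<in> carrier X" "y \<in> carrier Y"
    show "lin Z ground (\<lambda>z. \<beta> (pure X Y x y) z)"
      using \<beta> pure_in_tens[OF a] by (simp add: bilin_def)
  next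
    fix x z assume a: "x \<in> carrier X" "z \<in> carrier Z"
    then have "lin (X \<otimes> Y) ground (\<lambda>t. \<beta> t z)" using \<beta> by (simp add: bilin_def)
    from lin_compose[OF lin_pure(2)[OF X Y a(1)] this] show "lin Y ground (\<lambda>y. \<beta> (pure X Y x y) z)" .
  next
    fix y z assume a: "y \<in> carrier Y" "z \<in> carrier Z"
    then have "lin (X \<otimes> Y) ground (\<lambda>t. \<beta> t z)" using \<beta> by (simp add: bilin_def)
    from lin_compose[OF lin_pure(1)[OF X Y a(1)] this] show "lin X ground (\<lambda>x. \<beta> (pure X Y x y) z)" .
  qed
  have "s \<beta> = eval3 s f" if s: "s \<in> carrier (X \<otimes> Y \<otimes> Z)" for s
    unfolding eval3_def
  proof (rule tens_eval_cong[OF s \<beta> bilin_eval3[OF f Z]])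
    fix t z assume t: "t \<in> carrier (X \<otimes> Y)" and z: "z \<in> carrier Z"
    have "lin (X \<otimes> Y) ground (\<lambda>t. \<beta> t z)" using \<beta> z by (simp add: bilin_def)
    from tens_expand[OF this X Y t] show "\<beta> t z = t (\<lambda>x y. f x y z)"
      by (simp add: f_def)
  qed
  then show "s \<beta> = u \<beta>" using s u eq[OF f] by simp
qed

lemma bilin_pure_comp:
  assumes f: "lin V V' f" and g: "lin W W' g" and VW: "is_vspace V'" "is_vspace W'"
  shows "bilin V W (V' \<otimes> W') (\<lambda>v w. pure V' W' (f v) (g w))"
  using bilin_pure[OF VW] f g unfolding bilin_def lin_def by auto

lemma lin_id: "lin V V id" "lin V V (\<lambda>x. x)"
  by (simp_all add: lin_def)

lemma
  assumes f: "lin V V' f" and g: "lin W W' g" and VW: "is_vspace V'" "is_vspace W'"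
  shows lin_tens_map: "lin (V \<otimes> W) (V' \<otimes> W') (tens_map V W V' W' f g)"
    and tens_map_pure: "v \<in> carrier V \<Longrightarrow> w \<in> carrier W \<Longrightarrow>
      tens_map V W V' W' f g (pure V W v w) = pure V' W' (f v) (g w)"
  unfolding tens_map_def
  using tlift[OF is_vspace_tens bilin_pure_comp[OF assms]] by auto

context
  fixes X :: "('k::field, 'x::ab_group_add) vspace"
    and Y :: "('k, 'y::ab_group_add) vspace" and Z :: "('k, 'z::ab_group_add) vspace"
  assumes X: "is_vspace X" and Y: "is_vspace Y" and Z: "is_vspace Z"
begin

lemma bilin_unassoc_inner:
  "x \<in> carrier X \<Longrightarrow> bilin Y Z (X \<otimes> Y \<otimes> Z) (\<lambda>y z. pure (X \<otimes> Y) Z (pure X Y x y) z)"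
  unfolding bilin_def
  by (intro conjI ballI lin_pure(2)[OF is_vspace_tens Z] pure_in_tens
      lin_compose[OF lin_pure(2)[OF X Y] lin_pure(1)[OF is_vspace_tens Z]])

lemma bilin_assoc_inner:
  "z \<in> carrier Z \<Longrightarrow> bilin X Y (X \<otimes> (Y \<otimes> Z)) (\<lambda>x y. pure X (Y \<otimes> Z) x (pure Y Z y z))"
  unfolding bilin_def
  by (intro conjI ballI lin_pure(1)[OF X is_vspace_tens] pure_in_tens
      lin_compose[OF lin_pure(1)[OF Y Z] lin_pure(2)[OF X is_vspace_tens]])

text \<open>
  The maps \<open>assoc\<close> and \<open>unassoc\<close> are lifts of lifts; for the outer lift, the inner one has to depend
  linearly on the remaining variable.
\<close>

lemma lin_tlift_param:
  assumes W: "is_vspace W"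
    and b: "\<And>p. p \<in> carrier P \<Longrightarrow> bilin U U' W (\<beta> p)"
    and l: "\<And>u u'. u \<in> carrier U \<Longrightarrow> u' \<in> carrier U' \<Longrightarrow> lin P W (\<lambda>p. \<beta> p u u')"
    and P: "is_vspace P" and t: "t \<in> carrier (U \<otimes> U')"
  shows "lin P W (\<lambda>p. tlift U U' W (\<beta> p) t)"
  unfolding lin_def
proof (intro conjI ballI allI)
  have lt: "lin (U \<otimes> U') W (tlift U U' W (\<beta> p))" if "p \<in> carrier P" for p
    by (rule lin_tlift[OF W b[OF that]])
  show "tlift U U' W (\<beta> p) t \<in> carrier W" if "p \<in> carrier P" for p
    using lt[OF that] t by (simp add: lin_def)
  show "tlift U U' W (\<beta> (p + q)) t = tlift U U' W (\<beta> p) t + tlift U U' W (\<beta> q) t"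
    if pq: "p \<in> carrier P" "q \<in> carrier P" for p q
  proof (rule lin_tens_eqI[OF W lt _ _ t])
    interpret W: vector_space "smul W" using W by (simp add: is_vspace_def)
    show "lin (U \<otimes> U') W (\<lambda>t. tlift U U' W (\<beta> p) t + tlift U U' W (\<beta> q) t)"
      using lt[OF pq(1)] lt[OF pq(2)] by (auto simp: lin_def add_in_carrier[OF W] W.scale_right_distrib)
    show "p + q \<in> carrier P" using pq by (rule add_in_carrier[OF P])
  qed (use pq l in \<open>simp add: tlift_pure[OF W b] add_in_carrier[OF P] lin_def\<close>)
  show "tlift U U' W (\<beta> (smul P c p)) t = smul W c (tlift U U' W (\<beta> p) t)"
    if p: "p \<in> carrier P" for c p
  proof (rule lin_tens_eqI[OF W lt _ _ t])
    interpret W: vector_space "smul W" using W by (simp add: is_vspace_def)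
    show "lin (U \<otimes> U') W (\<lambda>t. smul W c (tlift U U' W (\<beta> p) t))"
      using lt[OF p] by (auto simp: lin_def smul_in_carrier[OF W] W.scale_right_distrib W.scale_left_commute)
    show "smul P c p \<in> carrier P" using p by (rule smul_in_carrier[OF P])
  qed (use p l in \<open>simp add: tlift_pure[OF W b] smul_in_carrier[OF P] lin_def\<close>)
qed

lemma bilin_unassoc:
  "bilin X (Y \<otimes> Z) (X \<otimes> Y \<otimes> Z)
    (\<lambda>x t. tlift Y Z (X \<otimes> Y \<otimes> Z) (\<lambda>y z. pure (X \<otimes> Y) Z (pure X Y x y) z) t)"
  unfolding bilin_def
proof (intro conjI ballI)
  fix t assume t: "t \<in> carrier (Y \<otimes> Z)"
  have "lin X (X \<otimes> Y \<otimes> Z) (\<lambda>x. pure (X \<otimes> Y) Z (pure X Y x y) z)"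
    if "y \<in> carrier Y" "z \<in> carrier Z" for y z
    by (rule lin_compose[OF lin_pure(1)[OF X Y that(1)] lin_pure(1)[OF is_vspace_tens Z that(2)]])
  then show "lin X (X \<otimes> Y \<otimes> Z)
      (\<lambda>x. tlift Y Z (X \<otimes> Y \<otimes> Z) (\<lambda>y z. pure (X \<otimes> Y) Z (pure X Y x y) z) t)"
    by (intro lin_tlift_param is_vspace_tens X t bilin_unassoc_inner)
qed (intro lin_tlift[OF is_vspace_tens] bilin_unassoc_inner)

lemma bilin_assoc:
  "bilin (X \<otimes> Y) Z (X \<otimes> (Y \<otimes> Z))
     (\<lambda>t z. tlift X Y (X \<otimes> (Y \<otimes> Z)) (\<lambda>x y. pure X (Y \<otimes> Z) x (pure Y Z y z)) t)"
  unfolding bilin_def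
proof (intro conjI ballI)
  fix t assume t: "t \<in> carrier (X \<otimes> Y)"
  have "lin Z (X \<otimes> (Y \<otimes> Z)) (\<lambda>z. pure X (Y \<otimes> Z) x (pure Y Z y z))"
    if "x \<in> carrier X" "y \<in> carrier Y" for x y
    by (rule lin_compose[OF lin_pure(2)[OF Y Z that(2)] lin_pure(2)[OF X is_vspace_tens that(1)]])
  then show "lin Z (X \<otimes> (Y \<otimes> Z))
      (\<lambda>z. tlift X Y (X \<otimes> (Y \<otimes> Z)) (\<lambda>x y. pure X (Y \<otimes> Z) x (pure Y Z y z)) t)"
    by (intro lin_tlift_param is_vspace_tens Z t bilin_assoc_inner)
qed (intro lin_tlift[OF is_vspace_tens] bilin_assoc_inner)

lemma lin_unassoc: "lin (X \<otimes> (Y \<otimes> Z)) (X \<otimes> Y \<otimes> Z) (unassoc X Y Z)"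
  unfolding unassoc_def by (rule lin_tlift[OF is_vspace_tens bilin_unassoc])

lemma lin_assoc: "lin (X \<otimes> Y \<otimes> Z) (X \<otimes> (Y \<otimes> Z)) (assoc X Y Z)"
  unfolding assoc_def by (rule lin_tlift[OF is_vspace_tens bilin_assoc])

lemma assoc_pure:
  assumes "x \<in> carrier X" "y \<in> carrier Y" "z \<in> carrier Z"
  shows "assoc X Y Z (pure (X \<otimes> Y) Z (pure X Y x y) z) = pure X (Y \<otimes> Z) x (pure Y Z y z)"
  unfolding assoc_def
  using assms by (simp add: tlift_pure[OF is_vspace_tens bilin_assoc] pure_in_tens
      tlift_pure[OF is_vspace_tens bilin_assoc_inner])

lemma unassoc_pure:
  assumes "x \<in> carrier X" "y \<in> carrier Y" "z \<in> carrier Z"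
  shows "unassoc X Y Z (pure X (Y \<otimes> Z) x (pure Y Z y z)) = pure (X \<otimes> Y) Z (pure X Y x y) z"
  unfolding unassoc_def
  using assms by (simp add: tlift_pure[OF is_vspace_tens bilin_unassoc] pure_in_tens
      tlift_pure[OF is_vspace_tens bilin_unassoc_inner])

lemma eval3_unassoc:
  assumes f: "trilin X Y Z f" and x: "x \<in> carrier X" and t: "t \<in> carrier (Y \<otimes> Z)"
  shows "eval3 (unassoc X Y Z (pure X (Y \<otimes> Z) x t)) f = t (\<lambda>y z. f x y z)"
proof -
  have l: "lin (Y \<otimes> Z) (X \<otimes> (Y \<otimes> Z)) (\<lambda>t. pure X (Y \<otimes> Z) x t)"
    using bilin_pure[OF X is_vspace_tens] x by (auto simp: bilin_def)
  have p: "pure Y Z y z (\<lambda>y z. f x y z) = f x y z" for y z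
    using trilinD(2)[OF f x] by (simp add: pure_def)
  show ?thesis
    by (rule lin_tens_eqI[OF is_vspace_ground
          lin_compose[OF lin_compose[OF l lin_unassoc] lin_eval3] lin_tens_eval _ t])
      (simp add: unassoc_pure[OF x] eval3_pure[OF f Z] p)
qed

lemma lin_leg12: "lin (X \<otimes> Y) (X \<otimes> Y) F \<Longrightarrow> lin (X \<otimes> Y \<otimes> Z) (X \<otimes> Y \<otimes> Z) (leg12 X Y Z F)"
  unfolding leg12_def by (intro lin_tens_map is_vspace_tens Z lin_id)

lemma lin_leg23: "lin (Y \<otimes> Z) (Y \<otimes> Z) F \<Longrightarrow> lin (X \<otimes> Y \<otimes> Z) (X \<otimes> Y \<otimes> Z) (leg23 X Y Z F)"
  unfolding leg23_def comp_def
  by (intro lin_compose[OF lin_compose[OF lin_assoc] lin_unassoc] lin_tens_map is_vspace_tens X lin_id)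

lemma trilin_leg12:
  assumes F: "lin (X \<otimes> Y) (X \<otimes> Y) F" and f: "trilin X Y Z f"
  shows "trilin X Y Z (\<lambda>x y z. F (pure X Y x y) (\<lambda>x' y'. f x' y' z))"
proof -
  have "lin X ground (\<lambda>x. F (pure X Y x y) \<beta>)" if "y \<in> carrier Y" for y \<beta>
    by (rule lin_compose[OF lin_compose[OF lin_pure(1)[OF X Y that] F] lin_tens_eval])
  moreover have "lin Y ground (\<lambda>y. F (pure X Y x y) \<beta>)" if "x \<in> carrier X" for x \<beta>
    by (rule lin_compose[OF lin_compose[OF lin_pure(2)[OF X Y that] F] lin_tens_eval])
  moreover have "F (pure X Y x y) \<in> carrier (X \<otimes> Y)" if "x \<in> carrier X" "y \<in> carrier Y" for x y
    using pure_in_tens[OF that] F by (simp add: lin_def)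
  then have "lin Z ground (\<lambda>z. F (pure X Y x y) (\<lambda>x' y'. f x' y' z))"
    if "x \<in> carrier X" "y \<in> carrier Y" for x y
    using bilin_eval3[OF f Z] that by (auto simp: bilin_def)
  ultimately show ?thesis by (auto simp: trilin_def)
qed

text \<open>
  An operator applied to two legs of a tensor can be moved into the trilinear form. Applied
  repeatedly, \<open>eval3_leg12\<close>, \<open>eval3_leg23\<close> and \<open>eval3_leg13\<close> translate an equation between composites
  of such operators into one between iterated evaluations.
\<close>

lemma eval3_leg12:
  assumes F: "lin (X \<otimes> Y) (X \<otimes> Y) F" and f: "trilin X Y Z f" and s: "s \<in> carrier (X \<otimes> Y \<otimes> Z)"
  shows "eval3 (leg12 X Y Z F s) f = eval3 s (\<lambda>x y z. F (pure X Y x y) (\<lambda>x' y'. f x' y' z))"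
proof (rule lin_tens3_eqI[OF X Y Z is_vspace_ground lin_compose[OF lin_leg12[OF F] lin_eval3] lin_eval3 _ s])
  fix x y z assume a: "x \<in> carrier X" "y \<in> carrier Y" "z \<in> carrier Z"
  have "leg12 X Y Z F (pure (X \<otimes> Y) Z (pure X Y x y) z) = pure (X \<otimes> Y) Z (F (pure X Y x y)) z"
    unfolding leg12_def
    using a by (simp add: tens_map_pure[OF F lin_id(1) is_vspace_tens Z] pure_in_tens)
  then show "eval3 (leg12 X Y Z F (pure (X \<otimes> Y) Z (pure X Y x y) z)) f =
      eval3 (pure (X \<otimes> Y) Z (pure X Y x y) z) (\<lambda>x y z. F (pure X Y x y) (\<lambda>x' y'. f x' y' z))"
    by (simp add: eval3_pure_left[OF f Z] eval3_pure[OF trilin_leg12[OF F f] Z a(3)])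
qed

lemma trilin_leg23:
  assumes F: "lin (Y \<otimes> Z) (Y \<otimes> Z) F" and f: "trilin X Y Z f"
  shows "trilin X Y Z (\<lambda>x y z. F (pure Y Z y z) (\<lambda>y' z'. f x y' z'))"
proof -
  have "lin Y ground (\<lambda>x. F (pure Y Z x y) \<beta>)" if "y \<in> carrier Z" for y \<beta>
    by (rule lin_compose[OF lin_compose[OF lin_pure(1)[OF Y Z that] F] lin_tens_eval])
  moreover have "lin Z ground (\<lambda>y. F (pure Y Z x y) \<beta>)" if "x \<in> carrier Y" for x \<beta>
    by (rule lin_compose[OF lin_compose[OF lin_pure(2)[OF Y Z that] F] lin_tens_eval])
  moreover have "F (pure Y Z x y) \<in> carrier (Y \<otimes> Z)" if "x \<in> carrier Y" "y \<in> carrier Z" for x y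
    using pure_in_tens[OF that] F by (simp add: lin_def)
  moreover have "trilin Y Z X (\<lambda>y z x. f x y z)" using f by (auto simp: trilin_def)
  then have "bilin (Y \<otimes> Z) X ground (\<lambda>t x. t (\<lambda>y z. f x y z))" by (rule bilin_eval3[OF _ X])
  ultimately show ?thesis by (auto simp: trilin_def bilin_def)
qed

lemma eval3_leg23:
  assumes F: "lin (Y \<otimes> Z) (Y \<otimes> Z) F" and f: "trilin X Y Z f" and s: "s \<in> carrier (X \<otimes> Y \<otimes> Z)"
  shows "eval3 (leg23 X Y Z F s) f = eval3 s (\<lambda>x y z. F (pure Y Z y z) (\<lambda>y' z'. f x y' z'))"
proof (rule lin_tens3_eqI[OF X Y Z is_vspace_ground lin_compose[OF lin_leg23[OF F] lin_eval3] lin_eval3 _ s])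
  fix x y z assume a: "x \<in> carrier X" "y \<in> carrier Y" "z \<in> carrier Z"
  have c: "F (pure Y Z y z) \<in> carrier (Y \<otimes> Z)"
    using pure_in_tens[OF a(2,3)] F by (simp add: lin_def)
  have "leg23 X Y Z F (pure (X \<otimes> Y) Z (pure X Y x y) z)
      = unassoc X Y Z (pure X (Y \<otimes> Z) x (F (pure Y Z y z)))"
    unfolding leg23_def comp_def
    using a by (simp add: assoc_pure tens_map_pure[OF lin_id(1) F X is_vspace_tens] pure_in_tens)
  then show "eval3 (leg23 X Y Z F (pure (X \<otimes> Y) Z (pure X Y x y) z)) f =
      eval3 (pure (X \<otimes> Y) Z (pure X Y x y) z) (\<lambda>x y z. F (pure Y Z y z) (\<lambda>y' z'. f x y' z'))"
    by (simp add: eval3_unassoc[OF f a(1) c] eval3_pure[OF trilin_leg23[OF F f] Z a(3)])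
qed

end

lemma bilin_flip: "is_vspace V \<Longrightarrow> is_vspace W \<Longrightarrow> bilin V W (W \<otimes> V) (\<lambda>v w. pure W V w v)"
  using bilin_pure[of W V] by (auto simp: bilin_def)

context
  fixes X :: "('k::field, 'x::ab_group_add) vspace"
    and Y :: "('k, 'y::ab_group_add) vspace" and Z :: "('k, 'z::ab_group_add) vspace"
  assumes X: "is_vspace X" and Y: "is_vspace Y" and Z: "is_vspace Z"
begin

lemma lin_flip: "lin (Y \<otimes> Z) (Z \<otimes> Y) (flip Y Z)"
  unfolding flip_def by (rule lin_tlift[OF is_vspace_tens bilin_flip[OF Y Z]])

lemma lin_flip23: "lin (X \<otimes> Y \<otimes> Z) (X \<otimes> Z \<otimes> Y) (flip23 X Y Z)"
  unfolding flip23_def comp_def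
  by (intro lin_compose[OF lin_compose[OF lin_assoc[OF X Y Z]] lin_unassoc[OF X Z Y]] lin_tens_map
      is_vspace_tens X lin_id lin_flip)

lemma flip23_pure:
  assumes "x \<in> carrier X" "y \<in> carrier Y" "z \<in> carrier Z"
  shows "flip23 X Y Z (pure (X \<otimes> Y) Z (pure X Y x y) z) = pure (X \<otimes> Z) Y (pure X Z x z) y"
proof -
  have "flip Y Z (pure Y Z y z) = pure Z Y z y"
    unfolding flip_def using assms by (simp add: tlift_pure[OF is_vspace_tens bilin_flip[OF Y Z]])
  then show ?thesis
    unfolding flip23_def comp_def using assms
    by (simp add: assoc_pure[OF X Y Z] unassoc_pure[OF X Z Y] pure_in_tens
        tens_map_pure[OF lin_id(1) lin_flip X is_vspace_tens])
qed

lemma eval3_flip23: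
  assumes f: "trilin X Z Y f" and s: "s \<in> carrier (X \<otimes> Y \<otimes> Z)"
  shows "eval3 (flip23 X Y Z s) f = eval3 s (\<lambda>x y z. f x z y)"
proof (rule lin_tens3_eqI[OF X Y Z is_vspace_ground lin_compose[OF lin_flip23 lin_eval3] lin_eval3 _ s])
  have f': "trilin X Y Z (\<lambda>x y z. f x z y)" using f by (auto simp: trilin_def)
  fix x y z assume a: "x \<in> carrier X" "y \<in> carrier Y" "z \<in> carrier Z"
  then show "eval3 (flip23 X Y Z (pure (X \<otimes> Y) Z (pure X Y x y) z)) f =
      eval3 (pure (X \<otimes> Y) Z (pure X Y x y) z) (\<lambda>x y z. f x z y)"
    by (simp add: flip23_pure eval3_pure[OF f Y] eval3_pure[OF f' Z])
qed

end

lemma leg13: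
  assumes X: "is_vspace X" and Y: "is_vspace Y" and Z: "is_vspace Z"
    and F: "lin (X \<otimes> Z) (X \<otimes> Z) F"
  shows lin_leg13: "lin (X \<otimes> Y \<otimes> Z) (X \<otimes> Y \<otimes> Z) (leg13 X Y Z F)"
    and eval3_leg13: "trilin X Y Z f \<Longrightarrow> s \<in> carrier (X \<otimes> Y \<otimes> Z) \<Longrightarrow>
      eval3 (leg13 X Y Z F s) f = eval3 s (\<lambda>x y z. F (pure X Z x z) (\<lambda>x' z'. f x' y z'))"
    and trilin_leg13: "trilin X Y Z f \<Longrightarrow>
      trilin X Y Z (\<lambda>x y z. F (pure X Z x z) (\<lambda>x' z'. f x' y z'))"
proof -
  have l1: "lin (X \<otimes> Y \<otimes> Z) (X \<otimes> Z \<otimes> Y) (flip23 X Y Z)" by (rule lin_flip23[OF X Y Z])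
  have l2: "lin (X \<otimes> Y \<otimes> Z) (X \<otimes> Z \<otimes> Y) (\<lambda>s. leg12 X Z Y F (flip23 X Y Z s))"
    by (rule lin_compose[OF l1 lin_leg12[OF X Z Y F]])
  show "lin (X \<otimes> Y \<otimes> Z) (X \<otimes> Y \<otimes> Z) (leg13 X Y Z F)"
    unfolding leg13_def comp_def by (rule lin_compose[OF l2 lin_flip23[OF X Z Y]])
  assume f: "trilin X Y Z f"
  have f': "trilin X Z Y (\<lambda>x z y. f x y z)" using f by (auto simp: trilin_def)
  have f'': "trilin X Z Y (\<lambda>x z y. F (pure X Z x z) (\<lambda>x' z'. f x' y z'))"
    by (rule trilin_leg12[OF X Z Y F f'])
  then show "trilin X Y Z (\<lambda>x y z. F (pure X Z x z) (\<lambda>x' z'. f x' y z'))"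
    by (auto simp: trilin_def)
  assume s: "s \<in> carrier (X \<otimes> Y \<otimes> Z)"
  have c1: "flip23 X Y Z s \<in> carrier (X \<otimes> Z \<otimes> Y)" using l1 s by (simp add: lin_def)
  have c2: "leg12 X Z Y F (flip23 X Y Z s) \<in> carrier (X \<otimes> Z \<otimes> Y)" using l2 s by (simp add: lin_def)
  show "eval3 (leg13 X Y Z F s) f = eval3 s (\<lambda>x y z. F (pure X Z x z) (\<lambda>x' z'. f x' y z'))"
    unfolding leg13_def comp_def
    by (simp add: eval3_flip23[OF X Z Y f c2] eval3_leg12[OF X Z Y F f' c1] eval3_flip23[OF X Y Z f'' s])
qed

lemma tens_eval_sum:
  assumes t: "t \<in> carrier (V \<otimes> W)" and b: "\<And>i. i \<in> I \<Longrightarrow> bilin V W ground (\<beta> i)"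
  shows "bilin V W ground (\<lambda>v w. \<Sum>i\<in>I. \<beta> i v w)"
    and "t (\<lambda>v w. \<Sum>i\<in>I. \<beta> i v w) = (\<Sum>i\<in>I. t (\<beta> i))"
proof -
  have z: "bilin V W ground (\<lambda>v w. 0)" by (simp add: bilin_ground_iff lin_ground_iff)
  have "bilin V W ground (\<lambda>v w. \<Sum>i\<in>I. \<beta> i v w) \<and> t (\<lambda>v w. \<Sum>i\<in>I. \<beta> i v w) = (\<Sum>i\<in>I. t (\<beta> i))"
    using b
  proof (induction I rule: infinite_finite_induct)
    case (insert i I)
    then have 1: "bilin V W ground (\<beta> i)" "bilin V W ground (\<lambda>v w. \<Sum>i\<in>I. \<beta> i v w)" by auto
    from 1 have "bilin V W ground (\<lambda>v w. \<beta> i v w + (\<Sum>i\<in>I. \<beta> i v w))"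
      by (auto simp: bilin_ground_iff lin_ground_iff algebra_simps)
    then show ?case using insert tens_eval_add[OF t 1] by simp
  qed (use z tens_eval_scale[OF t z, of 0] in simp_all)
  then show "bilin V W ground (\<lambda>v w. \<Sum>i\<in>I. \<beta> i v w)"
    and "t (\<lambda>v w. \<Sum>i\<in>I. \<beta> i v w) = (\<Sum>i\<in>I. t (\<beta> i))" by auto
qed

lemma bilin_prod: "lin V ground f \<Longrightarrow> lin W ground g \<Longrightarrow> bilin V W ground (\<lambda>v w. f v * g w)"
  by (auto simp: bilin_ground_iff lin_ground_iff algebra_simps)

lemma slice_left:
  assumes V: "is_vspace V" and W: "is_vspace W" and \<omega>: "lin V ground \<omega>"
  shows lin_slice_left: "lin (V \<otimes> W) W (slice_left V W \<omega>)"
    and slice_left_pure: "v \<in> carrier V \<Longrightarrow> w \<in> carrier W \<Longrightarrow> slice_left V W \<omega> (pure V W v w) = smul W (\<omega> v) w"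
    and slice_left_eval: "t \<in> carrier (V \<otimes> W) \<Longrightarrow> lin W ground g \<Longrightarrow>
      g (slice_left V W \<omega> t) = t (\<lambda>v w. \<omega> v * g w)"
proof -
  interpret vector_space "smul W" using W by (simp add: is_vspace_def)
  have b: "bilin V W W (\<lambda>v w. smul W (\<omega> v) w)"
    using \<omega> by (auto simp: bilin_def lin_ground_iff lin_def[of W W] lin_def[of V W] algebra_simps smul_in_carrier[OF W])
  show l: "lin (V \<otimes> W) W (slice_left V W \<omega>)"
    unfolding slice_left_def by (rule lin_tlift[OF W b])
  show p: "slice_left V W \<omega> (pure V W v w) = smul W (\<omega> v) w" if "v \<in> carrier V" "w \<in> carrier W" for v w
    unfolding slice_left_def by (rule tlift_pure[OF W b that])
  assume t: "t \<in> carrier (V \<otimes> W)" and g: "lin W ground g"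
  have "bilin V W ground (\<lambda>v w. g (slice_left V W \<omega> (pure V W v w)))"
    by (rule bilin_lin_comp[OF bilin_pure[OF V W] lin_compose[OF l g]])
  then have "t (\<lambda>v w. g (slice_left V W \<omega> (pure V W v w))) = t (\<lambda>v w. \<omega> v * g w)"
    by (rule tens_eval_cong[OF t _ bilin_prod[OF \<omega> g]]) (use g in \<open>simp add: p lin_ground_iff\<close>)
  then show "g (slice_left V W \<omega> t) = t (\<lambda>v w. \<omega> v * g w)"
    using tens_expand[OF lin_compose[OF l g] V W t] by simp
qed

lemma slice_right:
  assumes V: "is_vspace V" and W: "is_vspace W" and \<omega>: "lin W ground \<omega>"
  shows lin_slice_right: "lin (V \<otimes> W) V (slice_right V W \<omega>)"
    and slice_right_eval: "t \<in> carrier (V \<otimes> W) \<Longrightarrow> lin V ground g \<Longrightarrow>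
      g (slice_right V W \<omega> t) = t (\<lambda>v w. g v * \<omega> w)"
proof -
  interpret vector_space "smul V" using V by (simp add: is_vspace_def)
  have b: "bilin V W V (\<lambda>v w. smul V (\<omega> w) v)"
    using \<omega> by (auto simp: bilin_def lin_ground_iff lin_def[of V V] lin_def[of W V] algebra_simps smul_in_carrier[OF V])
  show l: "lin (V \<otimes> W) V (slice_right V W \<omega>)"
    unfolding slice_right_def by (rule lin_tlift[OF V b])
  have p: "slice_right V W \<omega> (pure V W v w) = smul V (\<omega> w) v" if "v \<in> carrier V" "w \<in> carrier W" for v w
    unfolding slice_right_def by (rule tlift_pure[OF V b that])
  assume t: "t \<in> carrier (V \<otimes> W)" and g: "lin V ground g"
  have "bilin V W ground (\<lambda>v w. g (slice_right V W \<omega> (pure V W v w)))"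
    by (rule bilin_lin_comp[OF bilin_pure[OF V W] lin_compose[OF l g]])
  then have "t (\<lambda>v w. g (slice_right V W \<omega> (pure V W v w))) = t (\<lambda>v w. g v * \<omega> w)"
    by (rule tens_eval_cong[OF t _ bilin_prod[OF g \<omega>]]) (use g in \<open>simp add: p lin_ground_iff\<close>)
  then show "g (slice_right V W \<omega> t) = t (\<lambda>v w. g v * \<omega> w)"
    using tens_expand[OF lin_compose[OF l g] V W t] by simp
qed

lemma slice_both_eval:
  assumes V: "is_vspace V" and W: "is_vspace W" and \<phi>: "lin V ground \<phi>" and \<omega>: "lin W ground \<omega>"
    and t: "t \<in> carrier (V \<otimes> W)"
  shows "slice_both V W \<phi> \<omega> t = t (\<lambda>v w. \<phi> v * \<omega> w)"
proof -
  have b: "bilin V W ground (\<lambda>v w. \<phi> v * \<omega> w)" by (rule bilin_prod[OF \<phi> \<omega>])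
  have p: "pure V W v w (\<lambda>v w. \<phi> v * \<omega> w) = \<phi> v * \<omega> w" for v w
    by (simp add: pure_def b)
  show ?thesis
    unfolding slice_both_def
    by (rule lin_tens_eqI[OF is_vspace_ground lin_tlift[OF is_vspace_ground b] lin_tens_eval _ t])
      (simp add: tlift_pure[OF is_vspace_ground b] p)
qed

lemma sum_fun_apply: "(\<Sum>i\<in>I. f i) x = (\<Sum>i\<in>I. f i x)"
  by (induction I rule: infinite_finite_induct) auto

lemma slice_left_tact:
  assumes V: "is_vspace V" and W: "is_vspace W" and \<phi>: "lin V ground \<phi>" and h: "lin W W h"
    and t: "t \<in> carrier (V \<otimes> W)"
  shows "slice_left V W \<phi> (tact V W id h t) = h (slice_left V W \<phi> t)"
proof -
  have l: "lin (V \<otimes> W) (V \<otimes> W) (tact V W id h)"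
    unfolding tact_def by (rule lin_tens_map[OF lin_id(1) h V W])
  note sl = slice_left_pure[OF V W \<phi>]
  show ?thesis
    by (rule lin_tens_eqI[OF W lin_compose[OF l lin_slice_left[OF V W \<phi>]]
          lin_compose[OF lin_slice_left[OF V W \<phi>] h] _ t])
      (use h in \<open>simp add: tact_def tens_map_pure[OF lin_id(1) h V W] sl lin_def\<close>)
qed

lemma lin_sum_maps:
  assumes "is_vspace Y" "\<And>i. i \<in> I \<Longrightarrow> lin X Y (f i)"
  shows "lin X Y (\<lambda>x. \<Sum>i\<in>I. f i x)"
proof -
  interpret vector_space "smul Y" using assms by (simp add: is_vspace_def)
  show ?thesis
    using assms(2)
    by (induction I rule: infinite_finite_induct)
      (auto simp: lin_def zero_in_carrier[OF assms(1)] add_in_carrier[OF assms(1)] algebra_simps)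
qed

section \<open>Dual bases of finite dimensional spaces\<close>

text \<open>
  The coordinate functionals are cut off outside the carrier in order to be elements of \<open>dual V\<close>.
\<close>

definition dcoord :: "('k::field, 'v::ab_group_add) vspace \<Rightarrow> 'v set \<Rightarrow> 'v \<Rightarrow> 'v \<Rightarrow> 'k" where
  "dcoord V U i v = (if v \<in> carrier V then coord V U i v else 0)"

lemma fin_dim_basis:
  assumes "is_vspace V" "fin_dim V"
  obtains U where "finite U" "is_basis V U"
proof -
  interpret vector_space "smul V" using assms by (simp add: is_vspace_def)
  obtain S where S: "finite S" "span S = carrier V" using assms by (auto simp: fin_dim_def lspan_def)
  obtain U where U: "U \<subseteq> carrier V" "independent U" "carrier V \<subseteq> span U"
    using maximal_independent_subset by blast
  have "finite U" using independent_span_bound[OF S(1) U(2)] U(1) S(2) by simp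
  moreover have "span U = carrier V"
    using U assms(1) by (simp add: is_vspace_def span_minimal subset_antisym)
  ultimately show ?thesis using that U by (simp add: is_basis_def lspan_def)
qed

context
  fixes V :: "('k::field, 'v::ab_group_add) vspace" and U
  assumes V: "is_vspace V" and U: "finite U" "is_basis V U"
begin

lemma basis_carrier: "i \<in> U \<Longrightarrow> i \<in> carrier V"
proof -
  interpret vector_space "smul V" using V by (simp add: is_vspace_def)
  show "i \<in> U \<Longrightarrow> i \<in> carrier V" using U(2) span_base[of i U] by (simp add: is_basis_def lspan_def)
qed

lemma lin_dcoord: "lin V ground (dcoord V U i)"
proof -
  interpret vector_space "smul V" using V by (simp add: is_vspace_def)
  have b: "independent U" "span U = carrier V" using U(2) by (simp_all add: is_basis_def lspan_def)
  show ?thesis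
    using add_in_carrier[OF V] smul_in_carrier[OF V]
    by (simp add: lin_ground_iff dcoord_def coord_def representation_add[OF b(1)] representation_scale[OF b(1)] b(2))
qed

lemma dcoord_dual: "dcoord V U i \<in> carrier (dual V)"
  using lin_dcoord by (simp add: dual_def dcoord_def)

lemma dcoord_basis: "j \<in> U \<Longrightarrow> dcoord V U i j = (if i = j then 1 else 0)"
proof -
  interpret vector_space "smul V" using V by (simp add: is_vspace_def)
  have b: "independent U" using U(2) by (simp add: is_basis_def)
  show "j \<in> U \<Longrightarrow> ?thesis"
    by (simp add: dcoord_def coord_def basis_carrier representation_basis[OF b])
qed

lemma dcoord_expand:
  assumes "v \<in> carrier V"
  shows "(\<Sum>i\<in>U. smul V (dcoord V U i v) i) = v"
proof -
  interpret vector_space "smul V" using V by (simp add: is_vspace_def)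
  have b: "independent U" "span U = carrier V" using U(2) by (simp_all add: is_basis_def lspan_def)
  show ?thesis
    using sum_representation_eq[OF b(1) _ U(1) subset_refl, of v] assms
    by (simp add: dcoord_def coord_def b(2))
qed

lemma lin_dcoord_expand:
  assumes W: "is_vspace W" and f: "lin V W f" and v: "v \<in> carrier V"
  shows "f v = (\<Sum>i\<in>U. smul W (dcoord V U i v) (f i))"
proof -
  have "f v = f (\<Sum>i\<in>U. smul V (dcoord V U i v) i)" by (simp add: dcoord_expand v)
  also have "\<dots> = (\<Sum>i\<in>U. f (smul V (dcoord V U i v) i))"
    by (rule lin_sum[OF V W f]) (simp add: smul_in_carrier[OF V] basis_carrier)
  finally show ?thesis using f by (simp add: lin_def basis_carrier)
qed

lemma dual_expand:
  assumes "\<psi> \<in> carrier (dual V)"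
  shows "\<psi> = (\<Sum>i\<in>U. pointwise (\<psi> i) (dcoord V U i))"
proof
  fix v
  have s: "(\<Sum>i\<in>U. pointwise (\<psi> i) (dcoord V U i)) v = (\<Sum>i\<in>U. \<psi> i * dcoord V U i v)" for v
    by (simp add: sum_fun_apply pointwise_def)
  have l: "lin V ground \<psi>" using assms by (simp add: dual_def)
  show "\<psi> v = (\<Sum>i\<in>U. pointwise (\<psi> i) (dcoord V U i)) v"
  proof (cases "v \<in> carrier V")
    case True
    then show ?thesis using lin_dcoord_expand[OF is_vspace_ground l True] by (simp add: s ground_def mult.commute)
  next
    case False
    then show ?thesis using assms by (simp add: s dual_def dcoord_def)
  qed
qed

text \<open>
  Evaluated form of \<open>t = \<Sum>\<^sub>i i \<otimes> t\<^sub>i\<close>, where \<open>t\<^sub>i\<close> is obtained from \<open>t\<close> by applying the \<open>i\<close>-th coordinate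
  functional to the first leg.
\<close>

lemma tens_basis_expand:
  assumes W: "is_vspace W" and t: "t \<in> carrier (V \<otimes> W)" and b: "bilin V W ground \<beta>"
  shows "t \<beta> = (\<Sum>i\<in>U. \<beta> i (slice_left V W (dcoord V U i) t))"
proof -
  have l: "lin W ground (\<beta> i)" if "i \<in> U" for i
    using b that by (simp add: bilin_def basis_carrier)
  have bi: "bilin V W ground (\<lambda>v w. dcoord V U i v * \<beta> i w)" if "i \<in> U" for i
    by (rule bilin_prod[OF lin_dcoord l[OF that]])
  have "t \<beta> = t (\<lambda>v w. \<Sum>i\<in>U. dcoord V U i v * \<beta> i w)"
  proof (rule tens_eval_cong[OF t b tens_eval_sum(1)[OF t bi]])
    fix v w assume v: "v \<in> carrier V" and w: "w \<in> carrier W"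
    have "lin V ground (\<lambda>v. \<beta> v w)" using b w by (simp add: bilin_def)
    from lin_dcoord_expand[OF is_vspace_ground this v]
    show "\<beta> v w = (\<Sum>i\<in>U. dcoord V U i v * \<beta> i w)" by (simp add: ground_def)
  qed
  also have "\<dots> = (\<Sum>i\<in>U. t (\<lambda>v w. dcoord V U i v * \<beta> i w))"
    by (rule tens_eval_sum(2)[OF t bi])
  finally show ?thesis by (simp add: slice_left_eval[OF V W lin_dcoord t l])
qed

end

section \<open>Sweedler calculus for a non-degenerate idempotent algebra\<close>

context idempotent_nondegenerate_algebra
begin

lemma is_vspace_A: "is_vspace A"
proof -
  interpret vector_space "smul A" by (rule vspace)
  show ?thesis using vspace by (simp add: is_vspace_def carrier_UNIV)
qed

lemma in_A [simp]: "x \<in> carrier A"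
  by (simp add: carrier_UNIV)

abbreviation lf :: "('a \<Rightarrow> 'k) \<Rightarrow> bool" where "lf \<equiv> lin A ground"
abbreviation bf :: "('a \<Rightarrow> 'a \<Rightarrow> 'k) \<Rightarrow> bool" where "bf \<equiv> bilin A A ground"

lemma lf_iff: "lf g \<longleftrightarrow> (\<forall>x y. g (x + y) = g x + g y) \<and> (\<forall>c x. g (smul A c x) = c * g x)"
  by (simp add: lin_ground_iff carrier_UNIV)

definition basis_A :: "'a set" where "basis_A = (SOME B. is_basis A B)"

lemma is_basis_basis_A: "is_basis A basis_A"
proof -
  interpret vector_space "smul A" by (rule vspace)
  have "is_basis A (extend_basis {})"
    using independent_extend_basis[OF independent_empty] span_extend_basis[OF independent_empty]
    by (simp add: is_basis_def lspan_def carrier_UNIV)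
  then show ?thesis unfolding basis_A_def by (rule someI)
qed

lemma finite_coord: "finite {i. coord A basis_A i p \<noteq> 0}"
proof -
  interpret vector_space "smul A" by (rule vspace)
  show ?thesis unfolding coord_def by (rule finite_representation)
qed

lemma lf_coord: "lf (coord A basis_A i)"
proof -
  interpret vector_space "smul A" by (rule vspace)
  have b: "independent basis_A" "\<And>x. x \<in> span basis_A"
    using is_basis_basis_A by (simp_all add: is_basis_def lspan_def carrier_UNIV)
  show ?thesis
    by (simp add: lf_iff coord_def representation_add[OF b(1) b(2) b(2)] representation_scale[OF b])
qed

lemma coord_expand: "(\<Sum>i | coord A basis_A i p \<noteq> 0. smul A (coord A basis_A i p) i) = p"
proof -
  interpret vector_space "smul A" by (rule vspace)
  show ?thesis
    using is_basis_basis_A sum_nonzero_representation_eq[of basis_A p]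
    by (simp add: is_basis_def lspan_def carrier_UNIV coord_def)
qed

lemma lf_expand:
  assumes "lf g"
  shows "g p = (\<Sum>i | coord A basis_A i p \<noteq> 0. coord A basis_A i p * g i)"
proof -
  have "g p = g (\<Sum>i | coord A basis_A i p \<noteq> 0. smul A (coord A basis_A i p) i)"
    by (simp add: coord_expand)
  also have "\<dots> = (\<Sum>i | coord A basis_A i p \<noteq> 0. g (smul A (coord A basis_A i p) i))"
    by (rule lin_sum[OF is_vspace_A is_vspace_ground assms]) simp
  finally show ?thesis using assms by (simp add: lf_iff)
qed

lemma lf_sum: "(\<And>i. i \<in> I \<Longrightarrow> lf (F i)) \<Longrightarrow> lf (\<lambda>x. \<Sum>i\<in>I. F i x)"
  by (induction I rule: infinite_finite_induct) (auto simp: lf_iff algebra_simps)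

lemma lf_mult_left: "lf g \<Longrightarrow> lf (\<lambda>x. c * g x)"
  and lf_mult_right: "lf g \<Longrightarrow> lf (\<lambda>x. g x * c)"
  by (auto simp: lf_iff algebra_simps)

lemma lf_coord_sum: "lf (\<lambda>p. \<Sum>i | coord A basis_A i p \<noteq> 0. coord A basis_A i p * c i)"
proof -
  define g where "g K p = (\<Sum>i\<in>K. coord A basis_A i p * c i)" for K p
  have l: "lf (g K)" for K
    unfolding g_def by (intro lf_sum lf_mult_right lf_coord)
  have eq: "(\<Sum>i | coord A basis_A i p \<noteq> 0. coord A basis_A i p * c i) = g K p"
    if "finite K" "{i. coord A basis_A i p \<noteq> 0} \<subseteq> K" for K p
    unfolding g_def by (rule sum.mono_neutral_left) (use that in auto)
  show ?thesis
    unfolding lf_iff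
  proof (intro conjI allI)
    fix x y
    let ?K = "{i. coord A basis_A i (x + y) \<noteq> 0} \<union> {i. coord A basis_A i x \<noteq> 0} \<union> {i. coord A basis_A i y \<noteq> 0}"
    have "finite ?K" by (simp add: finite_coord)
    note eq = eq[OF this]
    show "(\<Sum>i | coord A basis_A i (x + y) \<noteq> 0. coord A basis_A i (x + y) * c i)
      = (\<Sum>i | coord A basis_A i x \<noteq> 0. coord A basis_A i x * c i) + (\<Sum>i | coord A basis_A i y \<noteq> 0. coord A basis_A i y * c i)"
      using l[of ?K] by (subst (1 2 3) eq) (auto simp: lf_iff)
  next
    fix d x
    let ?K = "{i. coord A basis_A i (smul A d x) \<noteq> 0} \<union> {i. coord A basis_A i x \<noteq> 0}"
    have "finite ?K" by (simp add: finite_coord)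
    note eq = eq[OF this]
    show "(\<Sum>i | coord A basis_A i (smul A d x) \<noteq> 0. coord A basis_A i (smul A d x) * c i)
      = d * (\<Sum>i | coord A basis_A i x \<noteq> 0. coord A basis_A i x * c i)"
      using l[of ?K] by (subst (1 2) eq) (auto simp: lf_iff)
  qed
qed

lemma bfI: "(\<And>p. lf (\<lambda>q. F p q)) \<Longrightarrow> (\<And>q. lf (\<lambda>p. F p q)) \<Longrightarrow> bf F"
  by (simp add: bilin_ground_iff)

text \<open>
  The bilinear extension of the restriction of \<open>F\<close> to pairs of basis elements. Evaluating tensors at
  \<open>bilin_ext F\<close> instead of \<open>F\<close> makes evaluation linear in \<open>F\<close>, and evaluations at different tensors
  interchangeable, for arbitrary functions \<open>F\<close>; bilinearity only matters where a function is evaluated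
  at given elements.
\<close>

definition bilin_ext :: "('a \<Rightarrow> 'a \<Rightarrow> 'k) \<Rightarrow> 'a \<Rightarrow> 'a \<Rightarrow> 'k" where
  "bilin_ext F p q = (\<Sum>i | coord A basis_A i p \<noteq> 0. coord A basis_A i p *
     (\<Sum>j | coord A basis_A j q \<noteq> 0. coord A basis_A j q * F i j))"

lemma bf_bilin_ext: "bf (bilin_ext F)"
proof (rule bfI)
  show "lf (\<lambda>q. bilin_ext F p q)" for p
    unfolding bilin_ext_def by (intro lf_sum lf_mult_left lf_coord_sum)
  show "lf (\<lambda>p. bilin_ext F p q)" for q
    unfolding bilin_ext_def by (rule lf_coord_sum)
qed

lemma bilin_ext_bilin:
  assumes F: "bf F"
  shows "bilin_ext F = F"
proof (intro ext)
  fix p q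
  have "F p q = (\<Sum>i | coord A basis_A i p \<noteq> 0. coord A basis_A i p * F i q)"
    using F by (intro lf_expand) (simp add: bilin_ground_iff)
  also have "\<dots> = bilin_ext F p q"
    unfolding bilin_ext_def
    using F by (intro sum.cong refl arg_cong2[where f = "(*)"] lf_expand) (simp add: bilin_ground_iff)
  finally show "bilin_ext F p q = F p q" by simp
qed

text \<open>
  For bilinear \<open>F\<close>, read \<open>ev t (\<lambda>p q. F p q)\<close> as the sum of the \<open>F p q\<close> over the elementary tensors
  \<open>p \<odot> q\<close> in any representation of \<open>t\<close>; for other \<open>F\<close>, in the representation by basis elements.
\<close>

definition ev :: "('k, 'a, 'a) tensor \<Rightarrow> ('a \<Rightarrow> 'a \<Rightarrow> 'k) \<Rightarrow> 'k" where
  "ev t F = t (bilin_ext F)"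

lemma ev_bilin: "bf F \<Longrightarrow> ev t F = t F"
  by (simp add: ev_def bilin_ext_bilin)

lemma ev_pure: "bf F \<Longrightarrow> ev (a \<odot> b) F = F a b"
  by (simp add: ev_bilin pure_def)

lemma lin_ev: "lin A2 ground (\<lambda>t. ev t F)"
  unfolding ev_def by (rule lin_tens_eval)

text \<open>
  The source of the formal rules of evaluation: the finite set and the coefficients do not depend
  on \<open>F\<close>.
\<close>

lemma ev_finite:
  assumes "t \<in> carrier A2"
  shows "\<exists>(S :: ('a \<times> 'a) set) c. finite S \<and> (\<forall>F. ev t F = (\<Sum>s\<in>S. c s * F (fst s) (snd s)))"
  using assms
proof (induction rule: tens_induct)
  case zero
  show ?case by (rule exI[of _ "{}"]) (simp add: ev_def)
next
  case (add c v w t)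
  then obtain S d where S: "finite S" "\<And>F. ev t F = (\<Sum>s\<in>S. d s * F (fst s) (snd s))" by blast
  let ?P = "{i. coord A basis_A i v \<noteq> 0} \<times> {j. coord A basis_A j w \<noteq> 0}"
  let ?d = "\<lambda>s. (if s \<in> ?P then c * (coord A basis_A (fst s) v * coord A basis_A (snd s) w) else 0)
      + (if s \<in> S then d s else 0)"
  have "ev (smul A2 c (v \<odot> w) + t) F = (\<Sum>s\<in>?P \<union> S. ?d s * F (fst s) (snd s))" for F
  proof -
    have f: "finite (?P \<union> S)" using S by (simp add: finite_coord)
    have "ev (smul A2 c (v \<odot> w) + t) F = c * bilin_ext F v w + ev t F"
      by (simp add: ev_def pointwise_def pure_def bf_bilin_ext)
    also have "c * bilin_ext F v w =
        (\<Sum>s\<in>?P. c * (coord A basis_A (fst s) v * coord A basis_A (snd s) w) * F (fst s) (snd s))"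
      unfolding bilin_ext_def by (simp add: sum.cartesian_product sum_distrib_left mult.assoc case_prod_beta)
    also have "\<dots> = (\<Sum>s\<in>?P \<union> S. (if s \<in> ?P then c * (coord A basis_A (fst s) v * coord A basis_A (snd s) w) else 0)
        * F (fst s) (snd s))"
      by (intro sum.mono_neutral_cong_left) (use f in auto)
    also have "ev t F = (\<Sum>s\<in>?P \<union> S. (if s \<in> S then d s else 0) * F (fst s) (snd s))"
      unfolding S(2) by (intro sum.mono_neutral_cong_left) (use f in auto)
    finally show ?thesis by (simp only: sum.distrib[symmetric] distrib_right[symmetric])
  qed
  moreover have "finite (?P \<union> S)" using S by (simp add: finite_coord)
  ultimately show ?case by (intro exI[of _ "?P \<union> S"] exI[of _ ?d] conjI allI)
qed

lemma ev_mult_left: "t \<in> carrier A2 \<Longrightarrow> ev t (\<lambda>p q. c * F p q) = c * ev t F"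
  using ev_finite[of t] by (auto simp: sum_distrib_left mult.left_commute)

lemma ev_mult_right: "t \<in> carrier A2 \<Longrightarrow> ev t (\<lambda>p q. F p q * c) = ev t F * c"
  using ev_mult_left[of t c F] by (simp add: mult.commute)

lemma ev_sum: "t \<in> carrier A2 \<Longrightarrow> ev t (\<lambda>p q. \<Sum>i\<in>I. F i p q) = (\<Sum>i\<in>I. ev t (F i))"
  using ev_finite[of t] by (auto simp: sum_distrib_left intro: sum.swap)

lemma ev_swap:
  assumes "t \<in> carrier A2" "u \<in> carrier A2"
  shows "ev t (\<lambda>p q. ev u (\<lambda>x y. F p q x y)) = ev u (\<lambda>x y. ev t (\<lambda>p q. F p q x y))"
proof -
  obtain S :: "('a \<times> 'a) set" and c where "\<And>F. ev t F = (\<Sum>s\<in>S. c s * F (fst s) (snd s))"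
    using ev_finite[OF assms(1)] by blast
  then show ?thesis using assms(2) by (simp add: ev_sum ev_mult_left)
qed

lemma lf_ev: "t \<in> carrier A2 \<Longrightarrow> (\<And>p q. lf (\<lambda>x. F x p q)) \<Longrightarrow> lf (\<lambda>x. ev t (\<lambda>p q. F x p q))"
  using ev_finite[of t] by (auto intro!: lf_sum lf_mult_left)

lemma ev_lin:
  assumes "lin A2 A2 G" "t \<in> carrier A2"
  shows "ev (G t) F = ev t (\<lambda>p q. ev (G (p \<odot> q)) F)"
proof -
  have "lin A2 ground (\<lambda>t. ev (G t) F)" by (rule lin_compose[OF assms(1) lin_ev])
  note tens_expand[OF this is_vspace_A is_vspace_A assms(2)]
  moreover have "bf (\<lambda>p q. ev (G (p \<odot> q)) F)"
    by (rule bilin_lin_comp[OF bilin_pure[OF is_vspace_A is_vspace_A] lin_compose[OF assms(1) lin_ev]])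
  ultimately show ?thesis by (simp add: ev_bilin)
qed

lemma lin_carrier: "lin A2 A2 G \<Longrightarrow> t \<in> carrier A2 \<Longrightarrow> G t \<in> carrier A2"
  by (simp add: lin_def)

lemma pure_carrier [simp]: "a \<odot> b \<in> carrier A2"
  by (simp add: pure_in_tens)

lemma lin_smul_mult: "lin A A (\<lambda>x. x)" "lin A A (\<lambda>x. x * c)" "lin A A (\<lambda>x. c * x)"
  by (auto simp: lin_def algebra_simps smul_mult_left smul_mult_right)

lemma lin_mult_comp:
  "lin A A h \<Longrightarrow> lin A A (\<lambda>x. h x * c)" "lin A A h \<Longrightarrow> lin A A (\<lambda>x. c * h x)"
  by (auto simp: lin_def algebra_simps smul_mult_left smul_mult_right)

lemma lf_comp: "lf g \<Longrightarrow> lin A A h \<Longrightarrow> lf (\<lambda>x. g (h x))"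
  by (rule lin_compose)

lemma lf_ev_pure:
  assumes "lin A2 A2 G"
  shows "lf (\<lambda>x. ev (G (x \<odot> c)) F)" "lf (\<lambda>x. ev (G (c \<odot> x)) F)"
  using bilin_lin_comp[OF bilin_pure[OF is_vspace_A is_vspace_A] lin_compose[OF assms lin_ev]]
  by (auto simp: bilin_def)

lemma lf_ev_pure_comp:
  assumes "lin A2 A2 G" "lin A A h"
  shows "lf (\<lambda>x. ev (G (h x \<odot> c)) F)" "lf (\<lambda>x. ev (G (c \<odot> h x)) F)"
  using lf_comp[OF lf_ev_pure(1)[OF assms(1)] assms(2)] lf_comp[OF lf_ev_pure(2)[OF assms(1)] assms(2)]
  by auto

subsection \<open>Cancellation\<close>

text \<open>
  To cancel a factor \<open>r\<close> in an equation between evaluations, it must hold under all functionals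
  \<open>k\<close> composed with multiplication by \<open>r\<close>, and both sides must be values of \<open>k\<close> at some elements of \<open>A\<close>.
  The latter is automatic for iterated evaluations in which \<open>k\<close> occurs once.
\<close>

definition represented :: "(('a \<Rightarrow> 'k) \<Rightarrow> 'k) \<Rightarrow> bool" where
  "represented \<Psi> \<longleftrightarrow> (\<exists>x. \<forall>k. lf k \<longrightarrow> \<Psi> k = k x)"

lemma represented_point: "represented (\<lambda>k. k x)"
  unfolding represented_def by blast

lemma represented_sum:
  assumes "\<And>i. i \<in> I \<Longrightarrow> represented (\<lambda>k. \<Psi> i k)"
  shows "represented (\<lambda>k. \<Sum>i\<in>I. c i * \<Psi> i k)"
proof -
  from assms obtain x where x: "\<And>i k. i \<in> I \<Longrightarrow> lf k \<Longrightarrow> \<Psi> i k = k (x i)"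
    unfolding represented_def by metis
  have "(\<Sum>i\<in>I. c i * \<Psi> i k) = k (\<Sum>i\<in>I. smul A (c i) (x i))" if k: "lf k" for k
    using k by (subst lin_sum[OF is_vspace_A is_vspace_ground k]) (auto simp: x lf_iff)
  then show ?thesis unfolding represented_def by blast
qed

lemma represented_mult:
  assumes "represented (\<lambda>k. \<Psi> k)"
  shows "represented (\<lambda>k. c * \<Psi> k)" "represented (\<lambda>k. \<Psi> k * c)"
  using represented_sum[of "{0::nat}" "\<lambda>_. \<Psi>" "\<lambda>_. c"] assms by (auto simp: mult.commute)

lemma represented_ev:
  assumes "t \<in> carrier A2" "\<And>p q. represented (\<lambda>k. \<Psi> k p q)"
  shows "represented (\<lambda>k. ev t (\<lambda>p q. \<Psi> k p q))"
proof -
  obtain S :: "('a \<times> 'a) set" and c where "\<And>F. ev t F = (\<Sum>s\<in>S. c s * F (fst s) (snd s))"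
    using ev_finite[OF assms(1)] by blast
  then show ?thesis using assms(2) by (auto intro: represented_sum)
qed

lemma functional_eqD: "(\<And>k. lf k \<Longrightarrow> k x = k y) \<Longrightarrow> x = (y::'a)"
  by (rule functionals_separate[OF is_vspace_A])

text \<open>
  If \<open>\<Psi>\<close> and \<open>\<Phi>\<close> are the evaluations at \<open>x\<close> and \<open>y\<close>, the premise says \<open>x r = y r\<close> for all \<open>r\<close>.
\<close>

lemma cancel_right:
  assumes \<Psi>: "represented \<Psi>" and \<Phi>: "represented \<Phi>"
    and eq: "\<And>k r. lf k \<Longrightarrow> \<Psi> (\<lambda>x. k (x * r)) = \<Phi> (\<lambda>x. k (x * r))"
    and k: "lf k"
  shows "\<Psi> k = \<Phi> k"
proof -
  obtain x y where xy: "\<And>k. lf k \<Longrightarrow> \<Psi> k = k x" "\<And>k. lf k \<Longrightarrow> \<Phi> k = k y"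
    using \<Psi> \<Phi> unfolding represented_def by blast
  have "(x - y) * r = 0" for r
  proof -
    have "k (x * r) = k (y * r)" if "lf k" for k
      using eq[OF that, of r] lf_comp[OF that lin_smul_mult(2)] by (simp add: xy)
    then have "x * r = y * r" by (rule functional_eqD)
    then show ?thesis by (simp add: algebra_simps)
  qed
  then have "x = y" using nondegenerate_left[of "x - y"] by simp
  then show ?thesis using xy k by simp
qed

lemma cancel_left:
  assumes \<Psi>: "represented \<Psi>" and \<Phi>: "represented \<Phi>"
    and eq: "\<And>k r. lf k \<Longrightarrow> \<Psi> (\<lambda>x. k (r * x)) = \<Phi> (\<lambda>x. k (r * x))"
    and k: "lf k"
  shows "\<Psi> k = \<Phi> k"
proof -
  obtain x y where xy: "\<And>k. lf k \<Longrightarrow> \<Psi> k = k x" "\<And>k. lf k \<Longrightarrow> \<Phi> k = k y"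
    using \<Psi> \<Phi> unfolding represented_def by blast
  have "r * (x - y) = 0" for r
  proof -
    have "k (r * x) = k (r * y)" if "lf k" for k
      using eq[OF that, of r] lf_comp[OF that lin_smul_mult(3)] by (simp add: xy)
    then have "r * x = r * y" by (rule functional_eqD)
    then show ?thesis by (simp add: algebra_simps)
  qed
  then have "x = y" using nondegenerate_right[of "x - y"] by simp
  then show ?thesis using xy k by simp
qed

lemma bilin_mult: "bilin A A A (*)"
  unfolding bilin_def using lin_smul_mult by auto

lemma mu_pure: "mu (a \<odot> b) = a * b"
  by (rule tlift_pure[OF is_vspace_A bilin_mult]) auto

lemma lin_mu: "lin A2 A mu"
  by (rule lin_tlift[OF is_vspace_A bilin_mult])

lemma ev_span_eq:
  assumes t: "t \<in> lspan A2 S" and eq: "\<And>s. s \<in> S \<Longrightarrow> ev s F = ev s G"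
  shows "ev t F = ev t G"
proof -
  interpret vector_space pointwise by (rule vector_space_pointwise)
  have "t \<in> span S" using t by (simp add: lspan_def)
  then show ?thesis
    by (induction rule: span_induct_alt) (auto simp: ev_def pointwise_def eq[unfolded ev_def])
qed

subsection \<open>Operators in the legs\<close>

lemma ev_tact:
  assumes "lin A A h" "lin A A k" "t \<in> carrier A2" "bf F"
  shows "ev (tact A A h k t) F = ev t (\<lambda>p q. F (h p) (k q))"
proof -
  have l: "lin A2 A2 (tact A A h k)"
    unfolding tact_def by (rule lin_tens_map[OF assms(1,2) is_vspace_A is_vspace_A])
  have "tact A A h k (p \<odot> q) = h p \<odot> k q" for p q
    unfolding tact_def by (rule tens_map_pure[OF assms(1,2) is_vspace_A is_vspace_A]) simp_all
  then show ?thesis using ev_lin[OF l assms(3)] assms(4) by (simp add: ev_pure)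
qed

lemma ev_tact_prod:
  assumes h: "lin A A h" and k: "lin A A k" and t: "t \<in> carrier A2" and f: "lf f" and g: "lf g"
  shows "ev (tact A A h k t) (\<lambda>p q. f p * g q) = ev t (\<lambda>p q. f (h p) * g (k q))"
  by (rule ev_tact[OF h k t]) (intro bfI lf_mult_left lf_mult_right f g)

lemma tact_carrier:
  assumes "lin A A h" "lin A A k" "t \<in> carrier A2"
  shows "tact A A h k t \<in> carrier A2"
  unfolding tact_def by (rule lin_carrier[OF lin_tens_map[OF assms(1,2) is_vspace_A is_vspace_A] assms(3)])

lemma ev_slice_left:
  assumes "lf \<omega>" "t \<in> carrier A2" "lf g"
  shows "g (slice_left A A \<omega> t) = ev t (\<lambda>p q. \<omega> p * g q)"
  by (simp add: slice_left_eval[OF is_vspace_A is_vspace_A assms] ev_bilin bilin_prod assms)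

lemma ev_slice_right:
  assumes "lf \<omega>" "t \<in> carrier A2" "lf g"
  shows "g (slice_right A A \<omega> t) = ev t (\<lambda>p q. g p * \<omega> q)"
  by (simp add: slice_right_eval[OF is_vspace_A is_vspace_A assms] ev_bilin bilin_prod assms)

abbreviation tf where "tf \<equiv> trilin A A A"

lemma pure3_carrier: "pure A2 A (a \<odot> b) c \<in> carrier A3"
  by (simp add: pure_in_tens)

lemma eval3_pure_A: "tf f \<Longrightarrow> eval3 (pure A2 A (a \<odot> b) c) f = f a b c"
  by (rule eval3_pure[OF _ is_vspace_A]) simp_all

lemma tf_ev:
  assumes "lin A2 A2 G" "tf f"
  shows "tf (\<lambda>x y z. ev (G (x \<odot> y)) (\<lambda>x' y'. f x' y' z))"
    "tf (\<lambda>x y z. ev (G (y \<odot> z)) (\<lambda>y' z'. f x y' z'))"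
    "tf (\<lambda>x y z. ev (G (x \<odot> z)) (\<lambda>x' z'. f x' y z'))"
  using trilin_leg12[OF is_vspace_A is_vspace_A is_vspace_A assms]
    trilin_leg23[OF is_vspace_A is_vspace_A is_vspace_A assms]
    trilin_leg13[OF is_vspace_A is_vspace_A is_vspace_A assms] trilinD[OF assms(2)]
  by (simp_all add: ev_bilin)

lemma eval3_leg:
  assumes G: "lin A2 A2 G" and f: "tf f" and s: "s \<in> carrier A3"
  shows "eval3 (leg12 A A A G s) f = eval3 s (\<lambda>x y z. ev (G (x \<odot> y)) (\<lambda>x' y'. f x' y' z))"
    "eval3 (leg23 A A A G s) f = eval3 s (\<lambda>x y z. ev (G (y \<odot> z)) (\<lambda>y' z'. f x y' z'))"
    "eval3 (leg13 A A A G s) f = eval3 s (\<lambda>x y z. ev (G (x \<odot> z)) (\<lambda>x' z'. f x' y z'))"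
  using eval3_leg12[OF is_vspace_A is_vspace_A is_vspace_A G f s]
    eval3_leg23[OF is_vspace_A is_vspace_A is_vspace_A G f s]
    eval3_leg13[OF is_vspace_A is_vspace_A is_vspace_A G f s] trilinD[OF f]
  by (simp_all add: ev_bilin)

lemma leg_carrier:
  assumes "lin A2 A2 G" "s \<in> carrier A3"
  shows "leg12 A A A G s \<in> carrier A3" "leg23 A A A G s \<in> carrier A3" "leg13 A A A G s \<in> carrier A3"
  using lin_leg12[OF is_vspace_A is_vspace_A is_vspace_A assms(1)] 
    lin_leg23[OF is_vspace_A is_vspace_A is_vspace_A assms(1)]
    lin_leg13[OF is_vspace_A is_vspace_A is_vspace_A assms(1)] assms(2)
  by (simp_all add: lin_def)

text \<open>
  The trilinear form is transformed from the outside to the inside, so the operator applied first to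
  the tensor becomes the outer evaluation.
\<close>

lemma eval3_two_legs:
  assumes G: "lin A2 A2 G" and H: "lin A2 A2 H" and f: "tf f"
  shows "eval3 (leg12 A A A G (leg23 A A A H (pure A2 A (a \<odot> b) c))) f
      = ev (H (b \<odot> c)) (\<lambda>p q. ev (G (a \<odot> p)) (\<lambda>x y. f x y q))"
    and "eval3 (leg23 A A A H (leg12 A A A G (pure A2 A (a \<odot> b) c))) f
      = ev (G (a \<odot> b)) (\<lambda>x y. ev (H (y \<odot> c)) (\<lambda>p q. f x p q))"
    and "eval3 (leg23 A A A H (leg13 A A A G (pure A2 A (a \<odot> b) c))) f
      = ev (G (a \<odot> c)) (\<lambda>x z. ev (H (b \<odot> z)) (\<lambda>p q. f x p q))"
    and "eval3 (leg13 A A A G (leg23 A A A H (pure A2 A (a \<odot> b) c))) f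
      = ev (H (b \<odot> c)) (\<lambda>p q. ev (G (a \<odot> q)) (\<lambda>x z. f x p z))"
  using eval3_pure_A[OF tf_ev(2)[OF H tf_ev(1)[OF G f]]] eval3_pure_A[OF tf_ev(1)[OF G tf_ev(2)[OF H f]]]
    eval3_pure_A[OF tf_ev(3)[OF G tf_ev(2)[OF H f]]] eval3_pure_A[OF tf_ev(2)[OF H tf_ev(3)[OF G f]]]
  by (simp_all add: eval3_leg(1)[OF G f] eval3_leg(2)[OF H f] eval3_leg(3)[OF G f]
      eval3_leg(1)[OF G tf_ev(2)[OF H f]] eval3_leg(2)[OF H tf_ev(1)[OF G f]]
      eval3_leg(3)[OF G tf_ev(2)[OF H f]] eval3_leg(2)[OF H tf_ev(3)[OF G f]]
      leg_carrier[OF G] leg_carrier[OF H] pure3_carrier)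

end

section \<open>The axioms of a weak multiplier bialgebra in Sweedler form\<close>

context regular_weak_multiplier_bialgebra
begin

lemmas lin_E1 = lin_maps(1) and lin_E2 = lin_maps(2) and lin_T1 = lin_maps(3) and lin_T2 = lin_maps(4)
  and lin_T4 = lin_maps(6)

lemma maps_carrier [simp]:
  "t \<in> carrier A2 \<Longrightarrow> E1 t \<in> carrier A2" "t \<in> carrier A2 \<Longrightarrow> E2 t \<in> carrier A2"
  "t \<in> carrier A2 \<Longrightarrow> T1 t \<in> carrier A2" "t \<in> carrier A2 \<Longrightarrow> T2 t \<in> carrier A2"
  "t \<in> carrier A2 \<Longrightarrow> T4 t \<in> carrier A2"
  using lin_maps by (simp_all add: lin_def)

lemmas lf_intros =
  lf_mult_left lf_mult_right lf_ev
  lf_ev_pure[OF lin_E1] lf_ev_pure[OF lin_E2] lf_ev_pure[OF lin_T1] lf_ev_pure[OF lin_T2] lf_ev_pure[OF lin_T4]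
  lf_ev_pure_comp[OF lin_E1] lf_ev_pure_comp[OF lin_E2] lf_ev_pure_comp[OF lin_T1]
  lf_ev_pure_comp[OF lin_T2] lf_ev_pure_comp[OF lin_T4]
  lin_mult_comp lin_smul_mult
  pure_carrier maps_carrier
  lf_comp[OF lin_counit] lin_counit

lemmas rep_intros = represented_point represented_mult represented_ev pure_carrier maps_carrier

lemma tf_prod:
  assumes "lf f" "lf g" "lf h"
  shows "tf (\<lambda>x y z. f x * g y * h z)" "tf (\<lambda>x y z. f x * (g y * h z))"
  unfolding trilin_def by (auto intro!: lf_intros assms)

lemma T2_T1_ev:
  assumes "tf f"
  shows "ev (T1 (b \<odot> c)) (\<lambda>p q. ev (T2 (a \<odot> p)) (\<lambda>x y. f x y q))
    = ev (T2 (a \<odot> b)) (\<lambda>x y. ev (T1 (y \<odot> c)) (\<lambda>p q. f x p q))"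
  using arg_cong[OF T2_T1[OF pure3_carrier[of a b c]], of "\<lambda>s. eval3 s f"]
  by (simp only: eval3_two_legs lin_maps assms)

lemma E1_T1_ev:
  assumes "tf f"
  shows "ev (T1 (b \<odot> c)) (\<lambda>p q. ev (E1 (a \<odot> p)) (\<lambda>x y. f x y q))
    = ev (E1 (a \<odot> b)) (\<lambda>x y. ev (T1 (y \<odot> c)) (\<lambda>p q. f x p q))"
  using arg_cong[OF E1_T1[OF pure3_carrier[of a b c]], of "\<lambda>s. eval3 s f"]
  by (simp only: eval3_two_legs lin_maps assms)

text \<open>
  In Sweedler notation, \<open>(a \<otimes> \<Delta>(c))(E \<otimes> 1) = (A \<otimes> \<Delta>)((a \<otimes> c)E)\<close> with a factor \<open>b\<close> on the left of the
  middle leg.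
\<close>

lemma E2_T2_ev:
  assumes "tf f"
  shows "ev (T2 (b \<odot> c)) (\<lambda>p q. ev (E2 (a \<odot> p)) (\<lambda>x y. f x y q))
    = ev (E2 (a \<odot> c)) (\<lambda>x z. ev (T2 (b \<odot> z)) (\<lambda>p q. f x p q))"
  using arg_cong[OF E2_T2[OF pure3_carrier[of a b c]], of "\<lambda>s. eval3 s f"]
  by (simp only: eval3_two_legs lin_maps assms)

lemma eval3_mu:
  assumes u: "u \<in> carrier A3" and f: "lf f" and g: "lf g"
  shows "ev (tens_map A2 A A A mu id u) (\<lambda>x z. f x * g z) = eval3 u (\<lambda>x y z. f (x * y) * g z)"
proof -
  have l: "lin A3 A2 (tens_map A2 A A A mu id)"
    by (rule lin_tens_map[OF lin_mu lin_id(1) is_vspace_A is_vspace_A])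
  have t: "tf (\<lambda>x y z. f (x * y) * g z)"
    unfolding trilin_def by (auto intro!: lf_intros f g lf_comp[OF f])
  show ?thesis
    by (rule lin_tens3_eqI[OF is_vspace_A is_vspace_A is_vspace_A is_vspace_ground
          lin_compose[OF l lin_ev] lin_eval3 _ u])
      (simp add: tens_map_pure[OF lin_mu lin_id(1) is_vspace_A is_vspace_A] mu_pure eval3_pure_A[OF t]
        ev_pure bfI lf_mult_left lf_mult_right f g)
qed

text \<open>
  Multiplicativity of the comultiplication: \<open>\<Delta>(ab)(1 \<otimes> c) = \<Delta>(a)\<Delta>(b)(1 \<otimes> c)\<close>.
\<close>

lemma T1_mult_ev:
  assumes f: "lf f" and g: "lf g"
  shows "ev (T1 ((a * b) \<odot> c)) (\<lambda>p q. f p * g q)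
    = ev (T1 (b \<odot> c)) (\<lambda>p q. ev (T1 (a \<odot> q)) (\<lambda>x y. f (x * p) * g y))"
proof -
  have t: "tf (\<lambda>x y z. f (x * y) * g z)"
    unfolding trilin_def by (auto intro!: lf_intros f g lf_comp[OF f])
  have "tens_map A2 A A A mu id (pure A2 A (a \<odot> b) c) = (a * b) \<odot> c"
    by (simp add: tens_map_pure[OF lin_mu lin_id(1) is_vspace_A is_vspace_A] mu_pure)
  then show ?thesis
    using arg_cong[OF T1_mult[OF pure3_carrier[of a b c]], of "\<lambda>s. ev s (\<lambda>p q. f p * g q)"]
    by (simp add: eval3_mu f g leg_carrier lin_T1 pure3_carrier eval3_two_legs(4)[OF lin_T1 lin_T1 t])
qed

lemma counit_T1_ev: "lf g \<Longrightarrow> ev (T1 (a \<odot> b)) (\<lambda>p q. counit p * g q) = g (a * b)"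
  using arg_cong[OF counit_T1[OF pure_carrier[of a b]], of g]
  by (simp add: ev_slice_left lin_counit mu_pure)

lemma counit_T2_ev: "lf g \<Longrightarrow> ev (T2 (a \<odot> b)) (\<lambda>p q. g p * counit q) = g (a * b)"
  using arg_cong[OF counit_T2[OF pure_carrier[of a b]], of g]
  by (simp add: ev_slice_right lin_counit mu_pure)

lemma E1_E2_ev:
  assumes "lf f" "lf g"
  shows "ev (E1 (c \<odot> d)) (\<lambda>p q. f (a * p) * g (b * q)) = ev (E2 (a \<odot> b)) (\<lambda>p q. f (p * c) * g (q * d))"
  using arg_cong[OF E1_E2[of a b c d], of "\<lambda>t. ev t (\<lambda>p q. f p * g q)"] assms
  by (simp add: ev_tact_prod lin_smul_mult lin_id)

lemma E1_idem_ev: "ev (E1 (c \<odot> d)) (\<lambda>p q. ev (E1 (p \<odot> q)) F) = ev (E1 (c \<odot> d)) F"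
  using E1_idem[of "c \<odot> d"] ev_lin[OF lin_E1, of "E1 (c \<odot> d)" F] by simp

lemma counit_E1_ev:
  assumes k: "lf k"
  shows "ev (E1 (b \<odot> c)) (\<lambda>p q. counit p * k (a * q)) = ev (T1 (a \<odot> c)) (\<lambda>p q. counit (p * b) * k q)"
  using arg_cong[OF counit_E1[of a b c], of k]
  by (simp add: ev_slice_left[OF lin_counit _ k] tact_carrier ev_tact_prod lin_smul_mult lin_id
      lin_counit k)

lemma counit_E2_ev:
  assumes k: "lf k"
  shows "ev (E2 (a \<odot> b)) (\<lambda>p q. counit p * k (q * c)) = ev (T2 (a \<odot> c)) (\<lambda>p q. counit p * k (b * q))"
  using arg_cong[OF counit_E2[where a = a and b = b and c = c], of k]
  by (simp add: ev_slice_left[OF lin_counit _ k] tact_carrier ev_tact_prod lin_smul_mult lin_id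
      lin_counit k)

lemma T2_T4_ev:
  assumes "lf f" "lf g"
  shows "ev (T2 (a \<odot> c)) (\<lambda>p q. f (p * b) * g q) = ev (T4 (b \<odot> c)) (\<lambda>p q. f (a * p) * g q)"
  using arg_cong[OF T2_T4[of b a c], of "\<lambda>t. ev t (\<lambda>p q. f p * g q)"] assms
  by (simp add: ev_tact_prod lin_smul_mult lin_id)

text \<open>
  Both sides describe \<open>(a \<otimes> 1)\<Delta>(b)(1 \<otimes> c)\<close>. The identity results from coassociativity by applying the
  counit to the middle leg.
\<close>

lemma T1_T2_ev:
  assumes f: "lf f" and g: "lf g"
  shows "ev (T1 (b \<odot> c)) (\<lambda>p q. f (a * p) * g q) = ev (T2 (a \<odot> b)) (\<lambda>p q. f p * g (q * c))"
proof -
  have "tf (\<lambda>x y z. f x * counit y * g z)" by (intro tf_prod f g lin_counit)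
  note coassoc = T2_T1_ev[OF this, of b c a]
  have "ev (T1 (b \<odot> c)) (\<lambda>p q. f (a * p) * g q)
    = ev (T1 (b \<odot> c)) (\<lambda>p q. ev (T2 (a \<odot> p)) (\<lambda>x y. f x * counit y * g q))"
    by (simp add: ev_mult_right counit_T2_ev[OF f])
  also have "\<dots> = ev (T2 (a \<odot> b)) (\<lambda>p q. f p * g (q * c))"
    unfolding coassoc by (simp add: mult.assoc ev_mult_left counit_T1_ev[OF g])
  finally show ?thesis .
qed

section \<open>The counit\<close>

lemma represented_zero: "represented (\<lambda>k. 0)"
  using represented_mult(1)[OF represented_point, of 0] by simp

text \<open>
  For unital \<open>A\<close> this is the product of \<open>\<epsilon>(1\<^sub>1b) 1\<^sub>2\<close> and \<open>a\<close>. In general \<open>pi_L b\<close> is left multiplication by a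
  multiplier.
\<close>

definition pi_L :: "'a \<Rightarrow> 'a \<Rightarrow> 'a" where
  "pi_L b a = slice_left A A counit (E1 (b \<odot> a))"

lemma pi_L_ev: "lf k \<Longrightarrow> k (pi_L b a) = ev (E1 (b \<odot> a)) (\<lambda>p q. counit p * k q)"
  by (simp add: pi_L_def ev_slice_left[OF lin_counit])

text \<open>
  In Sweedler notation, \<open>u \<pi>(b) a = \<epsilon>(u\<^sub>1b) u\<^sub>2a\<close>.
\<close>

lemma mult_pi_L_ev:
  assumes "lf k"
  shows "k (u * pi_L b a) = ev (T1 (u \<odot> a)) (\<lambda>p q. counit (p * b) * k q)"
  using pi_L_ev[of "\<lambda>x. k (u * x)" b a] counit_E1_ev[OF assms, of b a u]
  by (simp add: lf_intros lf_comp[OF assms])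

text \<open>
  The identity \<open>\<epsilon>(vyz) = \<epsilon>(vy\<^sub>1) \<epsilon>(y\<^sub>2z)\<close>. By \<open>counit_E2_ev\<close> the element \<open>\<epsilon>(vy\<^sub>1) y\<^sub>2\<close> equals \<open>\<epsilon>(v1\<^sub>1) 1\<^sub>2y\<close>, so
  it is compatible with right multiplication of \<open>y\<close> by \<open>z\<close>; apply the counit.
\<close>

lemma counit_mult3_ev:
  "counit (v * (y * z)) = ev (T1 (y \<odot> z)) (\<lambda>p q. counit (v * p) * counit q)"
proof -
  have "ev (T2 (v \<odot> y)) (\<lambda>p q. counit p * counit (q * z)) = ev (T2 (v \<odot> (y * z))) (\<lambda>p q. counit p * counit q)"
  proof (rule cancel_left[where \<Psi> = "\<lambda>k. ev (T2 (v \<odot> y)) (\<lambda>p q. counit p * k (q * z))"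
        and \<Phi> = "\<lambda>k. ev (T2 (v \<odot> (y * z))) (\<lambda>p q. counit p * k q)"])
    fix k r assume k: "lf k"
    have "lf (\<lambda>x. k (x * z))" by (intro lf_comp[OF k] lf_intros)
    from counit_E2_ev[OF this, of v r y] counit_E2_ev[OF k, of v r "y * z"]
    show "ev (T2 (v \<odot> y)) (\<lambda>p q. counit p * k (r * (q * z))) =
      ev (T2 (v \<odot> (y * z))) (\<lambda>p q. counit p * k (r * q))"
      by (simp add: mult.assoc)
  qed (intro rep_intros lin_counit)+
  moreover have "ev (T1 (y \<odot> z)) (\<lambda>p q. counit (v * p) * counit q) = ev (T2 (v \<odot> y)) (\<lambda>p q. counit p * counit (q * z))"
    by (rule T1_T2_ev[OF lin_counit lin_counit])
  moreover have "ev (T2 (v \<odot> (y * z))) (\<lambda>p q. counit p * counit q) = counit (v * (y * z))"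
    by (rule counit_T2_ev[OF lin_counit])
  ultimately show ?thesis by simp
qed

text \<open>
  Multiplicativity of the comultiplication again, now in the form
  \<open>(s \<otimes> 1)\<Delta>(zp) = (s \<otimes> 1)\<Delta>(z)\<Delta>(p)\<close>. Multiplied by \<open>1 \<otimes> r\<close> from the right it is \<open>T1_mult_ev\<close>.
\<close>

lemma T2_mult_ev:
  assumes g: "lf g" and k: "lf k"
  shows "ev (T2 (s \<odot> (z * p))) (\<lambda>x y. g x * k y)
    = ev (T2 (s \<odot> z)) (\<lambda>u v. ev (T2 (u \<odot> p)) (\<lambda>x y. g x * k (v * y)))"
proof (rule cancel_right[where \<Psi> = "\<lambda>k. ev (T2 (s \<odot> (z * p))) (\<lambda>x y. g x * k y)"
      and \<Phi> = "\<lambda>k. ev (T2 (s \<odot> z)) (\<lambda>u v. ev (T2 (u \<odot> p)) (\<lambda>x y. g x * k (v * y)))", OF _ _ _ k])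
  fix k r assume k: "lf k"
  have gP: "lf (\<lambda>x. g (x * P))" for P by (intro lf_comp[OF g] lf_intros)
  have kv: "lf (\<lambda>x. k (v * x))" for v by (intro lf_comp[OF k] lf_intros)
  have "ev (T2 (s \<odot> (z * p))) (\<lambda>x y. g x * k (y * r)) = ev (T1 ((z * p) \<odot> r)) (\<lambda>x y. g (s * x) * k y)"
    by (rule T1_T2_ev[OF g k, symmetric])
  also have "\<dots> = ev (T1 (p \<odot> r)) (\<lambda>P Q. ev (T1 (z \<odot> Q)) (\<lambda>x y. g (s * (x * P)) * k y))"
    by (rule T1_mult_ev[OF _ k]) (intro lf_comp[OF g] lf_intros)
  also have "\<dots> = ev (T1 (p \<odot> r)) (\<lambda>P Q. ev (T2 (s \<odot> z)) (\<lambda>u v. g (u * P) * k (v * Q)))"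
    using T1_T2_ev[OF gP k] by (simp add: mult.assoc)
  also have "\<dots> = ev (T2 (s \<odot> z)) (\<lambda>u v. ev (T1 (p \<odot> r)) (\<lambda>P Q. g (u * P) * k (v * Q)))"
    by (rule ev_swap) simp_all
  also have "\<dots> = ev (T2 (s \<odot> z)) (\<lambda>u v. ev (T2 (u \<odot> p)) (\<lambda>x y. g x * k ((v * y) * r)))"
    using T1_T2_ev[OF g kv] by (simp add: mult.assoc)
  finally show "ev (T2 (s \<odot> (z * p))) (\<lambda>x y. g x * k (y * r)) =
    ev (T2 (s \<odot> z)) (\<lambda>u v. ev (T2 (u \<odot> p)) (\<lambda>x y. g x * k ((v * y) * r)))" .
qed (intro rep_intros)+

text \<open>
  The identity \<open>\<Delta>(z)E = \<Delta>(z)\<close>, applied to \<open>w \<otimes> p\<close>. Multiplied by \<open>s \<otimes> h\<close> from the left, \<open>\<Delta>(z)\<close> becomes an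
  element of the span of the \<open>(b \<otimes> c)E\<close>, on which the idempotent \<open>E\<close> acts as the identity from the
  right.
\<close>

lemma T1_E1_ev:
  assumes g: "lf g" and k: "lf k"
  shows "ev (T1 (z \<odot> p)) (\<lambda>x y. g (x * w) * k y)
    = ev (E1 (w \<odot> p)) (\<lambda>w' p'. ev (T1 (z \<odot> p')) (\<lambda>x y. g (x * w') * k y))"
proof (rule cancel_left[where \<Psi> = "\<lambda>g. ev (T1 (z \<odot> p)) (\<lambda>x y. g (x * w) * k y)" and
    \<Phi> = "\<lambda>g. ev (E1 (w \<odot> p)) (\<lambda>w' p'. ev (T1 (z \<odot> p')) (\<lambda>x y. g (x * w') * k y))", OF _ _ _ g])
  fix g s assume g: "lf g"
  show "ev (T1 (z \<odot> p)) (\<lambda>x y. g (s * (x * w)) * k y)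
    = ev (E1 (w \<odot> p)) (\<lambda>w' p'. ev (T1 (z \<odot> p')) (\<lambda>x y. g (s * (x * w')) * k y))"
  proof (rule cancel_left[where \<Psi> = "\<lambda>k. ev (T1 (z \<odot> p)) (\<lambda>x y. g (s * (x * w)) * k y)" and
      \<Phi> = "\<lambda>k. ev (E1 (w \<odot> p)) (\<lambda>w' p'. ev (T1 (z \<odot> p')) (\<lambda>x y. g (s * (x * w')) * k y))", OF _ _ _ k])
    fix k h assume k: "lf k"
    have gw: "lf (\<lambda>x. g (x * w))" for w by (intro lf_comp[OF g] lf_intros)
    have kh: "lf (\<lambda>x. k (h * x))" for h by (intro lf_comp[OF k] lf_intros)
    have kp: "lf (\<lambda>x. k (x * p))" for p by (intro lf_comp[OF k] lf_intros)
    define F where "F t h = g (t * w) * k (h * p)" for t h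
    define G where "G t h = ev (E1 (w \<odot> p)) (\<lambda>w' p'. g (t * w') * k (h * p'))" for t h
    have F: "bf F" unfolding F_def by (intro bfI lf_intros gw kp)
    have G: "bf G" unfolding G_def by (intro bfI lf_intros gw kp)
    have "ev (tact A A id ((*) h) (T2 (s \<odot> z))) F = ev (tact A A id ((*) h) (T2 (s \<odot> z))) G"
    proof (rule ev_span_eq)
      interpret vector_space pointwise by (rule vector_space_pointwise)
      have "tact A A id ((*) h) (T2 (s \<odot> z)) \<in> lspan A2 {tact A A id ((*) c) (T2 (b \<odot> a)) | a b c. True}"
        unfolding lspan_def smul_tens by (rule span_base) blast
      then show "tact A A id ((*) h) (T2 (s \<odot> z)) \<in> lspan A2 {E2 (b \<odot> c) | b c. True}"
        by (simp only: range_E2)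
      fix u assume "u \<in> {E2 (b \<odot> c) | b c. True}"
      then obtain b c where u: "u = E2 (b \<odot> c)" by blast
      have "ev u F = ev (E1 (w \<odot> p)) (\<lambda>x y. g (b * x) * k (c * y))"
        unfolding u F_def by (rule E1_E2_ev[OF g k, symmetric])
      also have "\<dots> = ev (E1 (w \<odot> p)) (\<lambda>w' p'. ev (E1 (w' \<odot> p')) (\<lambda>x y. g (b * x) * k (c * y)))"
        by (rule E1_idem_ev[symmetric])
      also have "\<dots> = ev (E1 (w \<odot> p)) (\<lambda>w' p'. ev (E2 (b \<odot> c)) (\<lambda>x y. g (x * w') * k (y * p')))"
        by (simp only: E1_E2_ev[OF g k, of _ _ b c])
      also have "\<dots> = ev u G"
        unfolding u G_def by (rule ev_swap) simp_all
      finally show "ev u F = ev u G" .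
    qed
    then have 1: "ev (T2 (s \<odot> z)) (\<lambda>x y. F x (h * y)) = ev (T2 (s \<odot> z)) (\<lambda>x y. G x (h * y))"
      by (simp add: ev_tact lin_smul_mult lin_id F G)
    have "ev (T1 (z \<odot> p)) (\<lambda>x y. g (s * (x * w)) * k (h * y)) = ev (T2 (s \<odot> z)) (\<lambda>x y. F x (h * y))"
      using T1_T2_ev[OF gw kh] by (simp add: F_def mult.assoc)
    also note 1
    also have "ev (T2 (s \<odot> z)) (\<lambda>x y. G x (h * y))
      = ev (E1 (w \<odot> p)) (\<lambda>w' p'. ev (T2 (s \<odot> z)) (\<lambda>x y. g (x * w') * k (h * y * p')))"
      unfolding G_def by (rule ev_swap) simp_all
    also have "\<dots> = ev (E1 (w \<odot> p)) (\<lambda>w' p'. ev (T1 (z \<odot> p')) (\<lambda>x y. g (s * (x * w')) * k (h * y)))"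
      using T1_T2_ev[OF gw kh] by (simp add: mult.assoc)
    finally show "ev (T1 (z \<odot> p)) (\<lambda>x y. g (s * (x * w)) * k (h * y))
      = ev (E1 (w \<odot> p)) (\<lambda>w' p'. ev (T1 (z \<odot> p')) (\<lambda>x y. g (s * (x * w')) * k (h * y)))" .
  qed (intro rep_intros)+
qed (intro rep_intros)+

text \<open>
  The case \<open>w \<otimes> a = \<Delta>(c)(b \<otimes> d)\<close> of the next lemma, which is the computation
  \<open>z\<^sub>1c\<^sub>1b \<epsilon>(z\<^sub>2c\<^sub>2d) = z\<^sub>1c\<^sub>1b \<epsilon>(z\<^sub>2c\<^sub>2) \<epsilon>(c\<^sub>3d) = zc\<^sub>1b \<epsilon>(c\<^sub>2d)\<close>.
\<close>

lemma counit_E1_right_aux: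
  assumes g: "lf g"
  shows "ev (T1 (c \<odot> d)) (\<lambda>x y. ev (T1 (z \<odot> y)) (\<lambda>u v. g (u * (x * b)) * counit v))
    = ev (T1 (c \<odot> d)) (\<lambda>x y. g (z * (x * b)) * counit y)"
proof (rule cancel_left[where
      \<Psi> = "\<lambda>g. ev (T1 (c \<odot> d)) (\<lambda>x y. ev (T1 (z \<odot> y)) (\<lambda>u v. g (u * (x * b)) * counit v))" and
      \<Phi> = "\<lambda>g. ev (T1 (c \<odot> d)) (\<lambda>x y. g (z * (x * b)) * counit y)", OF _ _ _ g])
  fix g s assume g: "lf g"
  have gb: "lf (\<lambda>x. g (x * w))" for w by (intro lf_comp[OF g] lf_intros)
  have cv: "lf (\<lambda>x. counit (v * x))" for v by (intro lf_comp[OF g] lf_intros)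
  have "ev (T1 (c \<odot> d)) (\<lambda>x y. ev (T1 (z \<odot> y)) (\<lambda>u v. g (s * (u * (x * b))) * counit v))
    = ev (T1 (c \<odot> d)) (\<lambda>x y. ev (T2 (s \<odot> z)) (\<lambda>u v. g (u * (x * b)) * counit (v * y)))"
    using T1_T2_ev[OF gb lin_counit] by (simp add: mult.assoc)
  also have "\<dots> = ev (T2 (s \<odot> z)) (\<lambda>u v. ev (T1 (c \<odot> d)) (\<lambda>x y. g (u * (x * b)) * counit (v * y)))"
    by (rule ev_swap) simp_all
  also have "\<dots> = ev (T2 (s \<odot> z)) (\<lambda>u v. ev (T2 (u \<odot> c)) (\<lambda>x y. g (x * b) * counit (v * (y * d))))"
    using T1_T2_ev[OF gb cv] by (simp add: mult.assoc)
  also have "\<dots> = ev (T2 (s \<odot> z)) (\<lambda>u v. ev (T2 (u \<odot> c)) (\<lambda>x y. ev (T1 (y \<odot> d))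
      (\<lambda>p q. g (x * b) * (counit (v * p) * counit q))))"
    by (simp add: counit_mult3_ev ev_mult_left)
  also have "\<dots> = ev (T2 (s \<odot> z)) (\<lambda>u v. ev (T1 (c \<odot> d)) (\<lambda>p q. ev (T2 (u \<odot> p))
      (\<lambda>x y. g (x * b) * (counit (v * y) * counit q))))"
    by (simp only: T2_T1_ev[OF tf_prod(2)[OF gb cv lin_counit]])
  also have "\<dots> = ev (T1 (c \<odot> d)) (\<lambda>p q. ev (T2 (s \<odot> z)) (\<lambda>u v. ev (T2 (u \<odot> p))
      (\<lambda>x y. g (x * b) * (counit (v * y) * counit q))))"
    by (rule ev_swap) simp_all
  also have "\<dots> = ev (T1 (c \<odot> d)) (\<lambda>p q. ev (T2 (s \<odot> (z * p))) (\<lambda>x y. g (x * b) * counit y) * counit q)"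
    unfolding T2_mult_ev[OF gb lin_counit] by (simp add: ev_mult_right mult.assoc[symmetric])
  also have "\<dots> = ev (T1 (c \<odot> d)) (\<lambda>p q. g (s * (z * (p * b))) * counit q)"
    unfolding counit_T2_ev[OF gb] by (simp add: mult.assoc)
  finally show "ev (T1 (c \<odot> d)) (\<lambda>x y. ev (T1 (z \<odot> y)) (\<lambda>u v. g (s * (u * (x * b))) * counit v))
    = ev (T1 (c \<odot> d)) (\<lambda>x y. g (s * (z * (x * b))) * counit y)" .
qed (intro rep_intros)+

text \<open>
  The identity \<open>z\<^sub>1w \<epsilon>(z\<^sub>2a) = z 1\<^sub>1w \<epsilon>(1\<^sub>2a)\<close>, the counterpart of \<open>counit_E1_ev\<close> for the other leg. By
  \<open>T1_E1_ev\<close> both sides depend only on \<open>E\<^sub>1(w \<otimes> a)\<close>, which is a linear combination of elements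
  \<open>\<Delta>(c)(b \<otimes> d)\<close>.
\<close>

lemma counit_E1_right_ev:
  assumes g: "lf g"
  shows "ev (T1 (z \<odot> a)) (\<lambda>p q. g (p * w) * counit q) = ev (E1 (w \<odot> a)) (\<lambda>p q. g (z * p) * counit q)"
proof -
  have gb: "lf (\<lambda>x. g (x * w))" for w by (intro lf_comp[OF g] lf_intros)
  have gz: "lf (\<lambda>x. g (z * x))" by (intro lf_comp[OF g] lf_intros)
  define M where "M w' p' = ev (T1 (z \<odot> p')) (\<lambda>x y. g (x * w') * counit y)" for w' p'
  have M: "bf M" unfolding M_def by (intro bfI lf_intros lf_comp[OF g])
  have N: "bf (\<lambda>p q. g (z * p) * counit q)" by (intro bfI lf_intros gz)
  have "ev (T1 (z \<odot> a)) (\<lambda>p q. g (p * w) * counit q) = ev (E1 (w \<odot> a)) M"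
    unfolding M_def by (rule T1_E1_ev[OF g lin_counit])
  also have "\<dots> = ev (E1 (w \<odot> a)) (\<lambda>p q. g (z * p) * counit q)"
  proof (rule ev_span_eq)
    interpret vector_space pointwise by (rule vector_space_pointwise)
    have "E1 (w \<odot> a) \<in> lspan A2 {E1 (b \<odot> c) | b c. True}"
      unfolding lspan_def smul_tens by (rule span_base) blast
    then show "E1 (w \<odot> a) \<in> lspan A2 {tact A A (\<lambda>x. x * b) id (T1 (a \<odot> c)) | a b c. True}"
      by (simp only: range_E1)
    fix u assume "u \<in> {tact A A (\<lambda>x. x * b) id (T1 (a \<odot> c)) | a b c. True}"
    then obtain b c d where u: "u = tact A A (\<lambda>x. x * b) id (T1 (c \<odot> d))" by blast
    show "ev u M = ev u (\<lambda>p q. g (z * p) * counit q)"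
      unfolding u using counit_E1_right_aux[OF g]
      by (simp add: ev_tact lin_smul_mult lin_id M N) (simp add: M_def)
  qed
  finally show ?thesis .
qed

text \<open>
  The identity \<open>(A \<otimes> \<Delta>)((t \<otimes> h)E) = (t \<otimes> \<Delta>(h))(E \<otimes> 1)\<close>, applied to \<open>w \<otimes> d \<otimes> a\<close> and freed from the factor
  on the left of the middle leg.
\<close>

lemma E1_pi_L_aux:
  assumes g: "lf g" and k: "lf k" and \<phi>: "lf \<phi>"
  shows "ev (E2 (t \<odot> h)) (\<lambda>t' h'. ev (T1 (h' \<odot> a)) (\<lambda>p q. g (t' * w) * (\<phi> (p * d) * k q)))
    = ev (E1 (w \<odot> d)) (\<lambda>w' d'. ev (T1 (h \<odot> a)) (\<lambda>p q. g (t * w') * (\<phi> (p * d') * k q)))"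
proof (rule cancel_left[where
      \<Psi> = "\<lambda>\<phi>. ev (E2 (t \<odot> h)) (\<lambda>t' h'. ev (T1 (h' \<odot> a)) (\<lambda>p q. g (t' * w) * (\<phi> (p * d) * k q)))" and
      \<Phi> = "\<lambda>\<phi>. ev (E1 (w \<odot> d)) (\<lambda>w' d'. ev (T1 (h \<odot> a)) (\<lambda>p q. g (t * w') * (\<phi> (p * d') * k q)))",
      OF _ _ _ \<phi>])
  fix \<phi> s assume \<phi>: "lf \<phi>"
  have gw: "lf (\<lambda>x. g (x * w))" for w by (intro lf_comp[OF g] lf_intros)
  have \<phi>d: "lf (\<lambda>x. \<phi> (x * d))" for d by (intro lf_comp[OF \<phi>] lf_intros)
  have ka: "lf (\<lambda>x. k (x * a))" by (intro lf_comp[OF k] lf_intros)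
  have T12: "ev (T1 (h \<odot> a)) (\<lambda>p q. \<phi> (s * (p * d)) * k q) = ev (T2 (s \<odot> h)) (\<lambda>p q. \<phi> (p * d) * k (q * a))" for h d
    using T1_T2_ev[OF \<phi>d k] by (simp add: mult.assoc)
  have "ev (E2 (t \<odot> h)) (\<lambda>t' h'. ev (T1 (h' \<odot> a)) (\<lambda>p q. g (t' * w) * (\<phi> (s * (p * d)) * k q)))
    = ev (E2 (t \<odot> h)) (\<lambda>t' h'. ev (T2 (s \<odot> h')) (\<lambda>p q. g (t' * w) * (\<phi> (p * d) * k (q * a))))"
    by (simp add: ev_mult_left T12)
  also have "\<dots> = ev (T2 (s \<odot> h)) (\<lambda>p q. ev (E2 (t \<odot> p)) (\<lambda>x y. g (x * w) * (\<phi> (y * d) * k (q * a))))"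
    by (rule E2_T2_ev[OF tf_prod(2)[OF gw \<phi>d ka], symmetric])
  also have "\<dots> = ev (T2 (s \<odot> h)) (\<lambda>p q. ev (E1 (w \<odot> d)) (\<lambda>x y. g (t * x) * (\<phi> (p * y) * k (q * a))))"
    using E1_E2_ev[OF g \<phi>] by (simp add: mult.assoc[symmetric] ev_mult_right)
  also have "\<dots> = ev (E1 (w \<odot> d)) (\<lambda>x y. ev (T2 (s \<odot> h)) (\<lambda>p q. g (t * x) * (\<phi> (p * y) * k (q * a))))"
    by (rule ev_swap) simp_all
  also have "\<dots> = ev (E1 (w \<odot> d)) (\<lambda>w' d'. ev (T1 (h \<odot> a)) (\<lambda>p q. g (t * w') * (\<phi> (s * (p * d')) * k q)))"
    by (simp add: ev_mult_left T12)
  finally show "ev (E2 (t \<odot> h)) (\<lambda>t' h'. ev (T1 (h' \<odot> a)) (\<lambda>p q. g (t' * w) * (\<phi> (s * (p * d)) * k q)))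
    = ev (E1 (w \<odot> d)) (\<lambda>w' d'. ev (T1 (h \<odot> a)) (\<lambda>p q. g (t * w') * (\<phi> (s * (p * d')) * k q)))" .
qed (intro rep_intros)+

text \<open>
  In Sweedler notation, \<open>1\<^sub>1w \<otimes> 1\<^sub>2\<pi>(d)a = 1\<^sub>1w \<otimes> \<pi>(1\<^sub>2d)a\<close>: apply the counit to the middle leg in the
  preceding identity.
\<close>

lemma E1_pi_L_ev:
  assumes g: "lf g" and k: "lf k"
  shows "ev (E1 (w \<odot> pi_L d a)) (\<lambda>p q. g p * k q) = ev (E1 (w \<odot> d)) (\<lambda>p q. g p * k (pi_L q a))"
proof (rule cancel_left[where \<Psi> = "\<lambda>g. ev (E1 (w \<odot> pi_L d a)) (\<lambda>p q. g p * k q)" and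
      \<Phi> = "\<lambda>g. ev (E1 (w \<odot> d)) (\<lambda>p q. g p * k (pi_L q a))", OF _ _ _ g])
  fix g t assume g: "lf g"
  show "ev (E1 (w \<odot> pi_L d a)) (\<lambda>p q. g (t * p) * k q) = ev (E1 (w \<odot> d)) (\<lambda>p q. g (t * p) * k (pi_L q a))"
  proof (rule cancel_left[where \<Psi> = "\<lambda>k. ev (E1 (w \<odot> pi_L d a)) (\<lambda>p q. g (t * p) * k q)" and
        \<Phi> = "\<lambda>k. ev (E1 (w \<odot> d)) (\<lambda>p q. g (t * p) * k (pi_L q a))", OF _ _ _ k])
    fix k h assume k: "lf k"
    have "ev (E1 (w \<odot> pi_L d a)) (\<lambda>p q. g (t * p) * k (h * q)) = ev (E2 (t \<odot> h)) (\<lambda>p q. g (p * w) * k (q * pi_L d a))"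
      by (rule E1_E2_ev[OF g k])
    also have "\<dots> = ev (E1 (w \<odot> d)) (\<lambda>p q. g (t * p) * k (h * pi_L q a))"
      using E1_pi_L_aux[OF g k lin_counit] by (simp add: mult_pi_L_ev[OF k] ev_mult_left)
    finally show "ev (E1 (w \<odot> pi_L d a)) (\<lambda>p q. g (t * p) * k (h * q))
      = ev (E1 (w \<odot> d)) (\<lambda>p q. g (t * p) * k (h * pi_L q a))" .
  qed (intro rep_intros)+
qed (intro rep_intros)+

text \<open>
  Without a unit in \<open>A\<close>, the value \<open>\<epsilon>(za)\<close> is reached from the values \<open>\<epsilon>(\<pi>(b)a)\<close> by inserting the
  counit of an auxiliary element \<open>x\<close>, which is cancelled afterwards.
\<close>

theorem counit_left_zero:
  assumes a: "\<And>b. counit (pi_L b a) = 0"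
  shows "counit (z * a) = 0"
proof -
  have E0: "ev (E1 (w \<odot> pi_L d a)) (\<lambda>p q. g p * counit q) = 0" if "lf g" for g w d
    using ev_mult_left[of "E1 (w \<odot> d)" 0] by (simp add: E1_pi_L_ev[OF that lin_counit] a)
  have T0: "ev (T1 (z \<odot> pi_L d a)) (\<lambda>p q. g (p * w) * counit q) = 0" if "lf g" for g w d
    unfolding counit_E1_right_ev[OF that] by (rule E0) (intro lf_comp[OF that] lf_intros)
  \<comment> \<open>\<open>z\<^sub>1xw \<epsilon>(z\<^sub>2a) = z\<^sub>1x\<^sub>1w \<epsilon>(z\<^sub>2x\<^sub>2) \<epsilon>(z\<^sub>3a) = z\<^sub>1x\<^sub>1w \<epsilon>(z\<^sub>2\<pi>(x\<^sub>2)a) = 0\<close>, multiplied by \<open>s\<close> from the left; \<open>\<Delta>(x)(w \<otimes> 1)\<close> is \<open>T\<^sub>4(w \<otimes> x)\<close>.\<close>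
  have key: "ev (T1 (z \<odot> a)) (\<lambda>p q. g (s * (p * (x * w))) * counit q) = 0" if g: "lf g" for g s x w
  proof -
    have gw: "lf (\<lambda>x. g (x * w))" for w by (intro lf_comp[OF g] lf_intros)
    have gs: "lf (\<lambda>x. g (s * x))" for s by (intro lf_comp[OF g] lf_intros)
    have cv: "lf (\<lambda>x. counit (v * x))" for v by (intro lf_comp[OF g] lf_intros)
    define f where "f u v q = ev (T4 (w \<odot> x)) (\<lambda>c d. g (u * c) * counit (v * d)) * counit q" for u v q
    have f: "tf f" unfolding trilin_def f_def by (auto intro!: lf_intros gw)
    have "ev (T2 (s \<odot> p)) (\<lambda>u v. f u v q) = g (s * (p * (x * w))) * counit q" for p q
    proof -
      have "ev (T2 (s \<odot> p)) (\<lambda>u v. f u v q)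
        = ev (T2 (s \<odot> p)) (\<lambda>u v. ev (T2 (u \<odot> x)) (\<lambda>c d. g (c * w) * counit (v * d))) * counit q"
        unfolding f_def by (simp add: ev_mult_right T2_T4_ev[OF g cv])
      also have "\<dots> = g (s * (p * x) * w) * counit q"
        unfolding T2_mult_ev[OF gw lin_counit, symmetric] by (simp add: counit_T2_ev[OF gw])
      finally show ?thesis by (simp add: mult.assoc)
    qed
    then have "ev (T1 (z \<odot> a)) (\<lambda>p q. g (s * (p * (x * w))) * counit q)
      = ev (T1 (z \<odot> a)) (\<lambda>p q. ev (T2 (s \<odot> p)) (\<lambda>u v. f u v q))" by simp
    also have "\<dots> = ev (T2 (s \<odot> z)) (\<lambda>u y. ev (T1 (y \<odot> a)) (\<lambda>p q. f u p q))"
      by (rule T2_T1_ev[OF f])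
    also have "\<dots> = ev (T2 (s \<odot> z)) (\<lambda>u y. ev (T4 (w \<odot> x)) (\<lambda>c d. ev (T1 (y \<odot> a)) (\<lambda>p q.
        g (u * c) * counit (p * d) * counit q)))"
      unfolding f_def using ev_swap[of "T1 (_ \<odot> _)" "T4 (_ \<odot> _)"] by (simp add: ev_mult_right[symmetric])
    also have "\<dots> = ev (T2 (s \<odot> z)) (\<lambda>u y. ev (T4 (w \<odot> x)) (\<lambda>c d. g (u * c) * counit (y * pi_L d a)))"
      by (simp add: mult_pi_L_ev[OF lin_counit] ev_mult_left mult.assoc)
    also have "\<dots> = ev (T4 (w \<odot> x)) (\<lambda>c d. ev (T2 (s \<odot> z)) (\<lambda>u y. g (u * c) * counit (y * pi_L d a)))"
      by (rule ev_swap) simp_all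
    also have "\<dots> = ev (T4 (w \<odot> x)) (\<lambda>c d. ev (T1 (z \<odot> pi_L d a)) (\<lambda>p q. g (s * (p * c)) * counit q))"
      using T1_T2_ev[OF gw lin_counit] by (simp add: mult.assoc)
    also have "\<dots> = 0"
      using ev_mult_left[of "T4 (w \<odot> x)" 0] by (simp add: T0[OF gs])
    finally show ?thesis .
  qed
  let ?\<Psi> = "\<lambda>k. ev (T1 (z \<odot> a)) (\<lambda>p q. k p * counit q)"
  have "?\<Psi> counit = 0"
  proof (rule cancel_left[where \<Psi> = ?\<Psi> and \<Phi> = "\<lambda>_. 0", OF _ _ _ lin_counit])
    fix g s assume g: "lf g"
    show "ev (T1 (z \<odot> a)) (\<lambda>p q. g (s * p) * counit q) = 0"
    proof (rule cancel_right[where \<Psi> = "\<lambda>g. ev (T1 (z \<odot> a)) (\<lambda>p q. g (s * p) * counit q)" and \<Phi> = "\<lambda>_. 0", OF _ _ _ g])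
      fix g w assume g: "lf g"
      show "ev (T1 (z \<odot> a)) (\<lambda>p q. g (s * p * w) * counit q) = 0"
      proof (rule cancel_right[where \<Psi> = "\<lambda>g. ev (T1 (z \<odot> a)) (\<lambda>p q. g (s * p * w) * counit q)" and \<Phi> = "\<lambda>_. 0", OF _ _ _ g])
      qed (insert key, (intro rep_intros represented_zero | simp add: mult.assoc)+)
    qed (intro rep_intros represented_zero)+
  qed (intro rep_intros represented_zero)+
  then show ?thesis by (simp add: counit_T1_ev[OF lin_counit])
qed

text \<open>
  As \<open>E\<^sub>1\<close> acts as left multiplication by a multiplier, it commutes with right multiplications.
\<close>

lemma E1_right_ev:
  assumes f: "lf f" and g: "lf g"
  shows "ev (E1 (b \<odot> (y * r))) (\<lambda>p q. f p * g q) = ev (E1 (b \<odot> y)) (\<lambda>p q. f p * g (q * r))"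
proof (rule cancel_left[where \<Psi> = "\<lambda>f. ev (E1 (b \<odot> (y * r))) (\<lambda>p q. f p * g q)" and
      \<Phi> = "\<lambda>f. ev (E1 (b \<odot> y)) (\<lambda>p q. f p * g (q * r))", OF _ _ _ f])
  fix f t assume f: "lf f"
  show "ev (E1 (b \<odot> (y * r))) (\<lambda>p q. f (t * p) * g q) = ev (E1 (b \<odot> y)) (\<lambda>p q. f (t * p) * g (q * r))"
  proof (rule cancel_left[where \<Psi> = "\<lambda>g. ev (E1 (b \<odot> (y * r))) (\<lambda>p q. f (t * p) * g q)" and
        \<Phi> = "\<lambda>g. ev (E1 (b \<odot> y)) (\<lambda>p q. f (t * p) * g (q * r))", OF _ _ _ g])
    fix g h assume g: "lf g"
    have "lf (\<lambda>x. g (x * r))" by (intro lf_comp[OF g] lf_intros)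
    from E1_E2_ev[OF f this, of b y t h]
    show "ev (E1 (b \<odot> (y * r))) (\<lambda>p q. f (t * p) * g (h * q))
      = ev (E1 (b \<odot> y)) (\<lambda>p q. f (t * p) * g (h * (q * r)))"
      by (simp add: E1_E2_ev[OF f g] mult.assoc)
  qed (intro rep_intros)+
qed (intro rep_intros)+

end

section \<open>Matrix coefficients of a coaction\<close>

text \<open>
  Right comodules have two coactions \<open>\<lambda>\<close> and \<open>\<varrho>\<close>, and so do their duals. What depends on one of them only
  is developed for an arbitrary endomorphism of \<open>V \<otimes> A\<close> and used for both.
\<close>

locale coaction = regular_weak_multiplier_bialgebra A E1 E2 T1 T2 T3 T4 counit
  for A :: "('k::field, 'a::ring) vspace" and E1 E2 T1 T2 T3 T4 counit +
  fixes V :: "('k, 'v::ab_group_add) vspace" and U :: "'v set"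
    and lam :: "('k, 'v, 'a) tensor \<Rightarrow> ('k, 'v, 'a) tensor"
  assumes V: "is_vspace V" and U: "finite U" "is_basis V U"
    and lin_lam: "lin (V \<otimes> A) (V \<otimes> A) lam"
begin

text \<open>
  The matrix coefficient \<open>(\<phi> \<otimes> A)\<lambda>(v \<otimes> a)\<close>. The row index is a functional and the column index a vector,
  not basis elements, so that relations between rows or columns are statements about
  \<open>entry\<close> with a linear combination as index.
\<close>

definition entry :: "('v \<Rightarrow> 'k) \<Rightarrow> 'v \<Rightarrow> 'a \<Rightarrow> 'a" where
  "entry \<phi> v a = slice_left V A \<phi> (lam (pure V A v a))"

abbreviation row :: "'v \<Rightarrow> 'v \<Rightarrow> 'k" where "row \<equiv> dcoord V U"

lemmas lin_row = lin_dcoord[OF V U]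
lemmas basis_in = basis_carrier[OF V U]

lemma lam_carrier: "v \<in> carrier V \<Longrightarrow> lam (pure V A v a) \<in> carrier (V \<otimes> A)"
  using lin_lam pure_in_tens[of v V a A] by (simp add: lin_def)

lemma entry_eval:
  assumes "lin V ground \<phi>" "v \<in> carrier V" "lf g"
  shows "g (entry \<phi> v a) = lam (pure V A v a) (\<lambda>v x. \<phi> v * g x)"
  unfolding entry_def
  by (rule slice_left_eval[OF V is_vspace_A assms(1) lam_carrier[OF assms(2)] assms(3)])

lemma lin_entry: "lin V ground \<phi> \<Longrightarrow> v \<in> carrier V \<Longrightarrow> lin A A (entry \<phi> v)"
  unfolding entry_def
  by (rule lin_compose[OF lin_compose[OF lin_pure(2)[OF V is_vspace_A] lin_lam] lin_slice_left[OF V is_vspace_A]])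

lemma lin_entry_vector: "lin V ground \<phi> \<Longrightarrow> lin V A (\<lambda>v. entry \<phi> v a)"
  unfolding entry_def
  by (rule lin_compose[OF lin_compose[OF lin_pure(1)[OF V is_vspace_A] lin_lam] lin_slice_left[OF V is_vspace_A]])
    simp_all

lemma entry_sum:
  assumes \<phi>: "lin V ground \<phi>" and v: "v \<in> carrier V" and g: "lf g"
  shows "g (entry \<phi> v a) = (\<Sum>i\<in>U. row i v * g (entry \<phi> i a))"
  using lin_dcoord_expand[OF V U is_vspace_ground lin_compose[OF lin_entry_vector[OF \<phi>] g] v]
  by (simp add: ground_def)

lemma lam_expand:
  assumes "v \<in> carrier V" "bilin V A ground \<beta>"
  shows "lam (pure V A v a) \<beta> = (\<Sum>i\<in>U. \<beta> i (entry (row i) v a))"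
  unfolding entry_def by (rule tens_basis_expand[OF V U is_vspace_A lam_carrier[OF assms(1)] assms(2)])

lemma trilin_VA:
  assumes "lin V ground \<phi>" "bf \<beta>"
  shows "trilin V A A (\<lambda>v p q. \<phi> v * \<beta> p q)"
  using assms by (auto simp: trilin_def bilin_ground_iff lin_ground_iff algebra_simps)

lemma bf_entries:
  assumes "bf \<beta>" "lin V ground \<phi>" "lin V ground \<psi>" "u \<in> carrier V" "v \<in> carrier V"
  shows "bf (\<lambda>p q. \<beta> (entry \<phi> u p) (entry \<psi> v q))"
proof (rule bfI)
  fix p show "lf (\<lambda>q. \<beta> (entry \<phi> u p) (entry \<psi> v q))"
    using assms(1) by (intro lf_comp[OF _ lin_entry[OF assms(3,5)]]) (simp add: bilin_def)
next
  fix q show "lf (\<lambda>p. \<beta> (entry \<phi> u p) (entry \<psi> v q))"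
    using assms(1) lf_comp[of "\<lambda>x. \<beta> x (entry \<psi> v q)", OF _ lin_entry[OF assms(2,4)]] by (simp add: bilin_def)
qed

text \<open>
  Applying the coaction twice amounts to multiplying matrices: \<open>(\<lambda> \<otimes> A)\<lambda>\<^sup>1\<^sup>3\<close> has the
  coefficients \<open>\<Sum>\<^sub>i L\<^sub>k\<^sub>i \<otimes> L\<^sub>i\<^sub>j\<close>.
\<close>

lemma two_coactions:
  assumes \<phi>: "lin V ground \<phi>" and \<beta>: "bf \<beta>" and v: "v \<in> carrier V" and G: "lin A2 A2 G"
  shows "eval3 (leg12 V A A lam (leg13 V A A lam (leg23 V A A G (pure (V \<otimes> A) A (pure V A v a) b))))
      (\<lambda>v p q. \<phi> v * \<beta> p q)
    = (\<Sum>i\<in>U. ev (G (a \<odot> b)) (\<lambda>p q. \<beta> (entry \<phi> i p) (entry (row i) v q)))"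
    (is "eval3 (leg12 V A A lam (leg13 V A A lam (leg23 V A A G ?s))) ?F = _")
    and "eval3 (leg12 V A A lam (leg13 V A A lam (pure (V \<otimes> A) A (pure V A v a) b))) (\<lambda>v p q. \<phi> v * \<beta> p q)
    = (\<Sum>i\<in>U. \<beta> (entry \<phi> i a) (entry (row i) v b))"
proof -
  have F: "trilin V A A ?F" by (rule trilin_VA[OF \<phi> \<beta>])
  note VAA = V is_vspace_A is_vspace_A
  let ?F1 = "\<lambda>v p q. lam (pure V A v p) (\<lambda>v' p'. ?F v' p' q)"
  let ?F2 = "\<lambda>v p q. lam (pure V A v q) (\<lambda>v' q'. ?F1 v' p q')"
  have F1: "trilin V A A ?F1" by (rule trilin_leg12[OF VAA lin_lam F])
  have F2: "trilin V A A ?F2" by (rule trilin_leg13[OF VAA lin_lam F1])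
  have s: "?s \<in> carrier (V \<otimes> A \<otimes> A)" using v by (simp add: pure_in_tens)
  have c1: "leg13 V A A lam t \<in> carrier (V \<otimes> A \<otimes> A)" if "t \<in> carrier (V \<otimes> A \<otimes> A)" for t
    using lin_leg13[OF VAA lin_lam] that by (simp add: lin_def)
  have c2: "leg23 V A A G ?s \<in> carrier (V \<otimes> A \<otimes> A)"
    using lin_leg23[OF VAA G] s by (simp add: lin_def)
  have eq: "?F2 v p q = (\<Sum>i\<in>U. \<beta> (entry \<phi> i p) (entry (row i) v q))" for p q
  proof -
    have "?F2 v p q = (\<Sum>i\<in>U. ?F1 i p (entry (row i) v q))"
      by (rule lam_expand[OF v trilinD(3)[OF F1]]) simp
    moreover have "?F1 i p r = \<beta> (entry \<phi> i p) r" if "i \<in> U" for i r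
      using \<beta> by (intro entry_eval[OF \<phi> basis_in[OF that], symmetric]) (simp add: bilin_def)
    ultimately show ?thesis by simp
  qed
  have bi: "bf (\<lambda>p q. \<beta> (entry \<phi> i p) (entry (row i) v q))" if "i \<in> U" for i
    by (rule bf_entries[OF \<beta> \<phi> lin_row basis_in[OF that] v])
  have "eval3 (leg12 V A A lam (leg13 V A A lam (leg23 V A A G ?s))) ?F = eval3 (leg23 V A A G ?s) ?F2"
    by (simp only: eval3_leg12[OF VAA lin_lam F c1[OF c2]] eval3_leg13[OF VAA lin_lam F1 c2])
  also have "\<dots> = G (a \<odot> b) (?F2 v)"
    unfolding eval3_leg23[OF VAA G F2 s]
    by (rule eval3_pure[OF trilin_leg23[OF VAA G F2] is_vspace_A]) simp
  also have "\<dots> = (\<Sum>i\<in>U. G (a \<odot> b) (\<lambda>p q. \<beta> (entry \<phi> i p) (entry (row i) v q)))"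
    unfolding eq by (rule tens_eval_sum(2)[OF lin_carrier[OF G pure_carrier] bi])
  finally show "eval3 (leg12 V A A lam (leg13 V A A lam (leg23 V A A G ?s))) ?F
    = (\<Sum>i\<in>U. ev (G (a \<odot> b)) (\<lambda>p q. \<beta> (entry \<phi> i p) (entry (row i) v q)))"
    by (simp add: ev_bilin bi)
  have "eval3 (leg12 V A A lam (leg13 V A A lam ?s)) ?F = eval3 ?s ?F2"
    by (simp only: eval3_leg12[OF VAA lin_lam F c1[OF s]] eval3_leg13[OF VAA lin_lam F1 s])
  also have "\<dots> = ?F2 v a b"
    by (rule eval3_pure[OF F2 is_vspace_A]) simp
  finally show "eval3 (leg12 V A A lam (leg13 V A A lam ?s)) ?F = (\<Sum>i\<in>U. \<beta> (entry \<phi> i a) (entry (row i) v b))"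
    by (simp add: eq)
qed

lemma coaction_then_G:
  assumes \<phi>: "lin V ground \<phi>" and \<beta>: "bf \<beta>" and v: "v \<in> carrier V" and G: "lin A2 A2 G"
  shows "eval3 (leg23 V A A G (leg12 V A A lam (pure (V \<otimes> A) A (pure V A v a) b))) (\<lambda>v p q. \<phi> v * \<beta> p q)
    = ev (G (entry \<phi> v a \<odot> b)) \<beta>"
    (is "eval3 (leg23 V A A G (leg12 V A A lam ?s)) ?F = _")
proof -
  have F: "trilin V A A ?F" by (rule trilin_VA[OF \<phi> \<beta>])
  note VAA = V is_vspace_A is_vspace_A
  have s: "?s \<in> carrier (V \<otimes> A \<otimes> A)" using v by (simp add: pure_in_tens)
  have c: "leg12 V A A lam ?s \<in> carrier (V \<otimes> A \<otimes> A)"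
    using lin_leg12[OF VAA lin_lam] s by (simp add: lin_def)
  let ?F1 = "\<lambda>v p q. G (p \<odot> q) (\<lambda>p' q'. ?F v p' q')"
  have F1: "trilin V A A ?F1" by (rule trilin_leg23[OF VAA G F])
  have "eval3 (leg23 V A A G (leg12 V A A lam ?s)) ?F = eval3 ?s (\<lambda>v p q. lam (pure V A v p) (\<lambda>v' p'. ?F1 v' p' q))"
    by (simp only: eval3_leg23[OF VAA G F c] eval3_leg12[OF VAA lin_lam F1 s])
  also have "\<dots> = lam (pure V A v a) (\<lambda>v' p'. ?F1 v' p' b)"
    by (rule eval3_pure[OF trilin_leg12[OF VAA lin_lam F1] is_vspace_A]) simp
  also have "(\<lambda>v' p'. ?F1 v' p' b) = (\<lambda>v' p'. \<phi> v' * ev (G (p' \<odot> b)) \<beta>)"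
    by (simp add: tens_eval_scale[OF lin_carrier[OF G pure_carrier] \<beta>] ev_bilin[OF \<beta>])
  also have "lam (pure V A v a) \<dots> = ev (G (entry \<phi> v a \<odot> b)) \<beta>"
    using entry_eval[OF \<phi> v lf_ev_pure(1)[OF G]] by simp
  finally show ?thesis .
qed

section \<open>The coaction on the dual space\<close>

lemma lin_entry_functional:
  assumes v: "v \<in> carrier V"
  shows "lin (dual V) A (\<lambda>\<phi>. entry \<phi> v a)"
proof -
  have d: "lin V ground \<phi>" if "\<phi> \<in> carrier (dual V)" for \<phi> using that by (simp add: dual_def)
  have b: "bilin V A ground (\<lambda>v x. \<phi> v * g x)" if "\<phi> \<in> carrier (dual V)" "lf g" for \<phi> g
    by (rule bilin_prod[OF d[OF that(1)] that(2)])
  note DV = is_vspace_dual[OF V]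
  show ?thesis
    unfolding lin_def
  proof (intro conjI ballI allI)
    fix \<phi> \<psi> assume p: "\<phi> \<in> carrier (dual V)" "\<psi> \<in> carrier (dual V)"
    show "entry (\<phi> + \<psi>) v a = entry \<phi> v a + entry \<psi> v a"
    proof (rule functional_eqD)
      fix g assume g: "lf g"
      have "g (entry (\<phi> + \<psi>) v a) = lam (pure V A v a) (\<lambda>v x. \<phi> v * g x + \<psi> v * g x)"
        using entry_eval[OF d[OF add_in_carrier[OF DV p]] v g] by (simp add: distrib_right)
      then show "g (entry (\<phi> + \<psi>) v a) = g (entry \<phi> v a + entry \<psi> v a)"
        using g by (simp add: tens_eval_add[OF lam_carrier[OF v] b[OF p(1) g] b[OF p(2) g]]
            entry_eval[OF d[OF p(1)] v g] entry_eval[OF d[OF p(2)] v g] lf_iff)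
    qed
  next
    fix c \<phi> assume p: "\<phi> \<in> carrier (dual V)"
    show "entry (smul (dual V) c \<phi>) v a = smul A c (entry \<phi> v a)"
    proof (rule functional_eqD)
      fix g assume g: "lf g"
      have "g (entry (smul (dual V) c \<phi>) v a) = lam (pure V A v a) (\<lambda>v x. c * (\<phi> v * g x))"
        using entry_eval[OF d[OF smul_in_carrier[OF DV p]] v g, of c] by (simp add: pointwise_def mult.assoc)
      then show "g (entry (smul (dual V) c \<phi>) v a) = g (smul A c (entry \<phi> v a))"
        using g by (simp add: tens_eval_scale[OF lam_carrier[OF v] b[OF p g]] entry_eval[OF d[OF p] v g] lf_iff)
    qed
  qed simp
qed

text \<open>
  The value of the dual coaction at \<open>b \<otimes> \<phi>\<close>, written in the dual basis of \<open>V\<close> instead of a basis of \<open>A\<close>.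
\<close>

abbreviation dual_value :: "'a \<Rightarrow> ('v \<Rightarrow> 'k) \<Rightarrow> ('k, 'a, 'v \<Rightarrow> 'k) tensor" where
  "dual_value b \<phi> \<equiv> \<Sum>j\<in>U. pure A (dual V) (entry \<phi> j b) (row j)"

lemmas row_dual = dcoord_dual[OF V U]

lemma bilin_dual_value: "bilin A (dual V) (A \<otimes> dual V) dual_value"
  unfolding bilin_def
proof (intro conjI ballI)
  fix b
  show "lin (dual V) (A \<otimes> dual V) (dual_value b)"
    by (intro lin_sum_maps is_vspace_tens lin_compose[OF lin_entry_functional
          lin_pure(1)[OF is_vspace_A is_vspace_dual[OF V] row_dual]] basis_in)
next
  fix \<phi> assume "\<phi> \<in> carrier (dual V)"
  then have "lin V ground \<phi>" by (simp add: dual_def)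
  then show "lin A (A \<otimes> dual V) (\<lambda>b. dual_value b \<phi>)"
    by (intro lin_sum_maps is_vspace_tens lin_compose[OF lin_entry
          lin_pure(1)[OF is_vspace_A is_vspace_dual[OF V] row_dual]] basis_in)
qed

text \<open>
  Both sides are the element of \<open>A \<otimes> V\<^sup>* \<cong> Hom(V, A)\<close> corresponding to \<open>v \<mapsto> (\<phi> \<otimes> A)\<lambda>(v \<otimes> b)\<close>, expanded in a
  basis of \<open>A\<close> and in a basis of \<open>V\<close>, respectively. A summand for \<open>i\<close> can only be non-zero if \<open>i\<close> occurs in one of the
  finitely many elements \<open>(\<phi> \<otimes> A)\<lambda>(j \<otimes> b)\<close>, \<open>j \<in> U\<close>.
\<close>

lemma dual_summand_sum:
  assumes B: "is_basis A B" and \<phi>: "\<phi> \<in> carrier (dual V)"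
  shows "(\<Sum>i | i \<in> B \<and> dual_summand A B V lam b \<phi> i \<noteq> 0. dual_summand A B V lam b \<phi> i) = dual_value b \<phi>"
    (is "?S = _")
proof (rule tens_eqI)
  interpret VA: vector_space "smul A" by (rule vspace)
  have Bi: "VA.independent B" "\<And>x. x \<in> VA.span B"
    using B by (simp_all add: is_basis_def lspan_def carrier_UNIV)
  note DV = is_vspace_dual[OF V]
  have \<phi>l: "lin V ground \<phi>" using \<phi> by (simp add: dual_def)
  have cl: "lf (coord A B i)" for i
    by (simp add: lf_iff coord_def VA.representation_add[OF Bi(1) Bi(2) Bi(2)] VA.representation_scale[OF Bi])
  define \<psi> where "\<psi> i = (\<Sum>j\<in>U. pointwise (coord A B i (entry \<phi> j b)) (row j))" for i
  have \<psi>: "dual_summand A B V lam b \<phi> i = pure A (dual V) i (\<psi> i)" for i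
  proof -
    have "(if v \<in> carrier V then slice_both V A \<phi> (coord A B i) (lam (pure V A v b)) else 0) = \<psi> i v" for v
    proof (cases "v \<in> carrier V")
      case True
      have "slice_both V A \<phi> (coord A B i) (lam (pure V A v b)) = coord A B i (entry \<phi> v b)"
        by (simp add: slice_both_eval[OF V is_vspace_A \<phi>l cl lam_carrier[OF True]] entry_eval[OF \<phi>l True cl])
      then show ?thesis
        using True entry_sum[OF \<phi>l True cl]
        by (simp add: \<psi>_def sum_fun_apply pointwise_def mult.commute)
    next
      case False
      then show ?thesis by (simp add: \<psi>_def sum_fun_apply pointwise_def dcoord_def)
    qed
    then show ?thesis by (simp add: dual_summand_def)
  qed
  have sm: "pointwise c (row j) \<in> carrier (dual V)" for c j
    using smul_in_carrier[OF DV row_dual, of c j] by simp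
  have \<psi>c: "\<psi> i \<in> carrier (dual V)" for i
    unfolding \<psi>_def by (intro sum_in_carrier[OF DV] sm)
  show "?S \<in> carrier (A \<otimes> dual V)"
    unfolding \<psi> by (intro sum_in_carrier[OF is_vspace_tens] pure_in_tens \<psi>c) simp
  show "dual_value b \<phi> \<in> carrier (A \<otimes> dual V)"
    by (intro sum_in_carrier[OF is_vspace_tens] pure_in_tens row_dual) simp
  fix \<beta> assume \<beta>: "bilin A (dual V) ground \<beta>"
  have pb: "pure A (dual V) x \<chi> \<beta> = \<beta> x \<chi>" for x \<chi> by (simp add: pure_def \<beta>)
  have \<beta>2: "lin (dual V) ground (\<beta> x)" for x using \<beta> by (simp add: bilin_def)
  have \<beta>1: "lf (\<lambda>x. \<beta> x (row j))" for j using \<beta> row_dual by (simp add: bilin_def)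
  have val: "dual_summand A B V lam b \<phi> i \<beta> = (\<Sum>j\<in>U. coord A B i (entry \<phi> j b) * \<beta> i (row j))" for i
  proof -
    have "\<beta> i (\<psi> i) = (\<Sum>j\<in>U. \<beta> i (pointwise (coord A B i (entry \<phi> j b)) (row j)))"
      unfolding \<psi>_def by (rule lin_sum[OF DV is_vspace_ground \<beta>2 sm])
    then show ?thesis
      using \<beta>2[of i] row_dual by (simp add: \<psi> pb lin_ground_iff)
  qed
  let ?K = "\<Union>j\<in>U. {i. coord A B i (entry \<phi> j b) \<noteq> 0}"
  have K: "finite ?K" using U(1) by (simp add: coord_def VA.finite_representation)
  have sub: "{i \<in> B. dual_summand A B V lam b \<phi> i \<noteq> 0} \<subseteq> ?K"
  proof
    fix i assume i: "i \<in> {i \<in> B. dual_summand A B V lam b \<phi> i \<noteq> 0}"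
    show "i \<in> ?K"
    proof (rule ccontr)
      assume "i \<notin> ?K"
      then have "\<psi> i = 0" by (intro ext) (simp add: \<psi>_def pointwise_def sum_fun_apply)
      then have "dual_summand A B V lam b \<phi> i = 0"
        using lin_zero[OF DV is_vspace_tens lin_pure(2)[OF is_vspace_A DV, of i]] by (simp add: \<psi>)
      then show False using i by simp
    qed
  qed
  have KB: "i \<in> B" if "i \<in> ?K" for i using that VA.representation_ne_zero by (auto simp: coord_def)
  have "?S \<beta> = (\<Sum>i | i \<in> B \<and> dual_summand A B V lam b \<phi> i \<noteq> 0. dual_summand A B V lam b \<phi> i \<beta>)"
    by (rule sum_fun_apply)
  also have "\<dots> = (\<Sum>i\<in>?K. dual_summand A B V lam b \<phi> i \<beta>)"
    by (rule sum.mono_neutral_left[OF K sub]) (use KB in auto)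
  also have "\<dots> = (\<Sum>j\<in>U. \<Sum>i\<in>?K. coord A B i (entry \<phi> j b) * \<beta> i (row j))"
    unfolding val by (rule sum.swap)
  also have "\<dots> = (\<Sum>j\<in>U. \<beta> (entry \<phi> j b) (row j))"
  proof (rule sum.cong[OF refl])
    fix j assume j: "j \<in> U"
    let ?x = "entry \<phi> j b"
    have "\<beta> ?x (row j) = \<beta> (\<Sum>i | coord A B i ?x \<noteq> 0. smul A (coord A B i ?x) i) (row j)"
      using VA.sum_nonzero_representation_eq[OF Bi] by (simp add: coord_def)
    also have "\<dots> = (\<Sum>i | coord A B i ?x \<noteq> 0. coord A B i ?x * \<beta> i (row j))"
      using \<beta>1[of j] by (simp add: lin_sum[OF is_vspace_A is_vspace_ground \<beta>1] lf_iff)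
    also have "\<dots> = (\<Sum>i\<in>?K. coord A B i ?x * \<beta> i (row j))"
      by (rule sum.mono_neutral_left[OF K]) (use j in auto)
    finally show "(\<Sum>i\<in>?K. coord A B i ?x * \<beta> i (row j)) = \<beta> ?x (row j)" by simp
  qed
  also have "\<dots> = dual_value b \<phi> \<beta>" by (simp add: sum_fun_apply pb)
  finally show "?S \<beta> = dual_value b \<phi> \<beta>" .
qed

context
  fixes B assumes B: "is_basis A B"
begin

abbreviation lam_dual where "lam_dual \<equiv> dual_coaction A B V lam"

lemma bilin_dual_summands:
  "bilin A (dual V) (A \<otimes> dual V)
    (\<lambda>b \<phi>. \<Sum>i | i \<in> B \<and> dual_summand A B V lam b \<phi> i \<noteq> 0. dual_summand A B V lam b \<phi> i)"
  using bilin_dual_value by (simp add: bilin_def lin_def dual_summand_sum[OF B] add_in_carrier[OF is_vspace_dual[OF V]]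
      smul_in_carrier[OF is_vspace_dual[OF V], simplified])

lemma lin_lam_dual: "lin (A \<otimes> dual V) (A \<otimes> dual V) lam_dual"
  unfolding dual_coaction_def by (rule lin_tlift[OF is_vspace_tens bilin_dual_summands])

lemma lam_dual_pure: "\<phi> \<in> carrier (dual V) \<Longrightarrow> lam_dual (pure A (dual V) b \<phi>) = dual_value b \<phi>"
  unfolding dual_coaction_def
  by (subst tlift_pure[OF is_vspace_tens bilin_dual_summands]) (simp_all add: dual_summand_sum[OF B])

lemma lam_dual_eval:
  assumes "\<phi> \<in> carrier (dual V)" "bilin A (dual V) ground \<beta>"
  shows "lam_dual (pure A (dual V) b \<phi>) \<beta> = (\<Sum>j\<in>U. \<beta> (entry \<phi> j b) (row j))"
  unfolding lam_dual_pure[OF assms(1)] by (simp add: sum_fun_apply pure_def assms(2))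

text \<open>
  The composites that occur in the axioms of a left comodule. The order of the two coactions is
  opposite to that in \<open>two_coactions\<close>, and so is the order of the matrices because of the
  transposition; the same products of coefficients arise.
\<close>

lemma eval3_lam_dual:
  assumes f: "trilin A A (dual V) f" and \<phi>: "\<phi> \<in> carrier (dual V)" and G: "lin A2 A2 G"
  shows "eval3 (leg23 A A (dual V) lam_dual (leg13 A A (dual V) lam_dual (leg12 A A (dual V) G
      (pure A2 (dual V) (a \<odot> b) \<phi>)))) f
    = (\<Sum>j\<in>U. \<Sum>i\<in>U. ev (G (a \<odot> b)) (\<lambda>p q. f (entry \<phi> i p) (entry (row i) j q) (row j)))"
      (is "eval3 (leg23 _ _ _ _ (leg13 _ _ _ _ (leg12 _ _ _ _ ?s))) f = _")
    and "eval3 (leg23 A A (dual V) lam_dual (leg13 A A (dual V) lam_dual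
      (pure A2 (dual V) (a \<odot> b) \<phi>))) f
    = (\<Sum>j\<in>U. \<Sum>i\<in>U. f (entry \<phi> i a) (entry (row i) j b) (row j))"
    and "eval3 (leg12 A A (dual V) G (leg13 A A (dual V) lam_dual (pure A2 (dual V) (a \<odot> b) \<phi>))) f
    = (\<Sum>j\<in>U. ev (G (entry \<phi> j a \<odot> b)) (\<lambda>p q. f p q (row j)))"
proof -
  note DV = is_vspace_dual[OF V]
  note AAD = is_vspace_A is_vspace_A DV
  have \<phi>l: "lin V ground \<phi>" using \<phi> by (simp add: dual_def)
  have s: "?s \<in> carrier (A2 \<otimes> dual V)" using \<phi> by (simp add: pure_in_tens)
  let ?F1 = "\<lambda>x y \<phi>. lam_dual (pure A (dual V) y \<phi>) (\<lambda>y' \<phi>'. f x y' \<phi>')"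
  let ?F2 = "\<lambda>x y \<phi>. lam_dual (pure A (dual V) x \<phi>) (\<lambda>x' \<phi>'. ?F1 x' y \<phi>')"
  have F1: "trilin A A (dual V) ?F1" by (rule trilin_leg23[OF AAD lin_lam_dual f])
  have F2: "trilin A A (dual V) ?F2" by (rule trilin_leg13[OF AAD lin_lam_dual F1])
  have c13: "leg13 A A (dual V) lam_dual t \<in> carrier (A2 \<otimes> dual V)" if "t \<in> carrier (A2 \<otimes> dual V)" for t
    using lin_leg13[OF AAD lin_lam_dual] that by (simp add: lin_def)
  have c12: "leg12 A A (dual V) G t \<in> carrier (A2 \<otimes> dual V)" if "t \<in> carrier (A2 \<otimes> dual V)" for t
    using lin_leg12[OF AAD G] that by (simp add: lin_def)
  have eq: "?F2 x y \<phi> = (\<Sum>j\<in>U. \<Sum>i\<in>U. f (entry \<phi> i x) (entry (row i) j y) (row j))" for x y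
  proof -
    have "?F2 x y \<phi> = (\<Sum>i\<in>U. ?F1 (entry \<phi> i x) y (row i))"
      by (rule lam_dual_eval[OF \<phi> trilinD(3)[OF F1]]) simp
    also have "\<dots> = (\<Sum>i\<in>U. \<Sum>j\<in>U. f (entry \<phi> i x) (entry (row i) j y) (row j))"
      by (intro sum.cong refl lam_dual_eval[OF row_dual trilinD(2)[OF f]]) simp
    finally show ?thesis by (subst sum.swap)
  qed
  have fb: "bf (\<lambda>x y. f x y (row j))" for j by (rule trilinD(1)[OF f row_dual])
  have bi: "bf (\<lambda>p q. f (entry \<phi> i p) (entry (row i) j q) (row j))" if "i \<in> U" "j \<in> U" for i j
    by (rule bf_entries[OF fb \<phi>l lin_row basis_in[OF that(1)] basis_in[OF that(2)]])
  have bj: "bf (\<lambda>p q. \<Sum>i\<in>U. f (entry \<phi> i p) (entry (row i) j q) (row j))" if "j \<in> U" for j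
    by (rule tens_eval_sum(1)[OF pure_carrier bi[OF _ that]])
  have "eval3 (leg23 A A (dual V) lam_dual (leg13 A A (dual V) lam_dual (leg12 A A (dual V) G ?s))) f
    = eval3 (leg12 A A (dual V) G ?s) ?F2"
    by (simp only: eval3_leg23[OF AAD lin_lam_dual f c13[OF c12[OF s]]] eval3_leg13[OF AAD lin_lam_dual F1 c12[OF s]])
  also have "\<dots> = G (a \<odot> b) (\<lambda>x y. ?F2 x y \<phi>)"
    unfolding eval3_leg12[OF AAD G F2 s] by (rule eval3_pure[OF trilin_leg12[OF AAD G F2] DV \<phi>])
  also have "\<dots> = (\<Sum>j\<in>U. G (a \<odot> b) (\<lambda>p q. \<Sum>i\<in>U. f (entry \<phi> i p) (entry (row i) j q) (row j)))"
    unfolding eq by (rule tens_eval_sum(2)[OF lin_carrier[OF G pure_carrier] bj])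
  finally show "eval3 (leg23 A A (dual V) lam_dual (leg13 A A (dual V) lam_dual (leg12 A A (dual V) G ?s))) f
    = (\<Sum>j\<in>U. \<Sum>i\<in>U. ev (G (a \<odot> b)) (\<lambda>p q. f (entry \<phi> i p) (entry (row i) j q) (row j)))"
    by (simp add: ev_bilin bi tens_eval_sum(2)[OF lin_carrier[OF G pure_carrier] bi])
  have "eval3 (leg23 A A (dual V) lam_dual (leg13 A A (dual V) lam_dual ?s)) f = eval3 ?s ?F2"
    by (simp only: eval3_leg23[OF AAD lin_lam_dual f c13[OF s]] eval3_leg13[OF AAD lin_lam_dual F1 s])
  also have "\<dots> = ?F2 a b \<phi>" by (rule eval3_pure[OF F2 DV \<phi>])
  finally show "eval3 (leg23 A A (dual V) lam_dual (leg13 A A (dual V) lam_dual ?s)) f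
    = (\<Sum>j\<in>U. \<Sum>i\<in>U. f (entry \<phi> i a) (entry (row i) j b) (row j))"
    by (simp only: eq)
  let ?H = "\<lambda>x y \<phi>. G (x \<odot> y) (\<lambda>x' y'. f x' y' \<phi>)"
  have H: "trilin A A (dual V) ?H" by (rule trilin_leg12[OF AAD G f])
  have "eval3 (leg12 A A (dual V) G (leg13 A A (dual V) lam_dual ?s)) f
    = lam_dual (pure A (dual V) a \<phi>) (\<lambda>x' \<phi>'. ?H x' b \<phi>')"
    unfolding eval3_leg12[OF AAD G f c13[OF s]] eval3_leg13[OF AAD lin_lam_dual H s]
    by (rule eval3_pure[OF trilin_leg13[OF AAD lin_lam_dual H] DV \<phi>])
  also have "\<dots> = (\<Sum>j\<in>U. ?H (entry \<phi> j a) b (row j))"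
    by (rule lam_dual_eval[OF \<phi> trilinD(3)[OF H]]) simp
  finally show "eval3 (leg12 A A (dual V) G (leg13 A A (dual V) lam_dual ?s)) f
    = (\<Sum>j\<in>U. ev (G (entry \<phi> j a \<odot> b)) (\<lambda>p q. f p q (row j)))"
    by (simp add: ev_bilin fb)
qed

end

end

section \<open>Independence of the columns\<close>

locale comodule = coaction A E1 E2 T1 T2 T3 T4 counit V U lam
  for A :: "('k::field, 'a::ring) vspace" and E1 E2 T1 T2 T3 T4 counit
    and V :: "('k, 'v::ab_group_add) vspace" and U lam +
  fixes rho :: "('k, 'v, 'a) tensor \<Rightarrow> ('k, 'v, 'a) tensor"
  assumes comodule: "right_comodule A E1 T1 V lam rho"
begin

sublocale R: coaction A E1 E2 T1 T2 T3 T4 counit V U rho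
  by unfold_locales (use V U comodule in \<open>simp_all add: right_comodule_def\<close>)

lemma entry_E1:
  assumes \<phi>: "lin V ground \<phi>" and \<beta>: "bf \<beta>" and v: "v \<in> carrier V"
  shows "(\<Sum>i\<in>U. ev (E1 (a \<odot> b)) (\<lambda>p q. \<beta> (entry \<phi> i p) (entry (row i) v q)))
    = (\<Sum>i\<in>U. \<beta> (entry \<phi> i a) (entry (row i) v b))"
proof -
  have s: "pure (V \<otimes> A) A (pure V A v a) b \<in> carrier (V \<otimes> A \<otimes> A)" using v by (simp add: pure_in_tens)
  have "leg12 V A A lam (leg13 V A A lam (leg23 V A A E1 (pure (V \<otimes> A) A (pure V A v a) b)))
    = leg12 V A A lam (leg13 V A A lam (pure (V \<otimes> A) A (pure V A v a) b))"
    using comodule s by (simp add: right_comodule_def)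
  from arg_cong[OF this, of "\<lambda>s. eval3 s (\<lambda>v p q. \<phi> v * \<beta> p q)"] show ?thesis
    by (simp only: two_coactions[OF \<phi> \<beta> v lin_E1])
qed

lemma entry_T1:
  assumes \<phi>: "lin V ground \<phi>" and \<beta>: "bf \<beta>" and v: "v \<in> carrier V"
  shows "(\<Sum>i\<in>U. ev (T1 (a \<odot> b)) (\<lambda>p q. \<beta> (entry \<phi> i p) (entry (row i) v q)))
    = ev (T1 (entry \<phi> v a \<odot> b)) \<beta>"
proof -
  have s: "pure (V \<otimes> A) A (pure V A v a) b \<in> carrier (V \<otimes> A \<otimes> A)" using v by (simp add: pure_in_tens)
  have "leg12 V A A lam (leg13 V A A lam (leg23 V A A T1 (pure (V \<otimes> A) A (pure V A v a) b)))
    = leg23 V A A T1 (leg12 V A A lam (pure (V \<otimes> A) A (pure V A v a) b))"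
    using comodule s by (simp add: right_comodule_def)
  from arg_cong[OF this, of "\<lambda>s. eval3 s (\<lambda>v p q. \<phi> v * \<beta> p q)"] show ?thesis
    by (simp only: two_coactions[OF \<phi> \<beta> v lin_T1] coaction_then_G[OF \<phi> \<beta> v lin_T1])
qed

lemma entry_rho:
  assumes \<phi>: "lin V ground \<phi>" and v: "v \<in> carrier V"
  shows "a * entry \<phi> v b = R.entry \<phi> v a * b"
proof -
  have "tact V A id ((*) a) (lam (pure V A v b)) = tact V A id (\<lambda>x. x * b) (rho (pure V A v a))"
    using comodule v by (simp add: right_comodule_def)
  from arg_cong[OF this, of "slice_left V A \<phi>"] show ?thesis
    by (simp add: entry_def R.entry_def slice_left_tact[OF V is_vspace_A \<phi>] lin_smul_mult
        lam_carrier[OF v] R.lam_carrier[OF v])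
qed

lemma entry_mult:
  assumes "lin V ground \<phi>" "v \<in> carrier V"
  shows "entry \<phi> v (a * b) = entry \<phi> v a * b"
proof -
  have "c * (entry \<phi> v (a * b) - entry \<phi> v a * b) = 0" for c
    using entry_rho[OF assms, of c "a * b"] arg_cong[OF entry_rho[OF assms, of c a], of "\<lambda>x. x * b"]
    by (simp add: right_diff_distrib mult.assoc)
  then show ?thesis using nondegenerate_right[of "entry \<phi> v (a * b) - entry \<phi> v a * b"] by simp
qed

text \<open>
  In Sweedler notation, \<open>v\<^sub>0 \<epsilon>(v\<^sub>1b) \<otimes> v\<^sub>2y = v\<^sub>0 \<otimes> v\<^sub>1\<pi>(b)y\<close>. By \<open>entry_E1\<close> the left-hand side depends only
  on \<open>E\<^sub>1(b \<otimes> y)\<close>, that is, on elements \<open>\<Delta>(c)(d \<otimes> e)\<close>, for which \<open>entry_T1\<close> moves the comultiplication from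
  the coaction to \<open>A\<close>.
\<close>

lemma counit_entry_pi_L:
  assumes \<phi>: "lin V ground \<phi>" and v: "v \<in> carrier V" and g: "lf g"
  shows "(\<Sum>i\<in>U. counit (entry \<phi> i b) * g (entry (row i) v y)) = g (entry \<phi> v (pi_L b y))"
proof -
  have cd: "lf (\<lambda>x. counit (x * d))" for d by (intro lf_intros)
  have ge: "lf (\<lambda>x. g (entry \<phi> v x))" by (rule lf_comp[OF g lin_entry[OF \<phi> v]])
  have bp: "bf (\<lambda>p q. f p * g q)" if "lf f" for f using that g by (rule bilin_prod)
  define F where "F p q = (\<Sum>i\<in>U. counit (entry \<phi> i p) * g (entry (row i) v q))" for p q
  define G where "G p q = counit p * g (entry \<phi> v q)" for p q
  have F: "bf F" unfolding F_def
    by (rule tens_eval_sum(1)[OF pure_carrier], rule bf_entries[OF bp[OF lin_counit] \<phi> lin_row basis_in v])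
  have G: "bf G" unfolding G_def by (rule bilin_prod[OF lin_counit ge])
  have "F b y = ev (E1 (b \<odot> y)) F"
    unfolding F_def
    by (simp add: ev_sum entry_E1[OF \<phi> bp[OF lin_counit] v])
  also have "\<dots> = ev (E1 (b \<odot> y)) G"
  proof (rule ev_span_eq)
    interpret vector_space pointwise by (rule vector_space_pointwise)
    have "E1 (b \<odot> y) \<in> lspan A2 {E1 (b \<odot> c) | b c. True}"
      unfolding lspan_def smul_tens by (rule span_base) blast
    then show "E1 (b \<odot> y) \<in> lspan A2 {tact A A (\<lambda>x. x * b) id (T1 (a \<odot> c)) | a b c. True}"
      by (simp only: range_E1)
    fix u assume "u \<in> {tact A A (\<lambda>x. x * b) id (T1 (a \<odot> c)) | a b c. True}"
    then obtain c d e where u: "u = tact A A (\<lambda>x. x * d) id (T1 (c \<odot> e))" by blast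
    have "ev u F = ev (T1 (c \<odot> e)) (\<lambda>p q. F (p * d) q)"
      unfolding u by (simp add: ev_tact lin_smul_mult lin_id F)
    also have "\<dots> = (\<Sum>i\<in>U. ev (T1 (c \<odot> e)) (\<lambda>p q. counit (entry \<phi> i p * d) * g (entry (row i) v q)))"
      unfolding F_def by (simp add: ev_sum entry_mult[OF \<phi>] basis_in)
    also have "\<dots> = ev (T1 (entry \<phi> v c \<odot> e)) (\<lambda>p q. counit (p * d) * g q)"
      by (rule entry_T1[OF \<phi> bp[OF cd] v])
    also have "\<dots> = g (entry \<phi> v c * pi_L d e)"
      by (rule mult_pi_L_ev[OF g, symmetric])
    also have "\<dots> = ev (T1 (c \<odot> e)) (\<lambda>p q. counit (p * d) * g (entry \<phi> v q))"
      using mult_pi_L_ev[OF ge, of c d e] by (simp add: entry_mult[OF \<phi> v])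
    also have "\<dots> = ev u G"
      unfolding u by (simp add: ev_tact lin_smul_mult lin_id G) (simp add: G_def)
    finally show "ev u F = ev u G" .
  qed
  also have "\<dots> = g (entry \<phi> v (pi_L b y))"
    unfolding G_def by (rule pi_L_ev[OF ge, symmetric])
  finally show ?thesis by (simp add: F_def)
qed

text \<open>
  A vector is reached if it has the form \<open>\<Sum>\<^sub>m (V \<otimes> \<epsilon>)\<lambda>(m \<otimes> a\<^sub>m)\<close>, the sum being over the basis of \<open>V\<close>, for a family of
  elements of \<open>A\<close> that keeps track of the coaction on \<open>n\<close>: the second condition recovers the coordinates of
  \<open>(V \<otimes> \<epsilon>)\<lambda>(n \<otimes> b)\<close> from it.
\<close>

definition reached :: "'v \<Rightarrow> bool" where
  "reached n \<longleftrightarrow> n \<in> carrier V \<and> (\<exists>a.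
     (\<forall>i\<in>U. row i n = (\<Sum>m\<in>U. counit (entry (row i) m (a m)))) \<and>
     (\<forall>b. \<forall>m\<in>U. counit (pi_L b (a m)) = (\<Sum>i\<in>U. counit (entry (row m) i b) * row i n)))"

lemma lf_counit_pi_L: "lf (\<lambda>a. counit (pi_L b a))"
  unfolding pi_L_ev[OF lin_counit] by (rule lf_ev_pure(2)[OF lin_E1])

lemma reached_lin:
  assumes x: "reached x" and y: "reached y"
  shows "reached (smul V c x + y)"
proof -
  obtain ax where ax: "x \<in> carrier V" "\<And>i. i \<in> U \<Longrightarrow> row i x = (\<Sum>m\<in>U. counit (entry (row i) m (ax m)))"
    "\<And>b m. m \<in> U \<Longrightarrow> counit (pi_L b (ax m)) = (\<Sum>i\<in>U. counit (entry (row m) i b) * row i x)"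
    using x by (auto simp: reached_def)
  obtain ay where ay: "y \<in> carrier V" "\<And>i. i \<in> U \<Longrightarrow> row i y = (\<Sum>m\<in>U. counit (entry (row i) m (ay m)))"
    "\<And>b m. m \<in> U \<Longrightarrow> counit (pi_L b (ay m)) = (\<Sum>i\<in>U. counit (entry (row m) i b) * row i y)"
    using y by (auto simp: reached_def)
  have cx: "smul V c x \<in> carrier V" using ax by (simp add: smul_in_carrier[OF V])
  have r: "row i (smul V c x + y) = c * row i x + row i y" for i
    using lin_row[of i] ax(1) ay(1) cx by (simp add: lin_ground_iff)
  have e: "counit (entry (row i) m (smul A c s + t)) = c * counit (entry (row i) m s) + counit (entry (row i) m t)"
    if "m \<in> U" for i m s t
    using lf_comp[OF lin_counit lin_entry[OF lin_row basis_in[OF that]], of i] by (simp add: lf_iff)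
  have p: "counit (pi_L b (smul A c s + t)) = c * counit (pi_L b s) + counit (pi_L b t)" for b s t
    using lf_counit_pi_L[of b] by (simp add: lf_iff)
  show ?thesis
    unfolding reached_def
  proof (intro conjI exI[of _ "\<lambda>m. smul A c (ax m) + ay m"] ballI allI)
    show "smul V c x + y \<in> carrier V" using cx ay(1) by (rule add_in_carrier[OF V])
    show "row i (smul V c x + y) = (\<Sum>m\<in>U. counit (entry (row i) m (smul A c (ax m) + ay m)))" if "i \<in> U" for i
      by (simp add: r e ax(2)[OF that] ay(2)[OF that] sum_distrib_left sum.distrib)
    show "counit (pi_L b (smul A c (ax m) + ay m)) = (\<Sum>i\<in>U. counit (entry (row m) i b) * row i (smul V c x + y))"
      if "m \<in> U" for b m
      by (simp add: r p ax(3)[OF that] ay(3)[OF that] sum_distrib_left sum.distrib distrib_left mult.left_commute)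
  qed
qed

lemma reached_zero: "reached 0"
proof -
  have z: "row i 0 = 0" for i by (rule lin_zero[OF V is_vspace_ground lin_row])
  have e: "counit (entry (row i) m 0) = 0" if "m \<in> U" for i m
    by (rule lin_zero[OF is_vspace_A is_vspace_ground lf_comp[OF lin_counit lin_entry[OF lin_row basis_in[OF that]]]])
  have p: "counit (pi_L b 0) = 0" for b
    by (rule lin_zero[OF is_vspace_A is_vspace_ground lf_counit_pi_L])
  show ?thesis unfolding reached_def
    by (intro conjI exI[of _ "\<lambda>m. 0"]) (simp_all add: z e p zero_in_carrier[OF V])
qed

lemma row_slice_right:
  assumes "v \<in> carrier V" "lf \<omega>"
  shows "row i (slice_right V A \<omega> (lam (pure V A v y))) = \<omega> (entry (row i) v y)"
  by (simp add: slice_right_eval[OF V is_vspace_A assms(2) lam_carrier[OF assms(1)] lin_row]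
      entry_eval[OF lin_row assms])

lemma lin_slice_lam:
  assumes "v \<in> carrier V" "lf \<omega>"
  shows "lin A V (\<lambda>y. slice_right V A \<omega> (lam (pure V A v y)))"
  by (rule lin_compose[OF lin_compose[OF lin_pure(2)[OF V is_vspace_A assms(1)] lin_lam]
        lin_slice_right[OF V is_vspace_A assms(2)]])

text \<open>
  The coefficients of \<open>v\<^sub>0 \<omega>(v\<^sub>1yz) = v\<^sub>0 \<epsilon>(v\<^sub>1y\<^sub>1) \<omega>(v\<^sub>2y\<^sub>2z)\<close> can be read off if \<open>v\<^sub>2\<close> is split off by means
  of the basis: \<open>a\<^sub>m = y\<^sub>1 \<omega>(L\<^sub>m(y\<^sub>2z))\<close>, where \<open>L\<^sub>m\<close> is the coefficient of row \<open>m\<close> and column \<open>v\<close>. The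
  condition on \<open>\<epsilon>(\<pi>(b)a\<^sub>m)\<close> is then \<open>counit_entry_pi_L\<close>, because
  \<open>\<epsilon>(\<pi>(b)y\<^sub>1) y\<^sub>2z = \<pi>(b)yz\<close>.
\<close>

lemma reached_slice_product:
  assumes v: "v \<in> carrier V" and \<omega>: "lf \<omega>"
  shows "reached (slice_right V A \<omega> (lam (pure V A v (y * z))))"
proof -
  let ?n = "slice_right V A \<omega> (lam (pure V A v (y * z)))"
  have \<omega>e: "lf (\<lambda>q. \<omega> (entry (row m) v q))" for m by (rule lf_comp[OF \<omega> lin_entry[OF lin_row v]])
  define a where "a m = slice_right A A (\<lambda>q. \<omega> (entry (row m) v q)) (T1 (y \<odot> z))" for m
  have a: "g (a m) = ev (T1 (y \<odot> z)) (\<lambda>p q. g p * \<omega> (entry (row m) v q))" if "lf g" for g m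
    unfolding a_def by (rule ev_slice_right[OF \<omega>e _ that]) simp
  have "row i ?n = (\<Sum>m\<in>U. counit (entry (row i) m (a m)))" for i
  proof -
    have "(\<Sum>m\<in>U. counit (entry (row i) m (a m)))
      = (\<Sum>m\<in>U. ev (T1 (y \<odot> z)) (\<lambda>p q. counit (entry (row i) m p) * \<omega> (entry (row m) v q)))"
      by (intro sum.cong refl a lf_comp[OF lin_counit lin_entry[OF lin_row basis_in]])
    also have "\<dots> = ev (T1 (entry (row i) v y \<odot> z)) (\<lambda>p q. counit p * \<omega> q)"
      by (rule entry_T1[OF lin_row bilin_prod[OF lin_counit \<omega>] v])
    finally show ?thesis
      by (simp add: counit_T1_ev[OF \<omega>] row_slice_right[OF v \<omega>] entry_mult[OF lin_row v])
  qed
  moreover have "counit (pi_L b (a m)) = (\<Sum>i\<in>U. counit (entry (row m) i b) * row i ?n)" for b m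
  proof -
    have "counit (pi_L b (a m)) = ev (T1 (y \<odot> z)) (\<lambda>p q. counit (pi_L b p) * \<omega> (entry (row m) v q))"
      by (rule a[OF lf_counit_pi_L])
    also have "\<dots> = ev (T1 (y \<odot> z)) (\<lambda>p q. ev (E1 (b \<odot> p)) (\<lambda>x x'. counit x * counit x' * \<omega> (entry (row m) v q)))"
      by (simp add: pi_L_ev[OF lin_counit] ev_mult_right)
    also have "\<dots> = ev (E1 (b \<odot> y)) (\<lambda>x x'. ev (T1 (x' \<odot> z)) (\<lambda>p q. counit x * counit p * \<omega> (entry (row m) v q)))"
      by (rule E1_T1_ev[OF tf_prod(1)[OF lin_counit lin_counit \<omega>e]])
    also have "\<dots> = ev (E1 (b \<odot> y)) (\<lambda>x x'. counit x * \<omega> (entry (row m) v (x' * z)))"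
      by (simp add: mult.assoc ev_mult_left counit_T1_ev[OF \<omega>e])
    also have "\<dots> = \<omega> (entry (row m) v (pi_L b (y * z)))"
      by (simp add: pi_L_ev[OF \<omega>e] E1_right_ev[OF lin_counit \<omega>e])
    finally show ?thesis
      by (simp add: counit_entry_pi_L[OF lin_row v \<omega>, symmetric] row_slice_right[OF v \<omega>])
  qed
  moreover have "?n \<in> carrier V"
    using lin_slice_lam[OF v \<omega>] by (simp add: lin_def)
  ultimately show ?thesis unfolding reached_def by (intro conjI exI[of _ a]) auto
qed

lemma reached_slice:
  assumes v: "v \<in> carrier V" and \<omega>: "lf \<omega>"
  shows "reached (slice_right V A \<omega> (lam (pure V A v y)))"
proof -
  let ?h = "\<lambda>y. slice_right V A \<omega> (lam (pure V A v y))"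
  have l: "lin A2 V (\<lambda>t. ?h (mu t))" by (rule lin_compose[OF lin_mu lin_slice_lam[OF assms]])
  obtain t where t: "t \<in> carrier A2" "y = mu t" using idempotent by (metis UNIV_I imageE)
  have "reached (?h (mu t))"
    using t(1)
  proof (induction rule: tens_induct)
    case zero
    have "?h (mu 0) = 0" by (rule lin_zero[OF is_vspace_tens V l])
    then show ?case by (simp only: reached_zero)
  next
    case (add c a b t)
    have "?h (mu (smul A2 c (a \<odot> b) + t)) = smul V c (?h (a * b)) + ?h (mu t)"
      using l add(3) smul_in_carrier[OF is_vspace_tens pure_carrier, of c a b]
      by (simp add: lin_def mu_pure[symmetric] del: smul_tens)
    then show ?case by (simp only: reached_lin[OF reached_slice_product[OF assms] add(4)])
  qed
  then show ?thesis using t by simp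
qed

context
  assumes full: "full_right A V lam"
begin

lemma full_induct:
  assumes n: "n \<in> carrier V" and z: "P 0"
    and step: "\<And>c v \<omega> a y. v \<in> carrier V \<Longrightarrow> lf \<omega> \<Longrightarrow> y \<in> carrier V \<Longrightarrow> P y \<Longrightarrow>
      P (smul V c (slice_right V A \<omega> (lam (pure V A v a))) + y)"
  shows "P n"
proof -
  interpret vector_space "smul V" using V by (simp add: is_vspace_def)
  have "n \<in> span {slice_right V A \<omega> (lam (pure V A v a)) | v a \<omega>.
       v \<in> carrier V \<and> a \<in> carrier A \<and> \<omega> \<in> carrier (dual A)}"
    using full n by (simp add: full_right_def lspan_def)
  then have "n \<in> carrier V \<and> P n"
  proof (induction rule: span_induct_alt)
    case base
    then show ?case using z zero_in_carrier[OF V] by simp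
  next
    case (step c x y)
    then obtain v a \<omega> where x: "x = slice_right V A \<omega> (lam (pure V A v a))" "v \<in> carrier V" "lf \<omega>"
      by (auto simp: dual_def)
    have "x \<in> carrier V" using lin_slice_lam[OF x(2,3)] unfolding x(1) by (simp add: lin_def)
    then show ?case using step assms(3)[OF x(2,3), of y c a] x(1)
      by (auto intro: add_in_carrier[OF V] smul_in_carrier[OF V])
  qed
  then show ?thesis by simp
qed

lemma all_reached: "n \<in> carrier V \<Longrightarrow> reached n"
  by (erule full_induct) (auto intro: reached_zero reached_lin reached_slice)

text \<open>
  A relation between the rows is a functional on \<open>V\<close> that vanishes on all slices of the coaction, and these
  span \<open>V\<close>.
\<close>

lemma rows_independent:
  assumes c: "\<And>v g a. v \<in> carrier V \<Longrightarrow> lf g \<Longrightarrow> (\<Sum>i\<in>U. c i * g (entry (row i) v a)) = 0" and j: "j \<in> U"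
  shows "c j = 0"
proof -
  have l: "lin V ground (\<lambda>v. \<Sum>i\<in>U. c i * row i v)"
    using lin_row by (intro lin_sum_maps is_vspace_ground) (auto simp: lin_ground_iff algebra_simps)
  have "(\<Sum>i\<in>U. c i * row i n) = 0" if "n \<in> carrier V" for n
    using that
  proof (rule full_induct)
    show "(\<Sum>i\<in>U. c i * row i 0) = 0" by (rule lin_zero[OF V is_vspace_ground l])
  next
    fix d v \<omega> a y assume v: "v \<in> carrier V" "lf \<omega>" and y: "y \<in> carrier V" "(\<Sum>i\<in>U. c i * row i y) = 0"
    let ?x = "slice_right V A \<omega> (lam (pure V A v a))"
    have x: "?x \<in> carrier V" using lin_slice_lam[OF v] by (simp add: lin_def)
    have "(\<Sum>i\<in>U. c i * row i ?x) = 0" by (simp add: row_slice_right[OF v] c[OF v])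
    then show "(\<Sum>i\<in>U. c i * row i (smul V d ?x + y)) = 0"
      using l x y smul_in_carrier[OF V x, of d] by (simp add: lin_ground_iff)
  qed
  from this[OF basis_in[OF j]] show ?thesis
    using U(1) j by (simp add: dcoord_basis[OF V U j] if_distrib sum.delta cong: if_cong)
qed

text \<open>
  A vector \<open>n\<close> with vanishing coaction is reached by a family \<open>a\<close> with \<open>\<epsilon>(\<pi>(b)a\<^sub>m) = 0\<close>. By
  \<open>counit_left_zero\<close> and the independence of the rows, this family does not contribute to \<open>n\<close>.
\<close>

theorem columns_independent:
  assumes n: "n \<in> carrier V" and zero: "\<And>i a. i \<in> U \<Longrightarrow> entry (row i) n a = 0"
  shows "n = 0"
proof -
  obtain a where a: "\<And>i. i \<in> U \<Longrightarrow> row i n = (\<Sum>m\<in>U. counit (entry (row i) m (a m)))"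
    "\<And>b m. m \<in> U \<Longrightarrow> counit (pi_L b (a m)) = (\<Sum>i\<in>U. counit (entry (row m) i b) * row i n)"
    using all_reached[OF n] by (auto simp: reached_def)
  have c0: "lf g \<Longrightarrow> g 0 = 0" for g by (rule lin_zero[OF is_vspace_A is_vspace_ground])
  have "counit (pi_L b (a m)) = 0" if "m \<in> U" for b m
    using entry_sum[OF lin_row n lin_counit, of m b] zero[OF that, of b]
    by (simp add: a(2)[OF that] c0[OF lin_counit] mult.commute)
  then have za: "counit (z * a m) = 0" if "m \<in> U" for z m
    using that by (intro counit_left_zero)
  have pi0: "pi_L (a m) y = 0" if m: "m \<in> U" for m y
  proof (rule nondegenerate_right, intro allI)
    fix u
    show "u * pi_L (a m) y = 0"
    proof (rule functional_eqD)
      fix k assume k: "lf k"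
      show "k (u * pi_L (a m) y) = k 0"
        using ev_mult_left[of "T1 (u \<odot> y)" 0] by (simp add: mult_pi_L_ev[OF k] za[OF m] c0[OF k])
    qed
  qed
  have "counit (entry (row i) j (a m)) = 0" if m: "m \<in> U" and j: "j \<in> U" for i j m
  proof (rule rows_independent[OF _ j])
    fix v g y assume v: "v \<in> carrier V" and g: "lf g"
    have "entry (row i) v 0 = 0" by (rule lin_zero[OF is_vspace_A is_vspace_A lin_entry[OF lin_row v]])
    then show "(\<Sum>j\<in>U. counit (entry (row i) j (a m)) * g (entry (row j) v y)) = 0"
      by (simp add: counit_entry_pi_L[OF lin_row v g] pi0[OF m] c0[OF g])
  qed
  then have "row i n = 0" if "i \<in> U" for i using that by (simp add: a(1))
  then show ?thesis
  proof -
    interpret vector_space "smul V" using V by (simp add: is_vspace_def)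
    assume "\<And>i. i \<in> U \<Longrightarrow> row i n = 0"
    then show ?thesis using dcoord_expand[OF V U n] by simp
  qed
qed

end

section \<open>The dual comodule\<close>

text \<open>
  Evaluated at trilinear forms, the axioms of the dual are sums over the columns of the identities
  \<open>entry_E1\<close> and \<open>entry_T1\<close> for the coefficients of \<open>V\<close>.
\<close>

lemma left_comodule_dual:
  assumes B: "is_basis A B"
  shows "left_comodule A E1 T1 (dual V) (dual_coaction A B V lam) (dual_coaction A B V rho)"
proof -
  note DV = is_vspace_dual[OF V]
  note AAD = is_vspace_A is_vspace_A DV
  note ld = lin_lam_dual[OF B] and rd = R.lin_lam_dual[OF B]
  let ?l = "dual_coaction A B V lam" and ?r = "dual_coaction A B V rho"
  have dl: "lin V ground \<phi>" if "\<phi> \<in> carrier (dual V)" for \<phi> using that by (simp add: dual_def)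
  have lins: "lin (A2 \<otimes> dual V) (A2 \<otimes> dual V) (\<lambda>t. leg23 A A (dual V) ?l (leg13 A A (dual V) ?l (leg12 A A (dual V) G t)))"
    "lin (A2 \<otimes> dual V) (A2 \<otimes> dual V) (\<lambda>t. leg12 A A (dual V) G (leg13 A A (dual V) ?l t))"
    "lin (A2 \<otimes> dual V) (A2 \<otimes> dual V) (\<lambda>t. leg23 A A (dual V) ?l (leg13 A A (dual V) ?l t))"
    if G: "lin A2 A2 G" for G
    by (intro lin_compose[OF lin_leg12[OF AAD G] lin_compose[OF lin_leg13[OF AAD ld] lin_leg23[OF AAD ld]]]
      lin_compose[OF lin_leg13[OF AAD ld] lin_leg12[OF AAD G]] lin_compose[OF lin_leg13[OF AAD ld] lin_leg23[OF AAD ld]])+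
  have compat: "tact A (dual V) ((*) a) id (?l (pure A (dual V) b \<phi>))
      = tact A (dual V) (\<lambda>x. x * b) id (?r (pure A (dual V) a \<phi>))"
    if \<phi>: "\<phi> \<in> carrier (dual V)" for a b \<phi>
  proof -
    have t: "tact A (dual V) h id (\<Sum>j\<in>U. pure A (dual V) (x j) (row j)) = (\<Sum>j\<in>U. pure A (dual V) (h (x j)) (row j))"
      if h: "lin A A h" for h x
    proof -
      have l: "lin (A \<otimes> dual V) (A \<otimes> dual V) (tact A (dual V) h id)"
        unfolding tact_def by (rule lin_tens_map[OF h lin_id(1) is_vspace_A DV])
      show ?thesis
        by (subst lin_sum[OF is_vspace_tens is_vspace_tens l])
          (simp_all add: pure_in_tens row_dual tact_def tens_map_pure[OF h lin_id(1) is_vspace_A DV])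
    qed
    show ?thesis
      by (simp add: lam_dual_pure[OF B \<phi>] R.lam_dual_pure[OF B \<phi>] t lin_smul_mult
          entry_rho[OF dl[OF \<phi>] basis_in] cong: sum.cong)
  qed
  have E: "leg23 A A (dual V) ?l (leg13 A A (dual V) ?l (leg12 A A (dual V) E1 t))
    = leg23 A A (dual V) ?l (leg13 A A (dual V) ?l t)" if "t \<in> carrier (A2 \<otimes> dual V)" for t
  proof (rule lin_tens3_eqI[OF AAD is_vspace_tens lins(1)[OF lin_E1] lins(3)[OF lin_E1] _ that])
    fix a b \<phi> assume \<phi>: "\<phi> \<in> carrier (dual V)"
    let ?s = "pure A2 (dual V) (a \<odot> b) \<phi>"
    have s: "?s \<in> carrier (A2 \<otimes> dual V)" using \<phi> by (simp add: pure_in_tens)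
    show "leg23 A A (dual V) ?l (leg13 A A (dual V) ?l (leg12 A A (dual V) E1 ?s))
      = leg23 A A (dual V) ?l (leg13 A A (dual V) ?l ?s)"
    proof (rule eval3_eqI[OF AAD])
      fix f assume f: "trilin A A (dual V) f"
      show "eval3 (leg23 A A (dual V) ?l (leg13 A A (dual V) ?l (leg12 A A (dual V) E1 ?s))) f
        = eval3 (leg23 A A (dual V) ?l (leg13 A A (dual V) ?l ?s)) f"
        unfolding eval3_lam_dual(1)[OF B f \<phi> lin_E1] eval3_lam_dual(2)[OF B f \<phi> lin_E1]
        by (intro sum.cong refl entry_E1[OF dl[OF \<phi>] trilinD(1)[OF f row_dual]] basis_in)
    qed (use lins(1)[OF lin_E1] lins(3)[OF lin_E1] s in \<open>simp_all add: lin_def\<close>)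
  qed
  have T: "leg23 A A (dual V) ?l (leg13 A A (dual V) ?l (leg12 A A (dual V) T1 t))
    = leg12 A A (dual V) T1 (leg13 A A (dual V) ?l t)" if "t \<in> carrier (A2 \<otimes> dual V)" for t
  proof (rule lin_tens3_eqI[OF AAD is_vspace_tens lins(1)[OF lin_T1] lins(2)[OF lin_T1] _ that])
    fix a b \<phi> assume \<phi>: "\<phi> \<in> carrier (dual V)"
    let ?s = "pure A2 (dual V) (a \<odot> b) \<phi>"
    have s: "?s \<in> carrier (A2 \<otimes> dual V)" using \<phi> by (simp add: pure_in_tens)
    show "leg23 A A (dual V) ?l (leg13 A A (dual V) ?l (leg12 A A (dual V) T1 ?s))
      = leg12 A A (dual V) T1 (leg13 A A (dual V) ?l ?s)"
    proof (rule eval3_eqI[OF AAD])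
      fix f assume f: "trilin A A (dual V) f"
      show "eval3 (leg23 A A (dual V) ?l (leg13 A A (dual V) ?l (leg12 A A (dual V) T1 ?s))) f
        = eval3 (leg12 A A (dual V) T1 (leg13 A A (dual V) ?l ?s)) f"
        unfolding eval3_lam_dual(1)[OF B f \<phi> lin_T1] eval3_lam_dual(3)[OF B f \<phi> lin_T1]
        by (intro sum.cong refl entry_T1[OF dl[OF \<phi>] trilinD(1)[OF f row_dual]] basis_in)
    qed (use lins(1)[OF lin_T1] lins(2)[OF lin_T1] s in \<open>simp_all add: lin_def\<close>)
  qed
  show ?thesis
    unfolding left_comodule_def using DV ld rd compat E T by blast
qed

text \<open>
  As \<open>V\<close> has finite dimension, a functional on the dual that vanishes on all slices of the dual coaction
  is evaluation at a vector of \<open>V\<close>. The coaction vanishes on this vector, so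
  \<open>columns_independent\<close> applies.
\<close>

lemma full_left_dual:
  assumes B: "is_basis A B" and full: "full_right A V lam"
  shows "full_left A (dual V) (dual_coaction A B V lam)"
proof -
  interpret P: vector_space pointwise by (rule vector_space_pointwise)
  interpret K: vector_space "(*) :: 'k \<Rightarrow> 'k \<Rightarrow> 'k" by unfold_locales (auto simp: algebra_simps)
  interpret PK: vector_space_pair "pointwise :: 'k \<Rightarrow> ('v \<Rightarrow> 'k) \<Rightarrow> _" "(*) :: 'k \<Rightarrow> 'k \<Rightarrow> 'k" ..
  note DV = is_vspace_dual[OF V]
  define S where "S = {slice_left A (dual V) \<omega> (dual_coaction A B V lam (pure A (dual V) a \<phi>)) | a \<phi> \<omega>.
       \<phi> \<in> carrier (dual V) \<and> a \<in> carrier A \<and> \<omega> \<in> carrier (dual A)}"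
  have lfd: "\<omega> \<in> carrier (dual A) \<longleftrightarrow> lf \<omega>" for \<omega> by (simp add: dual_def)
  have sl: "slice_left A (dual V) \<omega> (dual_coaction A B V lam (pure A (dual V) a \<phi>))
      = (\<Sum>j\<in>U. pointwise (\<omega> (entry \<phi> j a)) (row j))"
    if \<phi>: "\<phi> \<in> carrier (dual V)" and \<omega>: "lf \<omega>" for a \<phi> \<omega>
    unfolding lam_dual_pure[OF B \<phi>]
    by (subst lin_sum[OF is_vspace_tens DV lin_slice_left[OF is_vspace_A DV \<omega>]])
      (simp_all add: pure_in_tens row_dual slice_left_pure[OF is_vspace_A DV \<omega>])
  have S_sub: "S \<subseteq> carrier (dual V)"
    using smul_in_carrier[OF DV row_dual]
    by (auto simp: S_def lfd sl intro!: sum_in_carrier[OF DV])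
  have "carrier (dual V) \<subseteq> P.span S"
  proof
    fix \<psi> assume \<psi>: "\<psi> \<in> carrier (dual V)"
    show "\<psi> \<in> P.span S"
    proof (rule ccontr)
      assume n: "\<psi> \<notin> P.span S"
      obtain S' where S': "S' \<subseteq> S" "P.independent S'" "S \<subseteq> P.span S'"
        using P.maximal_independent_subset by blast
      have "P.span S' = P.span S"
        using S' P.span_mono P.span_minimal P.subspace_span by (metis subset_antisym)
      then have "\<psi> \<notin> P.span S'" using n by simp
      then have "P.independent (insert \<psi> S')" using S'(2) P.independent_insertI by blast
      from PK.linear_independent_extend[OF this, of "\<lambda>x. if x = \<psi> then 1 else 0"] obtain g
        where g: "Vector_Spaces.linear pointwise (*) g" "\<forall>x\<in>insert \<psi> S'. g x = (if x = \<psi> then 1 else 0)" by blast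
      interpret g: Vector_Spaces.linear pointwise "(*)" g by (rule g)
      have g1: "g \<psi> = 1" using g(2) by simp
      have g0: "g x = 0" if "x \<in> S" for x
      proof -
        have "x \<in> P.span S'" using that S'(3) by blast
        moreover have "g y = 0" if "y \<in> S'" for y
          using g(2) that \<open>\<psi> \<notin> P.span S'\<close> P.span_base[OF that] by auto
        ultimately show ?thesis by (induction rule: P.span_induct_alt) (auto simp: g.add g.scale g.zero)
      qed
      \<comment> \<open>The vector at which \<open>g\<close> evaluates the elements of the dual.\<close>
      define m where "m = (\<Sum>j\<in>U. smul V (g (row j)) j)"
      have m: "m \<in> carrier V"
        unfolding m_def by (intro sum_in_carrier[OF V] smul_in_carrier[OF V] basis_in)
      have lm: "f m = (\<Sum>j\<in>U. g (row j) * f j)" if f: "lin V ground f" for f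
        unfolding m_def using f
        by (subst lin_sum[OF V is_vspace_ground f]) (auto simp: smul_in_carrier[OF V] basis_in lin_ground_iff)
      have "entry (row i) m a = 0" for i a
      proof (rule functional_eqD)
        fix \<omega> assume \<omega>: "lf \<omega>"
        have "\<omega> (entry (row i) m a) = (\<Sum>j\<in>U. g (row j) * \<omega> (entry (row i) j a))"
          by (rule lm[OF lin_compose[OF lin_entry_vector[OF lin_row] \<omega>]])
        also have "\<dots> = g (\<Sum>j\<in>U. pointwise (\<omega> (entry (row i) j a)) (row j))"
          by (simp add: g.sum g.scale mult.commute)
        also have "\<dots> = 0"
          unfolding sl[OF row_dual \<omega>, symmetric]
          by (rule g0) (unfold S_def lfd, use row_dual \<omega> in_A in blast)
        also have "0 = \<omega> 0" by (rule lin_zero[OF is_vspace_A is_vspace_ground \<omega>, symmetric])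
        finally show "\<omega> (entry (row i) m a) = \<omega> 0" .
      qed
      then have m0: "m = 0" by (rule columns_independent[OF full m])
      have "g (row j) = 0" if j: "j \<in> U" for j
      proof -
        have "row j m = (\<Sum>i\<in>U. g (row i) * row j i)" by (rule lm[OF lin_row])
        also have "\<dots> = g (row j)"
          using U(1) j by (simp add: dcoord_basis[OF V U] if_distrib cong: if_cong sum.cong)
        finally show ?thesis by (simp add: m0 lin_zero[OF V is_vspace_ground lin_row])
      qed
      moreover have "g \<psi> = (\<Sum>j\<in>U. \<psi> j * g (row j))"
        by (subst dual_expand[OF V U \<psi>]) (simp add: g.sum g.scale)
      ultimately show False using g1 by simp
    qed
  qed
  moreover have "P.span S \<subseteq> carrier (dual V)"
    using DV S_sub by (intro P.span_minimal) (simp_all add: is_vspace_def)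
  ultimately show ?thesis
    unfolding full_left_def lspan_def S_def[symmetric] smul_dual by blast
qed

end

theorem proposition6p2:
  fixes A :: "('k::field, 'a::ring) vspace" and V :: "('k, 'v::ab_group_add) vspace"
  assumes "regular_weak_multiplier_bialgebra A E1 E2 T1 T2 T3 T4 counit"
    and "right_full_comultiplication A T1"
    and "right_comodule A E1 T1 V lam rho"
    and "fin_dim V"
    and "full_right A V lam"
    and "is_basis A B"
  shows "left_comodule A E1 T1 (dual V) (dual_coaction A B V lam) (dual_coaction A B V rho) \<and>
    full_left A (dual V) (dual_coaction A B V lam)"
proof -
  interpret regular_weak_multiplier_bialgebra A E1 E2 T1 T2 T3 T4 counit by (rule assms(1))
  have V: "is_vspace V" using assms(3) by (simp add: right_comodule_def)
  obtain U where U: "finite U" "is_basis V U" using fin_dim_basis[OF V assms(4)] .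
  interpret comodule A E1 E2 T1 T2 T3 T4 counit V U lam rho
    by unfold_locales (use V U assms(3) in \<open>simp_all add: right_comodule_def\<close>)
  show ?thesis using left_comodule_dual full_left_dual assms(5,6) by blast
qed

end
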